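(* Let $K$ be a connected $2$-dimensional regular CW-complex and let $K'$ be its barycentric subdivision. Let $L\subseteq K'$ be the full (one-dimensional) subcomplex spanned by the barycenters of the $2$-cells of $K$ and the barycenters of those $1$-cells of $K$ which are faces of exactly two $2$-cells. Suppose that for every connected component $M$ of $L$, the subgroup $i_*(\pi_1(M))\leq \pi_1(K')$ contains an element of infinite order, where $i_*:\pi_1(M)\to\pi_1(K')$ is the homomorphism induced by the inclusion $M\hookrightarrow K'$ (base points taken in $M$). Then $K$ is aspherical.
   Context: The barycentric subdivision $K'$ of a regular CW-complex $K$ is the simplicial complex whose vertices are the cells of $K$ (each cell being identified with its barycenter) and whose simplices are the finite chains of cells of $K$ ordered by the face relation; it is homeomorphic to $K$. The full subcomplex spanned by a set $S$ of vertices consists of all simplices of $K'$ whose vertices all lie in $S$. A connected $2$-dimensional CW-complex $K$ is called aspherical if $\pi_2(K)=0$. *)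

theory Defs
  imports "HOL-Analysis.Analysis" "HOL-Algebra.Group"
begin

section \<open>Regular CW-complexes\<close>

definition disc :: "nat \<Rightarrow> (nat \<Rightarrow> real) topology" where
  "disc n = subtopology (Euclidean_space n) {x. (\<Sum>i<n. (x i)\<^sup>2) \<le> 1}"

definition disc_interior :: "nat \<Rightarrow> (nat \<Rightarrow> real) set" where
  "disc_interior n = {x \<in> topspace (Euclidean_space n). (\<Sum>i<n. (x i)\<^sup>2) < 1}"

definition disc_boundary :: "nat \<Rightarrow> (nat \<Rightarrow> real) set" where
  "disc_boundary n = {x \<in> topspace (Euclidean_space n). (\<Sum>i<n. (x i)\<^sup>2) = 1}"

text \<open>
  The complex is the space \<open>X\<close> together with its sets \<open>cells n\<close> of open \<open>n\<close>-cells. Regularity is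
  the requirement that the characteristic maps can be chosen to be embeddings of the closed disc.
  The complex may be infinite and need not be locally finite; its topology is the weak topology.
\<close>

locale regular_CW_complex =
  fixes X :: "'a topology" and cells :: "nat \<Rightarrow> 'a set set"
  assumes Hausdorff: "Hausdorff_space X"
    and cells_cover: "(\<Union>n. \<Union>(cells n)) = topspace X"
    and cells_disjoint:
      "\<And>m n e f. \<lbrakk>e \<in> cells m; f \<in> cells n; e \<inter> f \<noteq> {}\<rbrakk> \<Longrightarrow> m = n \<and> e = f"
    and characteristic_map:
      "\<And>n e. e \<in> cells n \<Longrightarrow>
         \<exists>\<Phi>. embedding_map (disc n) X \<Phi> \<and> \<Phi> ` disc_interior n = e \<and>
             (\<exists>F. finite F \<and> F \<subseteq> (\<Union>m<n. cells m) \<and> \<Phi> ` disc_boundary n \<subseteq> \<Union>F)"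
    and weak_topology:
      "\<And>A. \<lbrakk>A \<subseteq> topspace X; \<And>n e. e \<in> cells n \<Longrightarrow> closedin X (A \<inter> X closure_of e)\<rbrakk>
         \<Longrightarrow> closedin X A"

definition two_dimensional :: "(nat \<Rightarrow> 'a set set) \<Rightarrow> bool" where
  "two_dimensional cells \<longleftrightarrow> cells 2 \<noteq> {} \<and> (\<forall>n>2. cells n = {})"

text \<open>Cells are open cells, so the faces of \<open>f\<close> are the cells contained in its closure.\<close>

definition face_of_cell :: "'a topology \<Rightarrow> 'a set \<Rightarrow> 'a set \<Rightarrow> bool" where
  "face_of_cell X e f \<longleftrightarrow> e \<subseteq> X closure_of f"

section \<open>Simplicial complexes and the barycentric subdivision\<close>

text \<open>
  An abstract simplicial complex is given by its set of (nonempty, finite) simplices. Its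
  geometric realization consists of barycentric coordinate functions on the vertices and carries
  the weak topology with respect to the closed simplices.
\<close>

definition closed_simplex :: "'v set \<Rightarrow> ('v \<Rightarrow> real) set" where
  "closed_simplex \<sigma> = {a. (\<forall>v. 0 \<le> a v) \<and> (\<forall>v. v \<notin> \<sigma> \<longrightarrow> a v = 0) \<and> (\<Sum>v\<in>\<sigma>. a v) = 1}"

definition underlying_space :: "'v set set \<Rightarrow> ('v \<Rightarrow> real) set" where
  "underlying_space K = (\<Union>\<sigma>\<in>K. closed_simplex \<sigma>)"

definition realization :: "'v set set \<Rightarrow> ('v \<Rightarrow> real) topology" where
  "realization K = topology (\<lambda>U. U \<subseteq> underlying_space K \<and>
     (\<forall>\<sigma>\<in>K. openin (subtopology (powertop_real UNIV) (closed_simplex \<sigma>)) (U \<inter> closed_simplex \<sigma>)))"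

lemma istopology_weak:
  fixes T :: "'i \<Rightarrow> 'a topology" and C :: "'i \<Rightarrow> 'a set"
  shows "istopology (\<lambda>U. U \<subseteq> S \<and> (\<forall>i\<in>I. openin (T i) (U \<inter> C i)))"
  unfolding istopology_def
proof (intro conjI allI impI)
  fix U V
  assume U: "U \<subseteq> S \<and> (\<forall>i\<in>I. openin (T i) (U \<inter> C i))"
    and V: "V \<subseteq> S \<and> (\<forall>i\<in>I. openin (T i) (V \<inter> C i))"
  show "U \<inter> V \<subseteq> S"
    using U by blast
  have eq: "U \<inter> V \<inter> C i = (U \<inter> C i) \<inter> (V \<inter> C i)" for i
    by blast
  show "\<forall>i\<in>I. openin (T i) (U \<inter> V \<inter> C i)"
    unfolding eq using U V openin_Int by blast
next
  fix \<U>
  assume \<U>: "\<forall>U\<in>\<U>. U \<subseteq> S \<and> (\<forall>i\<in>I. openin (T i) (U \<inter> C i))"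
  show "\<Union>\<U> \<subseteq> S"
    using \<U> by blast
  have eq: "\<Union>\<U> \<inter> C i = \<Union>((\<lambda>U. U \<inter> C i) ` \<U>)" for i
    by blast
  show "\<forall>i\<in>I. openin (T i) (\<Union>\<U> \<inter> C i)"
    unfolding eq using \<U> by (intro ballI openin_Union) blast
qed

lemma openin_realization:
  "openin (realization K) U \<longleftrightarrow> U \<subseteq> underlying_space K \<and>
     (\<forall>\<sigma>\<in>K. openin (subtopology (powertop_real UNIV) (closed_simplex \<sigma>)) (U \<inter> closed_simplex \<sigma>))"
  unfolding realization_def by (subst topology_inverse'[OF istopology_weak]) (rule refl)

lemma topspace_realization: "topspace (realization K) = underlying_space K"
proof (rule equalityI)
  show "topspace (realization K) \<subseteq> underlying_space K"
    using openin_topspace[of "realization K"] unfolding openin_realization by (rule conjunct1)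
  have "underlying_space K \<inter> closed_simplex \<sigma>
          = topspace (subtopology (powertop_real UNIV) (closed_simplex \<sigma>))" if "\<sigma> \<in> K" for \<sigma>
    using that by (auto simp: underlying_space_def)
  then have "openin (realization K) (underlying_space K)"
    unfolding openin_realization by (metis openin_topspace order_refl)
  then show "underlying_space K \<subseteq> topspace (realization K)"
    by (rule openin_subset)
qed

definition full_subcomplex :: "'v set set \<Rightarrow> 'v set \<Rightarrow> 'v set set" where
  "full_subcomplex K S = {\<sigma> \<in> K. \<sigma> \<subseteq> S}"

definition barycentric_subdivision :: "'a topology \<Rightarrow> (nat \<Rightarrow> 'a set set) \<Rightarrow> 'a set set set" where
  "barycentric_subdivision X cells =
     {\<sigma>. \<sigma> \<noteq> {} \<and> finite \<sigma> \<and> \<sigma> \<subseteq> (\<Union>n. cells n) \<and>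
         (\<forall>e\<in>\<sigma>. \<forall>f\<in>\<sigma>. face_of_cell X e f \<or> face_of_cell X f e)}"

definition two_sided_subcomplex :: "'a topology \<Rightarrow> (nat \<Rightarrow> 'a set set) \<Rightarrow> 'a set set set" where
  "two_sided_subcomplex X cells = full_subcomplex (barycentric_subdivision X cells)
     (cells 2 \<union> {e \<in> cells 1. card {f \<in> cells 2. face_of_cell X e f} = 2})"

section \<open>Homotopy groups\<close>

text \<open>
  Maps of pairs \<open>(D, B) \<rightarrow> (X, x)\<close> up to homotopy relative to \<open>B\<close>, with a multiplication induced
  by an operation \<open>cat\<close> on such maps. A class contains maps that are unconstrained outside the
  domain \<open>D\<close>.
\<close>

definition based_maps :: "'d topology \<Rightarrow> 'd set \<Rightarrow> 'a topology \<Rightarrow> 'a \<Rightarrow> ('d \<Rightarrow> 'a) set" where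
  "based_maps D B X x = {f. continuous_map D X f \<and> (\<forall>t\<in>B. f t = x)}"

definition based_class ::
    "'d topology \<Rightarrow> 'd set \<Rightarrow> 'a topology \<Rightarrow> 'a \<Rightarrow> ('d \<Rightarrow> 'a) \<Rightarrow> ('d \<Rightarrow> 'a) set" where
  "based_class D B X x f = {g. homotopic_with (\<lambda>h. \<forall>t\<in>B. h t = x) D X f g}"

definition based_group ::
    "'d topology \<Rightarrow> 'd set \<Rightarrow> (('d \<Rightarrow> 'a) \<Rightarrow> ('d \<Rightarrow> 'a) \<Rightarrow> 'd \<Rightarrow> 'a) \<Rightarrow> 'a topology \<Rightarrow> 'a
     \<Rightarrow> ('d \<Rightarrow> 'a) set monoid" where
  "based_group D B cat X x =
     \<lparr>carrier = based_class D B X x ` based_maps D B X x,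
      monoid.mult = (\<lambda>a b. \<Union>f\<in>a. \<Union>g\<in>b. based_class D B X x (cat f g)),
      one = based_class D B X x (\<lambda>_. x)\<rparr>"

definition interval_cat :: "(real \<Rightarrow> 'a) \<Rightarrow> (real \<Rightarrow> 'a) \<Rightarrow> real \<Rightarrow> 'a" where
  "interval_cat f g = (\<lambda>t. if t \<le> 1/2 then f (2 * t) else g (2 * t - 1))"

definition square_cat :: "(real \<times> real \<Rightarrow> 'a) \<Rightarrow> (real \<times> real \<Rightarrow> 'a) \<Rightarrow> real \<times> real \<Rightarrow> 'a" where
  "square_cat f g = (\<lambda>(s, t). if s \<le> 1/2 then f (2 * s, t) else g (2 * s - 1, t))"

definition fundamental_group :: "'a topology \<Rightarrow> 'a \<Rightarrow> (real \<Rightarrow> 'a) set monoid" where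
  "fundamental_group = based_group (top_of_set {0..1}) {0, 1} interval_cat"

definition second_homotopy_group :: "'a topology \<Rightarrow> 'a \<Rightarrow> (real \<times> real \<Rightarrow> 'a) set monoid" where
  "second_homotopy_group = based_group (top_of_set ({0..1} \<times> {0..1}))
     ({0, 1} \<times> {0..1} \<union> {0..1} \<times> {0, 1}) square_cat"

definition fundamental_group_induced ::
    "'b topology \<Rightarrow> 'b \<Rightarrow> ('a \<Rightarrow> 'b) \<Rightarrow> (real \<Rightarrow> 'a) set \<Rightarrow> (real \<Rightarrow> 'b) set" where
  "fundamental_group_induced Y y \<phi> a =
     (\<Union>f\<in>a. based_class (top_of_set {0..1}) {0, 1} Y y (\<phi> \<circ> f))"

definition has_infinite_order :: "('g, 'm) monoid_scheme \<Rightarrow> 'g \<Rightarrow> bool" where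
  "has_infinite_order G a \<longleftrightarrow> (\<forall>n::nat. n > 0 \<longrightarrow> a [^]\<^bsub>G\<^esub> n \<noteq> \<one>\<^bsub>G\<^esub>)"

definition aspherical :: "'a topology \<Rightarrow> bool" where
  "aspherical X \<longleftrightarrow> (\<forall>x\<in>topspace X.
     carrier (second_homotopy_group X x) = {\<one>\<^bsub>second_homotopy_group X x\<^esub>})"

end

theory Submission
  imports Defs
begin

text \<open>
  Why the theorem holds. Pass to the universal cover of the complex. An edge with exactly two
  adjacent 2-cells keeps this property there, so the preimage of \<open>L\<close> records which 2-cells of the
  cover are neighbours across such edges. A component of the preimage lies over a component \<open>M\<close> of
  \<open>L\<close>. Lifting the powers of a loop of infinite order in \<open>M\<close>, one reaches infinitely many of its
  vertices, hence infinitely many of its 2-cells. Consequently a finite nonempty set of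
  2-cells of the cover is never closed under taking neighbours: one of its members has a
  two-sided edge whose other 2-cell is outside the set (\<open>free_face\<close>).

  A map of a sphere lifts to the cover and meets only finitely many 2-cells there. One of them has a
  free face among them, and the sphere can be pushed off that 2-cell through the free face without
  touching any other 2-cell (\<open>collapse_cell\<close>). After finitely many such pushes the sphere lies in a
  graph. There it lifts once more, to the tree of reduced walks, and is contracted by moving the
  deepest nodes to their parents (\<open>graph_null_sphere\<close>). This replaces the homology of the universal
  cover and the Hurewicz theorem by an elementary collapsing argument.

  All deformations take place in realizations of simplicial complexes, where they are given by
  formulas in barycentric coordinates. Coverings are treated as vertex maps with unique lifting of
  simplices (\<open>simplicial_cover\<close>); the vertices of the universal cover are homotopy classes of paths.
  The result is carried over to the cell complex by an explicit homeomorphism with its barycentric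
  subdivision (\<open>to_sd\<close> and \<open>of_sd\<close>), which rests on the fact that the boundary circle of a 2-cell is
  a union of cells (\<open>edge_in_boundary\<close>). Spheres are contracted freely throughout; base points return
  only in \<open>null_sphere_imp_based\<close>.
\<close>

section \<open>Simplicial complexes and their realizations\<close>

definition supp :: "('v \<Rightarrow> real) \<Rightarrow> 'v set" where
  "supp y = {v. y v \<noteq> 0}"

definition simplicial :: "'v set set \<Rightarrow> bool" where
  "simplicial K \<longleftrightarrow> (\<forall>\<sigma>\<in>K. finite \<sigma> \<and> \<sigma> \<noteq> {} \<and> (\<forall>\<tau>. \<tau> \<subseteq> \<sigma> \<longrightarrow> \<tau> \<noteq> {} \<longrightarrow> \<tau> \<in> K))"

lemma simplicialD:
  assumes "simplicial K" "\<sigma> \<in> K"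
  shows "finite \<sigma>" "\<sigma> \<noteq> {}" "\<And>\<tau>. \<tau> \<subseteq> \<sigma> \<Longrightarrow> \<tau> \<noteq> {} \<Longrightarrow> \<tau> \<in> K"
  using assms unfolding simplicial_def by blast+

lemma simplicial_full_subcomplex: "simplicial K \<Longrightarrow> simplicial (full_subcomplex K S)"
  by (auto simp: simplicial_def full_subcomplex_def)

lemma in_supp [simp]: "v \<in> supp y \<longleftrightarrow> y v \<noteq> 0"
  by (simp add: supp_def)

lemma closed_simplex_iff:
  assumes "finite \<sigma>"
  shows "y \<in> closed_simplex \<sigma> \<longleftrightarrow> (\<forall>v. 0 \<le> y v) \<and> supp y \<subseteq> \<sigma> \<and> sum y (supp y) = 1"
proof -
  have "sum y (supp y) = sum y \<sigma>" if "supp y \<subseteq> \<sigma>"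
    using that assms by (intro sum.mono_neutral_left) auto
  moreover have "supp y \<subseteq> \<sigma> \<longleftrightarrow> (\<forall>v. v \<notin> \<sigma> \<longrightarrow> y v = 0)"
    by (auto simp: supp_def)
  ultimately show ?thesis
    unfolding closed_simplex_def by auto
qed

lemma space_iff:
  assumes "simplicial K"
  shows "y \<in> underlying_space K \<longleftrightarrow> supp y \<in> K \<and> (\<forall>v. 0 \<le> y v) \<and> sum y (supp y) = 1"
proof
  assume "y \<in> underlying_space K"
  then obtain \<sigma> where \<sigma>: "\<sigma> \<in> K" "y \<in> closed_simplex \<sigma>"
    by (auto simp: underlying_space_def)
  then have "(\<forall>v. 0 \<le> y v) \<and> supp y \<subseteq> \<sigma> \<and> sum y (supp y) = 1"
    using closed_simplex_iff simplicialD(1)[OF assms] by blast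
  moreover from this have "supp y \<noteq> {}"
    by auto
  ultimately show "supp y \<in> K \<and> (\<forall>v. 0 \<le> y v) \<and> sum y (supp y) = 1"
    using simplicialD(3)[OF assms \<sigma>(1)] by auto
next
  assume "supp y \<in> K \<and> (\<forall>v. 0 \<le> y v) \<and> sum y (supp y) = 1"
  then show "y \<in> underlying_space K"
    using closed_simplex_iff[of "supp y" y] simplicialD(1)[OF assms]
    by (auto simp: underlying_space_def)
qed

lemma space_supp_nonempty:
  assumes "simplicial K" "y \<in> underlying_space K"
  obtains v where "y v > 0" "v \<in> supp y"
proof -
  have "supp y \<noteq> {}" "\<forall>v. 0 \<le> y v"
    using assms by (auto simp: space_iff dest: simplicialD(2))
  then obtain v where "v \<in> supp y" by blast
  moreover have "y v > 0"
    using \<open>v \<in> supp y\<close> \<open>\<forall>v. 0 \<le> y v\<close> by (metis in_supp order_less_le)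
  ultimately show ?thesis using that by blast
qed

lemma space_mono: "J \<subseteq> K \<Longrightarrow> underlying_space J \<subseteq> underlying_space K"
  by (auto simp: underlying_space_def)

lemma closed_closed_simplex: "closed (closed_simplex (\<sigma> :: 'v set))"
proof -
  have c: "continuous_on UNIV (\<lambda>a::'v \<Rightarrow> real. a v)" for v
    by simp
  have 1: "closed {a::'v \<Rightarrow> real. \<forall>v. 0 \<le> a v}"
    by (intro closed_Collect_all closed_Collect_le continuous_intros c)
  have 2: "closed {a::'v \<Rightarrow> real. \<forall>v. v \<notin> \<sigma> \<longrightarrow> a v = 0}"
    by (intro closed_Collect_all closed_Collect_imp closed_Collect_eq open_Collect_const continuous_intros c)
  have 3: "closed {a::'v \<Rightarrow> real. (\<Sum>v\<in>\<sigma>. a v) = 1}"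
    by (intro closed_Collect_eq continuous_intros continuous_on_sum c)
  have eq: "closed_simplex \<sigma> = {a. \<forall>v. 0 \<le> a v} \<inter> {a. \<forall>v. v \<notin> \<sigma> \<longrightarrow> a v = 0} \<inter> {a. (\<Sum>v\<in>\<sigma>. a v) = 1}"
    unfolding closed_simplex_def by blast
  show ?thesis
    unfolding eq by (intro closed_Int 1 2 3)
qed

lemma closed_space_finite: "finite J \<Longrightarrow> closed (underlying_space J)"
  unfolding underlying_space_def by (intro closed_UN ballI closed_closed_simplex)

lemma closed_point: "closed {y :: 'v \<Rightarrow> real}"
proof -
  have "closed {a. \<forall>v. a v = y v}"
    by (intro closed_Collect_all closed_Collect_eq continuous_intros) simp
  moreover have "{a. \<forall>v. a v = y v} = {y}" by auto
  ultimately show ?thesis by simp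
qed

lemma powertop_eq: "powertop_real UNIV = (euclidean :: ('v \<Rightarrow> real) topology)"
  by (rule euclidean_product_topology)

lemma finite_subcomplex_generated:
  assumes "simplicial K" "finite J" "J \<subseteq> K"
  obtains J' where "finite J'" "J \<subseteq> J'" "J' \<subseteq> K" "simplicial J'"
proof
  let ?J = "(\<Union>\<sigma>\<in>J. Pow \<sigma>) - {{}}"
  have J: "finite \<sigma>" "\<sigma> \<noteq> {}" "\<And>\<tau>. \<tau> \<subseteq> \<sigma> \<Longrightarrow> \<tau> \<noteq> {} \<Longrightarrow> \<tau> \<in> K" if "\<sigma> \<in> J" for \<sigma>
    using simplicialD[OF assms(1)] assms(3) that by blast+
  show "finite ?J" using assms(2) J(1) by simp
  show "J \<subseteq> ?J" "?J \<subseteq> K" using J by blast+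
  show "simplicial ?J"
    unfolding simplicial_def using J(1) by (blast intro: finite_subset)
qed

text \<open>
  A finite union of closed simplices carries the same topology as a subspace of the realization and
  as a subspace of the product, because closed subsets of finitely many simplices have a closed union.
\<close>

lemma continuous_map_into_realization:
  assumes f: "continuous_map Y euclidean f"
    and J: "finite J" "J \<subseteq> K" "f ` topspace Y \<subseteq> underlying_space J"
  shows "continuous_map Y (realization K) f"
  unfolding continuous_map_def
proof (intro conjI allI impI)
  show "f \<in> topspace Y \<rightarrow> topspace (realization K)"
    using J space_mono[OF J(2)] by (auto simp: topspace_realization)
  fix U assume U: "openin (realization K) U"
  have cl: "closed (closed_simplex \<sigma> - U)" if "\<sigma> \<in> J" for \<sigma>
  proof -
    have "openin (top_of_set (closed_simplex \<sigma>)) (U \<inter> closed_simplex \<sigma>)"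
      using U that J(2) unfolding openin_realization powertop_eq by blast
    then obtain V where "open V" "U \<inter> closed_simplex \<sigma> = closed_simplex \<sigma> \<inter> V"
      unfolding openin_open by blast
    then have "closed_simplex \<sigma> - U = closed_simplex \<sigma> \<inter> - V" by blast
    then show ?thesis using \<open>open V\<close> closed_closed_simplex by (metis closed_Compl closed_Int)
  qed
  have "{x \<in> topspace Y. f x \<in> U} = {x \<in> topspace Y. f x \<in> - (\<Union>\<sigma>\<in>J. closed_simplex \<sigma> - U)}"
    using J(3) by (auto simp: underlying_space_def)
  moreover have "openin Y {x \<in> topspace Y. f x \<in> - (\<Union>\<sigma>\<in>J. closed_simplex \<sigma> - U)}"
  proof (rule openin_continuous_map_preimage[OF f])
    have "closed (\<Union>\<sigma>\<in>J. closed_simplex \<sigma> - U)"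
      using J(1) cl by (intro closed_UN) auto
    then show "openin euclidean (- (\<Union>\<sigma>\<in>J. closed_simplex \<sigma> - U))"
      by (metis open_Compl open_openin)
  qed
  ultimately show "openin Y {x \<in> topspace Y. f x \<in> U}" by simp
qed

lemma continuous_map_realization_euclidean: "continuous_map (realization K) euclidean (\<lambda>x. x)"
  unfolding continuous_map_def
proof (intro conjI allI impI)
  fix U :: "('a \<Rightarrow> real) set" assume U: "openin euclidean U"
  show "openin (realization K) {x \<in> topspace (realization K). x \<in> U}"
    unfolding openin_realization topspace_realization powertop_eq
  proof (intro conjI ballI)
    fix \<sigma> assume "\<sigma> \<in> K"
    then have "{x \<in> underlying_space K. x \<in> U} \<inter> closed_simplex \<sigma> = closed_simplex \<sigma> \<inter> U"
      by (auto simp: underlying_space_def)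
    then show "openin (top_of_set (closed_simplex \<sigma>)) ({x \<in> underlying_space K. x \<in> U} \<inter> closed_simplex \<sigma>)"
      using U by (auto simp: openin_open)
  qed auto
qed auto

lemma continuous_map_from_realization:
  assumes f: "\<And>\<sigma>. \<sigma> \<in> K \<Longrightarrow> continuous_map (top_of_set (closed_simplex \<sigma>)) Y f"
  shows "continuous_map (realization K) Y f"
  unfolding continuous_map_def
proof (intro conjI allI impI)
  show "f \<in> topspace (realization K) \<rightarrow> topspace Y"
    using f by (fastforce simp: topspace_realization underlying_space_def continuous_map_def)
  fix U assume U: "openin Y U"
  show "openin (realization K) {x \<in> topspace (realization K). f x \<in> U}"
    unfolding openin_realization topspace_realization powertop_eq
  proof (intro conjI ballI)
    fix \<sigma> assume s: "\<sigma> \<in> K"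
    then have "{x \<in> underlying_space K. f x \<in> U} \<inter> closed_simplex \<sigma> = {x \<in> topspace (top_of_set (closed_simplex \<sigma>)). f x \<in> U}"
      by (auto simp: underlying_space_def)
    then show "openin (top_of_set (closed_simplex \<sigma>)) ({x \<in> underlying_space K. f x \<in> U} \<inter> closed_simplex \<sigma>)"
      using openin_continuous_map_preimage[OF f[OF s] U] by simp
  qed auto
qed

text \<open>
  Choose one point of \<open>S\<close> for each simplex that carries a point of \<open>S\<close>. A set of chosen points meets
  every closed simplex in finitely many points and is therefore closed. So the chosen points form a
  closed discrete subset of a compact set, and there are only finitely many of them.
\<close>

lemma compactin_realization_finite:
  assumes K: "simplicial K" and S: "compactin (realization K) S"
  obtains J where "finite J" "J \<subseteq> K" "S \<subseteq> underlying_space J"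
proof -
  have sub: "S \<subseteq> underlying_space K"
    using compactin_subset_topspace[OF S] by (simp add: topspace_realization)
  define T where "T = supp ` S"
  have TK: "T \<subseteq> K" using sub by (auto simp: T_def space_iff[OF K])
  define q where "q \<sigma> = (SOME y. y \<in> S \<and> supp y = \<sigma>)" for \<sigma>
  have q: "q \<sigma> \<in> S" "supp (q \<sigma>) = \<sigma>" if "\<sigma> \<in> T" for \<sigma>
  proof -
    have "\<exists>y. y \<in> S \<and> supp y = \<sigma>" using that by (auto simp: T_def)
    from someI_ex[OF this] show "q \<sigma> \<in> S" "supp (q \<sigma>) = \<sigma>" unfolding q_def by auto
  qed
  let ?A = "q ` T"
  have clo: "closedin (realization K) B" if "B \<subseteq> ?A" for B
    unfolding closedin_def topspace_realization openin_realization powertop_eq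
  proof (intro conjI ballI)
    note \<open>B \<subseteq> ?A\<close>
    have BS: "B \<subseteq> S" using that q(1) by blast
    then show "B \<subseteq> underlying_space K" using sub by blast
    fix \<sigma> assume s: "\<sigma> \<in> K"
    have "B \<inter> closed_simplex \<sigma> \<subseteq> q ` Pow \<sigma>"
    proof
      fix y assume y: "y \<in> B \<inter> closed_simplex \<sigma>"
      then obtain \<tau> where t: "\<tau> \<in> T" "y = q \<tau>" using \<open>B \<subseteq> ?A\<close> by blast
      have "supp y \<subseteq> \<sigma>" using y closed_simplex_iff simplicialD(1)[OF K s] by blast
      then show "y \<in> q ` Pow \<sigma>" using t q(2) by auto
    qed
    then have "finite (B \<inter> closed_simplex \<sigma>)"
      using simplicialD(1)[OF K s] by (meson finite_Pow_iff finite_imageI finite_subset)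
    then have "closed (\<Union>y\<in>B \<inter> closed_simplex \<sigma>. {y})"
      by (intro closed_UN ballI closed_point)
    then have "closed (B \<inter> closed_simplex \<sigma>)" by simp
    then have "open (- (B \<inter> closed_simplex \<sigma>))" by (rule open_Compl)
    moreover have "(underlying_space K - B) \<inter> closed_simplex \<sigma> = closed_simplex \<sigma> \<inter> - (B \<inter> closed_simplex \<sigma>)"
      using s by (auto simp: underlying_space_def)
    ultimately show "openin (top_of_set (closed_simplex \<sigma>)) ((underlying_space K - B) \<inter> closed_simplex \<sigma>)"
      by (auto simp: openin_open)
  qed auto
  have AS: "?A \<subseteq> S" using q by blast
  have cA: "compactin (realization K) ?A"
    using closed_compactin[OF S AS clo] by simp
  have disc: "openin (subtopology (realization K) ?A) {y}" if "y \<in> ?A" for y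
  proof -
    have "closedin (realization K) (?A - {y})" by (rule clo) blast
    then have "openin (realization K) (topspace (realization K) - (?A - {y}))" by blast
    moreover have "{y} = (topspace (realization K) - (?A - {y})) \<inter> ?A"
      using that AS sub by (auto simp: topspace_realization)
    ultimately show ?thesis unfolding openin_subtopology by blast
  qed
  have "compact_space (subtopology (realization K) ?A)"
    using cA by (simp add: compactin_subspace)
  moreover have "topspace (subtopology (realization K) ?A) = ?A"
    using AS sub by (auto simp: topspace_realization)
  ultimately have "subtopology (realization K) ?A = discrete_topology ?A"
    using disc by (metis discrete_topology_unique)
  then have "finite ?A"
    using \<open>compact_space (subtopology (realization K) ?A)\<close> by (simp add: compact_space_discrete_topology)
  moreover have "inj_on q T" using q(2) by (metis inj_onI)
  ultimately have "finite T" by (rule finite_imageD)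
  moreover have "S \<subseteq> underlying_space T"
  proof
    fix y assume "y \<in> S"
    then have "supp y \<in> T" "y \<in> underlying_space K" using sub by (auto simp: T_def)
    then show "y \<in> underlying_space T"
      using closed_simplex_iff[of "supp y" y] simplicialD(1)[OF K, of "supp y"]
      unfolding space_iff[OF K] by (auto simp: underlying_space_def)
  qed
  ultimately show ?thesis using that TK by blast
qed

text \<open>
  For a compact domain these are the continuous maps into the realization, but both conditions are
  stated for the product topology, in which maps can be checked coordinate by coordinate.
\<close>

definition tame :: "'v set set \<Rightarrow> 'd::topological_space set \<Rightarrow> ('d \<Rightarrow> 'v \<Rightarrow> real) \<Rightarrow> bool" where
  "tame K S f \<longleftrightarrow> continuous_on S f \<and> (\<exists>J. finite J \<and> J \<subseteq> K \<and> f ` S \<subseteq> underlying_space J)"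

lemma tameI: "continuous_on S f \<Longrightarrow> finite J \<Longrightarrow> J \<subseteq> K \<Longrightarrow> f ` S \<subseteq> underlying_space J \<Longrightarrow> tame K S f"
  by (auto simp: tame_def)

lemma tameE:
  assumes "tame K S f" "simplicial K"
  obtains J where "continuous_on S f" "finite J" "J \<subseteq> K" "simplicial J" "f ` S \<subseteq> underlying_space J"
proof -
  obtain J where J: "continuous_on S f" "finite J" "J \<subseteq> K" "f ` S \<subseteq> underlying_space J"
    using assms by (auto simp: tame_def)
  obtain J' where "finite J'" "J \<subseteq> J'" "J' \<subseteq> K" "simplicial J'"
    using finite_subcomplex_generated[OF assms(2) J(2,3)] .
  with J that space_mono show ?thesis by (metis order_trans)
qed

lemma tame_imp_continuous_map: "tame K S f \<Longrightarrow> continuous_map (top_of_set S) (realization K) f"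
  by (auto simp: tame_def intro!: continuous_map_into_realization)

lemma continuous_map_imp_tame:
  assumes "simplicial K" "compact S" "continuous_map (top_of_set S) (realization K) f"
  shows "tame K S f"
proof -
  have "compactin (realization K) (f ` S)"
    by (rule image_compactin[OF _ assms(3)]) (simp add: compactin_subtopology assms)
  then obtain J where "finite J" "J \<subseteq> K" "f ` S \<subseteq> underlying_space J"
    using compactin_realization_finite[OF assms(1)] by blast
  moreover have "continuous_map (top_of_set S) euclidean ((\<lambda>x. x) \<circ> f)"
    by (rule continuous_map_compose[OF assms(3) continuous_map_realization_euclidean])
  ultimately show ?thesis by (auto simp: tame_def o_def)
qed

lemma tame_values: "tame K S f \<Longrightarrow> t \<in> S \<Longrightarrow> f t \<in> underlying_space K"
  unfolding tame_def using space_mono by blast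

lemma tame_subset: "tame K S f \<Longrightarrow> T \<subseteq> S \<Longrightarrow> tame K T f"
  unfolding tame_def by (meson continuous_on_subset image_mono order_trans)

lemma tame_mono: "tame K S f \<Longrightarrow> K \<subseteq> L \<Longrightarrow> tame L S f"
  unfolding tame_def by (meson order_trans)

lemma tame_compose: "tame K S f \<Longrightarrow> continuous_on T h \<Longrightarrow> h ` T \<subseteq> S \<Longrightarrow> tame K T (\<lambda>x. f (h x))"
  unfolding tame_def using continuous_on_compose2[of S f T h] by blast

definition square :: "(real \<times> real) set" where
  "square = {0..1} \<times> {0..1}"

definition square_boundary :: "(real \<times> real) set" where
  "square_boundary = {0, 1} \<times> {0..1} \<union> {0..1} \<times> {0, 1}"

text \<open>
  A sphere is a map of the square with this property. The constant may change during a homotopy,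
  so spheres are deformed without regard to base points.
\<close>

definition collapses_boundary :: "(real \<times> real \<Rightarrow> 'b) \<Rightarrow> bool" where
  "collapses_boundary f \<longleftrightarrow> (\<exists>y. \<forall>t\<in>square_boundary. f t = y)"

definition sphere_homotopic :: "'b topology \<Rightarrow> (real \<times> real \<Rightarrow> 'b) \<Rightarrow> (real \<times> real \<Rightarrow> 'b) \<Rightarrow> bool" where
  "sphere_homotopic Y = homotopic_with collapses_boundary (top_of_set square) Y"

definition null_sphere :: "'b topology \<Rightarrow> (real \<times> real \<Rightarrow> 'b) \<Rightarrow> bool" where
  "null_sphere Y f \<longleftrightarrow> (\<exists>c. sphere_homotopic Y f (\<lambda>_. c))"

lemma compact_square: "compact square"
  by (simp add: square_def compact_Times)

lemma null_sphere_step: "sphere_homotopic Y f g \<Longrightarrow> null_sphere Y g \<Longrightarrow> null_sphere Y f"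
  unfolding null_sphere_def sphere_homotopic_def using homotopic_with_trans by blast

lemma null_sphere_push:
  assumes "null_sphere Y f" "continuous_map Y Z h"
  shows "null_sphere Z (h \<circ> f)"
proof -
  obtain c where "sphere_homotopic Y f (\<lambda>_. c)" using assms(1) by (auto simp: null_sphere_def)
  then have "sphere_homotopic Z (h \<circ> f) (h \<circ> (\<lambda>_. c))"
    unfolding sphere_homotopic_def
    by (rule homotopic_with_compose_continuous_map_left[OF _ assms(2)]) (auto simp: collapses_boundary_def)
  then show ?thesis by (auto simp: null_sphere_def o_def)
qed

lemma sphere_homotopicI:
  fixes K :: "'v set set"
  assumes H: "tame K ({0..1::real} \<times> square) H"
    and "\<And>x. x \<in> square \<Longrightarrow> H (0, x) = f x" "\<And>x. x \<in> square \<Longrightarrow> H (1, x) = g x"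
    and "\<And>s. s \<in> {0..1} \<Longrightarrow> collapses_boundary (\<lambda>x. H (s, x))"
  shows "sphere_homotopic (realization K) f g"
proof -
  have sub: "square_boundary \<subseteq> square" by (auto simp: square_boundary_def square_def)
  show ?thesis
    unfolding sphere_homotopic_def
  proof (subst homotopic_with)
    show "collapses_boundary h = collapses_boundary k"
      if "\<And>x. x \<in> topspace (top_of_set square) \<Longrightarrow> h x = k x" for h k :: "real \<times> real \<Rightarrow> 'v \<Rightarrow> real"
    proof -
      have "h t = k t" if "t \<in> square_boundary" for t
        using that sub \<open>\<And>x. x \<in> topspace (top_of_set square) \<Longrightarrow> h x = k x\<close>[of t] by (auto simp del: split_paired_All)
      then show ?thesis by (simp add: collapses_boundary_def)
    qed
    show "\<exists>h. continuous_map (prod_topology (top_of_set {0..1::real}) (top_of_set square)) (realization K) h \<and>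
        (\<forall>x\<in>topspace (top_of_set square). h (0, x) = f x) \<and>
        (\<forall>x\<in>topspace (top_of_set square). h (1, x) = g x) \<and> (\<forall>t\<in>{0..1}. collapses_boundary (\<lambda>x. h (t, x)))"
      by (rule exI[of _ H]) (use assms tame_imp_continuous_map[OF H] in auto)
  qed
qed

text \<open>
  Deforming a set that contains the image never separates points of the boundary of the square;
  all homotopies of spheres in simplicial complexes below have this form.
\<close>

lemma sphere_homotopic_deform:
  assumes f: "continuous_on square f" "f ` square \<subseteq> A" "collapses_boundary f"
    and D: "tame K ({0..1::real} \<times> A) D" "\<And>y. y \<in> A \<Longrightarrow> D (0, y) = y"
  shows "sphere_homotopic (realization K) f (\<lambda>t. D (1, f t))"
proof (rule sphere_homotopicI[where H = "\<lambda>(s, t). D (s, f t)"])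
  have "tame K ({0..1::real} \<times> square) (\<lambda>x. D (case x of (s, t) \<Rightarrow> (s, f t)))"
  proof (rule tame_compose[OF D(1)])
    have "continuous_on ({0..1} \<times> square) (\<lambda>x. (fst x, f (snd x)))"
      by (intro continuous_intros continuous_on_compose2[OF f(1)]) auto
    then show "continuous_on ({0..1} \<times> square) (\<lambda>x. case x of (s, t) \<Rightarrow> (s, f t))"
      by (simp add: case_prod_beta')
  qed (use f(2) in auto)
  then show "tame K ({0..1::real} \<times> square) (\<lambda>(s, t). D (s, f t))"
    by (simp add: case_prod_beta')
qed (use f D in \<open>auto simp: collapses_boundary_def\<close>)

lemma tame_iff:
  assumes K: "simplicial K"
  shows "tame K S f \<longleftrightarrow> continuous_on S f \<and> f ` S \<subseteq> underlying_space K \<and> finite (supp ` f ` S)"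
proof
  assume t: "tame K S f"
  obtain J where J: "continuous_on S f" "finite J" "J \<subseteq> K" "simplicial J" "f ` S \<subseteq> underlying_space J"
    using tameE[OF t K] .
  have "supp ` f ` S \<subseteq> J" using J(5) space_iff[OF J(4)] by blast
  then have "finite (supp ` f ` S)" using J(2) by (rule finite_subset)
  with J(1,5) show "continuous_on S f \<and> f ` S \<subseteq> underlying_space K \<and> finite (supp ` f ` S)"
    using space_mono[OF J(3)] by simp
next
  assume R: "continuous_on S f \<and> f ` S \<subseteq> underlying_space K \<and> finite (supp ` f ` S)"
  show "tame K S f"
  proof (rule tameI[where J = "supp ` f ` S"])
    show "f ` S \<subseteq> underlying_space (supp ` f ` S)"
    proof
      fix y assume y: "y \<in> f ` S"
      then have "y \<in> underlying_space K" using R by blast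
      then have "y \<in> closed_simplex (supp y)"
        using closed_simplex_iff[of "supp y" y] simplicialD(1)[OF K, of "supp y"] unfolding space_iff[OF K] by auto
      with y show "y \<in> underlying_space (supp ` f ` S)" by (auto simp: underlying_space_def)
    qed
    show "supp ` f ` S \<subseteq> K" using R space_iff[OF K] by blast
  qed (use R in auto)
qed

lemma openin_coordinate:
  fixes f :: "'d::topological_space \<Rightarrow> 'v \<Rightarrow> real"
  assumes "continuous_on S f"
  shows "openin (top_of_set S) {t \<in> S. f t v \<noteq> 0}"
proof -
  have "continuous_on S (\<lambda>t. f t v)"
    using assms by (rule continuous_on_product_then_coordinatewise)
  then have "openin (top_of_set S) (S \<inter> (\<lambda>t. f t v) -` (- {0}))"
    by (rule continuous_openin_preimage_gen) auto
  moreover have "S \<inter> (\<lambda>t. f t v) -` (- {0}) = {t \<in> S. f t v \<noteq> 0}" by auto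
  ultimately show ?thesis by simp
qed

subsection \<open>Simplicial maps\<close>

text \<open>
  The piecewise linear map induced by a vertex map: coordinates are added up over the fibres.
\<close>

definition push :: "('w \<Rightarrow> 'v) \<Rightarrow> ('w \<Rightarrow> real) \<Rightarrow> 'v \<Rightarrow> real" where
  "push p y v = (\<Sum>w | y w \<noteq> 0 \<and> p w = v. y w)"

lemma push_closed_simplex:
  assumes s: "finite \<sigma>" and y: "y \<in> closed_simplex \<sigma>"
  shows "push p y v = (\<Sum>w\<in>{w \<in> \<sigma>. p w = v}. y w)" "push p y \<in> closed_simplex (p ` \<sigma>)"
proof -
  have y': "\<forall>w. 0 \<le> y w" "\<forall>w. w \<notin> \<sigma> \<longrightarrow> y w = 0" "sum y \<sigma> = 1"
    using y by (auto simp: closed_simplex_def)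
  show eq: "push p y v = (\<Sum>w\<in>{w \<in> \<sigma>. p w = v}. y w)" for v
    unfolding push_def using s y' by (intro sum.mono_neutral_left) auto
  have "(\<Sum>v\<in>p ` \<sigma>. push p y v) = sum y \<sigma>"
    unfolding eq by (rule sum.group) (use s in auto)
  moreover have "push p y v = 0" if "v \<notin> p ` \<sigma>" for v
    unfolding eq using that by (intro sum.neutral) auto
  ultimately show "push p y \<in> closed_simplex (p ` \<sigma>)"
    using y' by (auto simp: closed_simplex_def eq intro: sum_nonneg)
qed

lemma continuous_push_simplex:
  assumes s: "finite \<sigma>"
  shows "continuous_on (closed_simplex \<sigma>) (push p)"
proof (rule continuous_on_coordinatewise_then_product)
  fix v
  have "continuous_on (closed_simplex \<sigma>) (\<lambda>y. \<Sum>w\<in>{w \<in> \<sigma>. p w = v}. y w)"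
    by (intro continuous_on_sum continuous_on_subset[OF continuous_on_product_coordinates]) auto
  then show "continuous_on (closed_simplex \<sigma>) (\<lambda>y. push p y v)"
    by (rule continuous_on_eq) (simp add: push_closed_simplex(1)[OF s])
qed

lemma continuous_map_push:
  assumes C: "\<And>\<sigma>. \<sigma> \<in> C \<Longrightarrow> finite \<sigma> \<and> p ` \<sigma> \<in> K"
  shows "continuous_map (realization C) (realization K) (push p)"
proof (rule continuous_map_from_realization)
  fix \<sigma> assume s: "\<sigma> \<in> C"
  show "continuous_map (top_of_set (closed_simplex \<sigma>)) (realization K) (push p)"
    using C[OF s] continuous_push_simplex[of \<sigma> p] push_closed_simplex(2)[of \<sigma> _ p]
    by (intro continuous_map_into_realization[where J = "{p ` \<sigma>}"]) (auto simp: underlying_space_def)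
qed

section \<open>Simplicial coverings\<close>

text \<open>
  Unique lifting of simplices through a given vertex is what makes the induced map of realizations a
  covering map.
\<close>

locale simplicial_cover =
  fixes p :: "'w \<Rightarrow> 'v" and C :: "'w set set" and K :: "'v set set"
  assumes C: "simplicial C" and K: "simplicial K"
    and down: "\<sigma> \<in> C \<Longrightarrow> p ` \<sigma> \<in> K"
    and inj: "\<sigma> \<in> C \<Longrightarrow> inj_on p \<sigma>"
    and lift_ex: "{w} \<in> C \<Longrightarrow> \<tau> \<in> K \<Longrightarrow> p w \<in> \<tau> \<Longrightarrow> \<exists>\<sigma>\<in>C. w \<in> \<sigma> \<and> p ` \<sigma> = \<tau>"
    and lift_unique: "\<sigma>1 \<in> C \<Longrightarrow> \<sigma>2 \<in> C \<Longrightarrow> w \<in> \<sigma>1 \<Longrightarrow> w \<in> \<sigma>2 \<Longrightarrow> p ` \<sigma>1 = p ` \<sigma>2 \<Longrightarrow> \<sigma>1 = \<sigma>2"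
begin

text \<open>
  As \<open>p\<close> is injective on simplices, a point over \<open>y\<close> amounts to a lift of the simplex that carries
  \<open>y\<close>; the coordinates are copied.
\<close>

definition above :: "('w \<Rightarrow> real) \<Rightarrow> ('v \<Rightarrow> real) \<Rightarrow> bool" where
  "above z y \<longleftrightarrow> supp z \<in> C \<and> supp y = p ` supp z \<and> (\<forall>w\<in>supp z. z w = y (p w))"

text \<open>
  The sheet through the vertex \<open>w\<close> over the closed star of \<open>p w\<close>.
\<close>

definition sheet :: "'w \<Rightarrow> ('v \<Rightarrow> real) \<Rightarrow> 'w \<Rightarrow> real" where
  "sheet w y = (\<lambda>u. if {w, u} \<in> C then y (p u) else 0)"

lemma edge_unique:
  assumes "{w, u} \<in> C" "{w, u'} \<in> C" "p u = p u'"
  shows "u = u'"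
proof -
  have "{w, u} = {w, u'}"
    by (rule lift_unique[OF assms(1,2), of w]) (use assms in auto)
  then show ?thesis by (metis doubleton_eq_iff)
qed

lemma above_space:
  assumes "above z y" "y \<in> underlying_space K"
  shows "z \<in> underlying_space C"
proof -
  have z: "supp z \<in> C" "supp y = p ` supp z" "\<forall>w\<in>supp z. z w = y (p w)"
    using assms(1) by (auto simp: above_def)
  have y: "\<forall>v. 0 \<le> y v" "sum y (supp y) = 1" using assms(2) by (auto simp: space_iff[OF K])
  have "sum z (supp z) = sum (y \<circ> p) (supp z)" using z(3) by (intro sum.cong) (simp_all only: o_def)
  also have "\<dots> = sum y (supp y)" unfolding z(2) by (rule sum.reindex[OF inj[OF z(1)], symmetric])
  finally have "sum z (supp z) = 1" using y by simp
  moreover have "0 \<le> z w" for w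
  proof (cases "w \<in> supp z")
    case True
    then show ?thesis using bspec[OF z(3) True] y(1) by metis
  qed simp
  ultimately show ?thesis using z(1) by (auto simp: space_iff[OF C])
qed

lemma above_push:
  assumes "above z y" shows "push p z = y"
proof
  fix v
  have z: "supp z \<in> C" "supp y = p ` supp z" "\<forall>w\<in>supp z. z w = y (p w)"
    using assms by (auto simp: above_def)
  show "push p z v = y v"
  proof (cases "v \<in> supp y")
    case True
    then obtain w where w: "w \<in> supp z" "p w = v" using z(2) by auto
    have "{w. z w \<noteq> 0 \<and> p w = v} = {w}"
      using inj_onD[OF inj[OF z(1)]] w by auto
    moreover have "z w = y v" using bspec[OF z(3) w(1)] w(2) by simp
    ultimately show ?thesis by (simp add: push_def)
  next
    case False
    then have "{w. z w \<noteq> 0 \<and> p w = v} = {}" using z(2) by auto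
    then show ?thesis using False unfolding push_def by (simp only: sum.empty) simp
  qed
qed

lemma sheet_above:
  assumes w: "{w} \<in> C" and y: "y \<in> underlying_space K" and wy: "insert (p w) (supp y) \<in> K"
  shows "above (sheet w y) y" "insert w (supp (sheet w y)) \<in> C"
proof -
  obtain \<sigma> where s: "\<sigma> \<in> C" "w \<in> \<sigma>" "p ` \<sigma> = insert (p w) (supp y)"
    using lift_ex[OF w wy] by blast
  have edge: "{w, u} \<in> C" if "u \<in> \<sigma>" for u
    using simplicialD(3)[OF C s(1)] that s(2) by auto
  have supp: "supp (sheet w y) = {u \<in> \<sigma>. p u \<in> supp y}"
  proof (rule Set.set_eqI)
    fix u
    have "u \<in> \<sigma>" if u: "{w, u} \<in> C" "p u \<in> supp y"
    proof -
      obtain u' where "u' \<in> \<sigma>" "p u' = p u" using s(3) u(2) by (metis imageE insertCI)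
      then show ?thesis using edge_unique[OF u(1) edge, of u'] by simp
    qed
    then show "u \<in> supp (sheet w y) \<longleftrightarrow> u \<in> {u \<in> \<sigma>. p u \<in> supp y}"
      using edge by (auto simp: sheet_def)
  qed
  have im: "supp y = p ` supp (sheet w y)"
    unfolding supp using s(3) by (auto simp del: in_supp)
  moreover have "supp y \<noteq> {}" using y simplicialD(2)[OF K] by (auto simp: space_iff[OF K])
  ultimately have ne: "supp (sheet w y) \<noteq> {}" by auto
  have "supp (sheet w y) \<in> C"
    using simplicialD(3)[OF C s(1) _ ne] supp by auto
  with im show "above (sheet w y) y"
    by (auto simp: above_def sheet_def)
  show "insert w (supp (sheet w y)) \<in> C"
    using simplicialD(3)[OF C s(1), of "insert w (supp (sheet w y))"] supp s(2) by auto
qed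

lemma sheet_unique:
  assumes "above z y" "insert w (supp z) \<in> C"
  shows "z = sheet w y"
proof
  fix u
  have z: "supp z \<in> C" "supp y = p ` supp z" "\<forall>w\<in>supp z. z w = y (p w)"
    using assms by (auto simp: above_def)
  have edge: "{w, u} \<in> C" if "u \<in> supp z" for u
    using simplicialD(3)[OF C assms(2), of "{w, u}"] that by auto
  show "z u = sheet w y u"
  proof (cases "u \<in> supp z")
    case True
    then show ?thesis using z(3) edge by (auto simp: sheet_def)
  next
    case False
    have "y (p u) = 0" if "{w, u} \<in> C"
    proof (rule ccontr)
      assume "y (p u) \<noteq> 0"
      then have "p u \<in> p ` supp z" using z(2) by auto
      then obtain u' where "u' \<in> supp z" "p u' = p u" by auto
      then show False using edge_unique[OF that edge, of u'] False by auto
    qed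
    then show ?thesis using False by (auto simp: sheet_def)
  qed
qed

lemma sheet_unique': "above z y \<Longrightarrow> z w \<noteq> 0 \<Longrightarrow> z = sheet w y"
  using sheet_unique[of z y w] by (auto simp: above_def insert_absorb)

lemma tame_sheet:
  assumes f: "tame K R f" and w: "{w} \<in> C" and R: "\<And>t. t \<in> R \<Longrightarrow> insert (p w) (supp (f t)) \<in> K"
  shows "tame C R (\<lambda>t. sheet w (f t))"
  unfolding tame_iff[OF C]
proof (intro conjI)
  have f': "continuous_on R f" "f ` R \<subseteq> underlying_space K" "finite (supp ` f ` R)"
    using f by (auto simp: tame_iff[OF K])
  show "continuous_on R (\<lambda>t. sheet w (f t))"
  proof (rule continuous_on_coordinatewise_then_product)
    show "continuous_on R (\<lambda>t. sheet w (f t) u)" for u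
      using continuous_on_product_then_coordinatewise[OF f'(1), of "p u"]
      by (cases "{w, u} \<in> C") (simp_all add: sheet_def)
  qed
  show "(\<lambda>t. sheet w (f t)) ` R \<subseteq> underlying_space C"
    using above_space sheet_above(1)[OF w _ R] f'(2) by blast
  have "supp ` (\<lambda>t. sheet w (f t)) ` R = (\<lambda>\<sigma>. {u. {w, u} \<in> C \<and> p u \<in> \<sigma>}) ` (supp ` f ` R)"
    unfolding image_image by (intro image_cong refl) (auto simp: sheet_def supp_def split: if_splits)
  then show "finite (supp ` (\<lambda>t. sheet w (f t)) ` R)" using f'(3) by simp
qed

text \<open>
  Two lifts that are positive at a common vertex lie in the same sheet near that point, so they agree
  there. If they differ at a point, they are positive at two different vertices over one vertex, and no
  simplex contains both; so they differ nearby.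
\<close>

lemma lift_agree:
  assumes R: "connected R" and f1: "continuous_on R f1" and f2: "continuous_on R f2"
    and a: "\<And>t. t \<in> R \<Longrightarrow> above (f1 t) (f t)" "\<And>t. t \<in> R \<Longrightarrow> above (f2 t) (f t)"
    and t0: "t0 \<in> R" "f1 t0 = f2 t0" and t: "t \<in> R"
  shows "f1 t = f2 t"
proof (rule connected_induction_simple[OF R, where P = "\<lambda>t. f1 t = f2 t" and a = t0 and b = t])
  fix s assume s: "s \<in> R"
  have supp: "supp (f1 s) \<in> C" "supp (f s) = p ` supp (f1 s)" "supp (f s) = p ` supp (f2 s)"
    using a[OF s] by (auto simp: above_def)
  obtain w1 where w1: "w1 \<in> supp (f1 s)" using simplicialD(2)[OF C supp(1)] by blast
  obtain w2 where w2: "w2 \<in> supp (f2 s)" "p w2 = p w1" using w1 supp by (metis imageE imageI)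
  let ?T = "{t \<in> R. f1 t w1 \<noteq> 0} \<inter> {t \<in> R. f2 t w2 \<noteq> 0}"
  have T: "openin (top_of_set R) ?T" "s \<in> ?T"
    using openin_coordinate[OF f1] openin_coordinate[OF f2] w1 w2 s by auto
  show "\<exists>T. openin (top_of_set R) T \<and> s \<in> T \<and> (\<forall>x\<in>T. \<forall>y\<in>T. f1 x = f2 x \<longrightarrow> f1 y = f2 y)"
  proof (cases "w1 = w2")
    case True
    then have "f1 x = f2 x" if "x \<in> ?T" for x
      using sheet_unique' a that by (metis (mono_tags, lifting) Int_iff mem_Collect_eq)
    then show ?thesis using T by blast
  next
    case False
    have "f1 x \<noteq> f2 x" if x: "x \<in> ?T" for x
    proof
      assume "f1 x = f2 x"
      then have "w1 \<in> supp (f1 x)" "w2 \<in> supp (f1 x)" using x by auto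
      moreover have "supp (f1 x) \<in> C" using a(1) x by (auto simp: above_def)
      ultimately show False using inj_onD[OF inj, of "supp (f1 x)" w1 w2] w2(2) False by auto
    qed
    then show ?thesis using T by blast
  qed
qed (use t0 t in auto)

text \<open>
  The value of the lift may be prescribed at any point. This is what allows lifts over two pieces with
  connected intersection to be fitted together.
\<close>

definition lifts :: "'d::topological_space set \<Rightarrow> ('d \<Rightarrow> 'v \<Rightarrow> real) \<Rightarrow> bool" where
  "lifts R f \<longleftrightarrow> (\<forall>t0\<in>R. \<forall>z. above z (f t0) \<longrightarrow>
     (\<exists>g. tame C R g \<and> (\<forall>t\<in>R. above (g t) (f t)) \<and> g t0 = z))"

lemma lifts_star:
  assumes f: "tame K R f" and v: "\<And>t. t \<in> R \<Longrightarrow> f t v \<noteq> 0"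
  shows "lifts R f"
  unfolding lifts_def
proof (intro ballI allI impI)
  fix t0 z assume t0: "t0 \<in> R" and z: "above z (f t0)"
  have fR: "f t \<in> underlying_space K" if "t \<in> R" for t
    using tame_values[OF f that] .
  obtain w where w: "w \<in> supp z" "p w = v" using z v[OF t0] by (auto simp: above_def set_eq_iff)
  have wC: "{w} \<in> C" using z w simplicialD(3)[OF C, of "supp z" "{w}"] by (auto simp: above_def)
  have ins: "insert (p w) (supp (f t)) \<in> K" if "t \<in> R" for t
    using v[OF that] fR[OF that] w(2) by (auto simp: space_iff[OF K] insert_absorb)
  show "\<exists>g. tame C R g \<and> (\<forall>t\<in>R. above (g t) (f t)) \<and> g t0 = z"
    using tame_sheet[OF f wC ins] sheet_above(1)[OF wC fR ins] sheet_unique'[OF z] w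
    by (intro exI[of _ "\<lambda>t. sheet w (f t)"]) auto
qed

lemma lifts_Un_aux:
  assumes cl: "closed A" "closed B" and AB: "connected (A \<inter> B)" "A \<inter> B \<noteq> {}"
    and l: "lifts A f" "lifts B f" and t0: "t0 \<in> A" "above z (f t0)"
  shows "\<exists>g. tame C (A \<union> B) g \<and> (\<forall>t\<in>A \<union> B. above (g t) (f t)) \<and> g t0 = z"
proof -
  obtain g1 where g1: "tame C A g1" "\<forall>t\<in>A. above (g1 t) (f t)" "g1 t0 = z"
    using l(1) t0 by (auto simp: lifts_def)
  obtain b where b: "b \<in> A" "b \<in> B" using AB(2) by auto
  obtain g2 where g2: "tame C B g2" "\<forall>t\<in>B. above (g2 t) (f t)" "g2 b = g1 b"
    using l(2) b g1(2) unfolding lifts_def by metis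
  have c: "continuous_on A g1" "continuous_on B g2" using g1(1) g2(1) by (auto simp: tame_def)
  have eq: "g1 t = g2 t" if "t \<in> A \<inter> B" for t
  proof (rule lift_agree[OF AB(1), where ?f1.0 = g1 and ?f2.0 = g2 and f = f and ?t0.0 = b])
    show "continuous_on (A \<inter> B) g1" "continuous_on (A \<inter> B) g2"
      using c continuous_on_subset by blast+
  qed (use g1 g2 b that in auto)
  let ?g = "\<lambda>t. if t \<in> A then g1 t else g2 t"
  have "continuous_on (A \<union> B) ?g"
    by (rule continuous_on_cases[OF cl c]) (use eq in auto)
  moreover have "?g ` (A \<union> B) \<subseteq> g1 ` A \<union> g2 ` B" by auto
  moreover have "g1 ` A \<subseteq> underlying_space C" "finite (supp ` g1 ` A)"
    "g2 ` B \<subseteq> underlying_space C" "finite (supp ` g2 ` B)"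
    using g1(1) g2(1) by (auto simp: tame_iff[OF C])
  ultimately have "tame C (A \<union> B) ?g"
    unfolding tame_iff[OF C] using finite_subset[OF image_mono, of "?g ` (A \<union> B)" "g1 ` A \<union> g2 ` B" supp]
    by (simp only: image_Un finite_Un) blast
  then show ?thesis
    using g1 g2 t0 by (intro exI[of _ ?g]) auto
qed

lemma lifts_Un:
  assumes "closed A" "closed B" "connected (A \<inter> B)" "A \<inter> B \<noteq> {}" "lifts A f" "lifts B f"
  shows "lifts (A \<union> B) f"
  unfolding lifts_def
proof (intro ballI allI impI)
  fix t0 z assume t0: "t0 \<in> A \<union> B" and z: "above z (f t0)"
  have BA: "connected (B \<inter> A)" "B \<inter> A \<noteq> {}" "A \<union> B = B \<union> A"
    using assms(3,4) by (auto simp: Int_commute)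
  show "\<exists>g. tame C (A \<union> B) g \<and> (\<forall>t\<in>A \<union> B. above (g t) (f t)) \<and> g t0 = z"
  proof (cases "t0 \<in> A")
    case True
    show ?thesis by (rule lifts_Un_aux[OF assms True z])
  next
    case False
    then have "t0 \<in> B" using t0 by blast
    show ?thesis unfolding BA(3) by (rule lifts_Un_aux[OF assms(2,1) BA(1,2) assms(6,5) \<open>t0 \<in> B\<close> z])
  qed
qed

text \<open>
  By the Lebesgue number lemma a small rectangle is mapped into the open star of a vertex, where a sheet
  provides the lift. Rectangles are then joined to strips and strips to the square, by bisection in one
  coordinate at a time.
\<close>

lemma lifts_square:
  assumes f: "tame K square f"
  shows "lifts square f"
proof -
  have cf: "continuous_on square f" using f by (simp add: tame_def)
  have "\<exists>O'. open O' \<and> {t \<in> square. f t v \<noteq> 0} = square \<inter> O'" for v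
    using openin_coordinate[OF cf, of v] unfolding openin_open .
  then obtain O' where O': "\<And>v. open (O' v)" "\<And>v. {t \<in> square. f t v \<noteq> 0} = square \<inter> O' v"
    by metis
  have cover: "square \<subseteq> \<Union>(range O')"
  proof
    fix t assume t: "t \<in> square"
    then have "f t \<in> underlying_space K" using tame_values[OF f] by blast
    then obtain v where "f t v > 0" using space_supp_nonempty[OF K] by blast
    then show "t \<in> \<Union>(range O')" using O'(2)[of v] t by auto
  qed
  obtain \<delta> where d: "\<delta> > 0" "\<And>T. T \<subseteq> square \<Longrightarrow> diameter T < \<delta> \<Longrightarrow> \<exists>B\<in>range O'. T \<subseteq> B"
    using Lebesgue_number_lemma[OF compact_square _ cover] O'(1) by (metis (no_types, lifting) UNIV_not_empty empty_is_image rangeE)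
  have small: "lifts ({a..b} \<times> {c..d}) f"
    if r: "0 \<le> a" "a \<le> b" "b \<le> 1" "0 \<le> c" "c \<le> d" "d \<le> 1" "b - a < \<delta> / 4" "d - c < \<delta> / 4" for a b c d
  proof -
    let ?R = "{a..b} \<times> {c..d}"
    have sub: "?R \<subseteq> square" using r by (auto simp: square_def)
    have "diameter ?R \<le> \<delta> / 2"
    proof (rule diameter_le)
      fix x y assume "x \<in> ?R" "y \<in> ?R"
      then have "\<bar>fst x - fst y\<bar> \<le> b - a" "\<bar>snd x - snd y\<bar> \<le> d - c" by auto
      moreover have "norm (x - y) \<le> norm (fst x - fst y) + norm (snd x - snd y)"
        using norm_Pair_le[of "fst (x - y)" "snd (x - y)"] unfolding prod.collapse by simp
      ultimately show "norm (x - y) \<le> \<delta> / 2" using r by auto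
    qed (use d in auto)
    then obtain v where "?R \<subseteq> O' v" using d sub by fastforce
    then have "\<And>t. t \<in> ?R \<Longrightarrow> f t v \<noteq> 0" using O'(2)[of v] sub by blast
    then show ?thesis by (rule lifts_star[OF tame_subset[OF f sub]])
  qed
  have strip: "0 \<le> c \<and> d \<le> 1 \<longrightarrow> lifts ({a..b} \<times> {c..d}) f"
    if r: "0 \<le> a" "a \<le> b" "b \<le> 1" "b - a < \<delta> / 4" and "c \<le> d" for a b c d :: real
    using \<open>c \<le> d\<close>
  proof (induction c d rule: Bolzano)
    case (trans c d e)
    have eq: "{a..b} \<times> {c..e} = {a..b} \<times> {c..d} \<union> {a..b} \<times> {d..e}" using trans by auto
    have int: "{a..b} \<times> {c..d} \<inter> {a..b} \<times> {d..e} = {a..b} \<times> {d}" using trans by auto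
    have con: "connected ({a..b} \<times> {d})" by (intro connected_Times) auto
    have cl: "closed ({a..b} \<times> {c..d})" "closed ({a..b} \<times> {d..e})" by (intro closed_Times closed_atLeastAtMost)+
    show ?case
    proof
      assume "0 \<le> c \<and> e \<le> 1"
      then have l: "lifts ({a..b} \<times> {c..d}) f" "lifts ({a..b} \<times> {d..e}) f" using trans by auto
      have "{a..b} \<times> {c..d} \<inter> {a..b} \<times> {d..e} \<noteq> {}" unfolding int using r by auto
      then show "lifts ({a..b} \<times> {c..e}) f"
        unfolding eq using lifts_Un[OF cl _ _ l] con int by simp
    qed
  next
    case (local x)
    show ?case using small r d(1) by (intro exI[of _ "\<delta> / 4"]) auto
  qed
  have "0 \<le> a \<and> b \<le> 1 \<longrightarrow> lifts ({a..b} \<times> {0..1}) f" if "a \<le> b" for a b :: real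
    using that
  proof (induction a b rule: Bolzano)
    case (trans c d e)
    have eq: "{c..e} \<times> {0..1::real} = {c..d} \<times> {0..1::real} \<union> {d..e} \<times> {0..1::real}" using trans by auto
    have int: "{c..d} \<times> {0..1::real} \<inter> {d..e} \<times> {0..1::real} = {d} \<times> {0..1::real}" using trans by auto
    have con: "connected ({d} \<times> {0..1::real})" by (intro connected_Times) auto
    have cl: "closed ({c..d} \<times> {0..1::real})" "closed ({d..e} \<times> {0..1::real})" by (intro closed_Times closed_atLeastAtMost)+
    show ?case
    proof
      assume "0 \<le> c \<and> e \<le> 1"
      then have l: "lifts ({c..d} \<times> {0..1::real}) f" "lifts ({d..e} \<times> {0..1::real}) f" using trans by auto
      have "{c..d} \<times> {0..1::real} \<inter> {d..e} \<times> {0..1::real} \<noteq> {}" unfolding int by auto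
      then show "lifts ({c..e} \<times> {0..1::real}) f"
        unfolding eq using lifts_Un[OF cl _ _ l] con int by simp
    qed
  next
    case (local x)
    show ?case using strip[of _ _ 0 1] d(1) by (intro exI[of _ "\<delta> / 4"]) auto
  qed
  from this[of 0 1] show ?thesis by (simp add: square_def)
qed

lemma connected_square_boundary: "connected square_boundary"
proof -
  have seg: "connected ({c} \<times> {0..1::real})" "connected ({0..1::real} \<times> {c})" for c :: real
    by (simp_all add: connected_Times)
  have ne: "({c} \<times> {0..1}) \<inter> ({0..1} \<times> {c}) \<noteq> {}" if "c \<in> {0..1}" for c :: real
    using that by (metis IntI SigmaI empty_iff singletonI)
  have "connected (({0} \<times> {0..1::real}) \<union> ({0..1::real} \<times> {0}))"
    using ne[of 0] by (intro connected_Un[OF seg]) simp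
  moreover have "connected (({1} \<times> {0..1::real}) \<union> ({0..1::real} \<times> {1}))"
    using ne[of 1] by (intro connected_Un[OF seg]) simp
  moreover have "(0, 1) \<in> ({0} \<times> {0..1::real})" "(0, 1) \<in> ({0..1::real} \<times> {1})"
    by auto
  ultimately have "connected ((({0} \<times> {0..1::real}) \<union> ({0..1::real} \<times> {0})) \<union> (({1} \<times> {0..1::real}) \<union> ({0..1::real} \<times> {1})))"
    by (blast intro: connected_Un)
  moreover have "square_boundary = (({0} \<times> {0..1::real}) \<union> ({0..1::real} \<times> {0})) \<union> (({1} \<times> {0..1::real}) \<union> ({0..1::real} \<times> {1}))"
    by (auto simp: square_boundary_def)
  ultimately show ?thesis by simp
qed

lemma lift_sphere:
  assumes f: "tame K square f" "collapses_boundary f" and z: "above z (f (0, 0))"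
  obtains g where "tame C square g" "collapses_boundary g" "\<And>t. t \<in> square \<Longrightarrow> above (g t) (f t)" "g (0, 0) = z"
proof -
  have sub: "square_boundary \<subseteq> square" "(0, 0) \<in> square_boundary"
    by (auto simp: square_boundary_def square_def)
  have "(0, 0) \<in> square" by (simp add: square_def)
  with lifts_square[OF f(1)] z
  obtain g where g: "tame C square g" "\<forall>t\<in>square. above (g t) (f t)" "g (0, 0) = z"
    unfolding lifts_def by meson
  have const: "f t = f (0, 0)" if "t \<in> square_boundary" for t
  proof -
    obtain y where "\<forall>t\<in>square_boundary. f t = y" using f(2) unfolding collapses_boundary_def by blast
    then show ?thesis using that sub(2) by simp
  qed
  have "g t = g (0, 0)" if "t \<in> square_boundary" for t
  proof (rule lift_agree[OF connected_square_boundary, where ?f1.0 = g and ?f2.0 = "\<lambda>_. g (0, 0)" and f = f and ?t0.0 = "(0, 0)"])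
    show "continuous_on square_boundary g"
      using g(1) sub(1) continuous_on_subset unfolding tame_def by blast
    show "above (g s) (f s)" if "s \<in> square_boundary" for s
      using g(2) sub(1) that by blast
    show "above (g (0, 0)) (f s)" if "s \<in> square_boundary" for s
      using const[OF that] g(3) z by simp
  qed (use sub that in \<open>simp_all del: split_paired_All\<close>)
  then have "collapses_boundary g" by (auto simp: collapses_boundary_def)
  with g that show ?thesis by blast
qed

text \<open>
  Spheres lift because the square is simply connected, and a contraction of the lift projects to a
  contraction.
\<close>

lemma null_sphere_downstairs:
  assumes f: "tame K square f" "collapses_boundary f"
    and w: "{w} \<in> C" "f (0, 0) (p w) \<noteq> 0"
    and up: "\<And>g. tame C square g \<Longrightarrow> collapses_boundary g \<Longrightarrow> null_sphere (realization C) g"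
  shows "null_sphere (realization K) f"
proof -
  have "f (0, 0) \<in> underlying_space K" using tame_values[OF f(1)] by (simp add: square_def)
  moreover from this have "insert (p w) (supp (f (0, 0))) \<in> K"
    using w(2) by (auto simp: space_iff[OF K] insert_absorb)
  ultimately have "above (sheet w (f (0, 0))) (f (0, 0))" using sheet_above(1)[OF w(1)] by blast
  then obtain g where g: "tame C square g" "collapses_boundary g" "\<And>t. t \<in> square \<Longrightarrow> above (g t) (f t)"
    using lift_sphere[OF f] by metis
  have "null_sphere (realization K) (push p \<circ> g)"
    by (rule null_sphere_push[OF up[OF g(1,2)] continuous_map_push])
       (use down simplicialD(1)[OF C] in auto)
  moreover have "sphere_homotopic (realization K) f (push p \<circ> g)"
    unfolding sphere_homotopic_def
  proof (rule homotopic_with_equal)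
    show "collapses_boundary (push p \<circ> g)" using g(2) by (auto simp: collapses_boundary_def)
  qed (use f(2) tame_imp_continuous_map[OF f(1)] above_push[OF g(3)] in \<open>simp_all del: split_paired_All\<close>)
  ultimately show ?thesis by (rule null_sphere_step[rotated])
qed

end

lemma closed_simplex_mono: "finite \<tau> \<Longrightarrow> \<sigma> \<subseteq> \<tau> \<Longrightarrow> closed_simplex \<sigma> \<subseteq> closed_simplex \<tau>"
  using closed_simplex_iff[of \<tau>] closed_simplex_iff[OF finite_subset[of \<sigma> \<tau>]] by (meson order_trans subsetI)

lemma closed_simplex_convex:
  assumes "y \<in> closed_simplex \<sigma>" "z \<in> closed_simplex \<sigma>" "s \<in> {0..1}"
  shows "(\<lambda>u. (1 - s) * y u + s * z u) \<in> closed_simplex \<sigma>"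
  using assms by (auto simp: closed_simplex_def sum.distrib simp flip: sum_distrib_left)

lemma continuous_push_finite:
  assumes J: "finite J" "\<And>\<sigma>. \<sigma> \<in> J \<Longrightarrow> finite \<sigma>"
  shows "continuous_on (underlying_space J) (push p)"
proof (rule continuous_on_subset[OF continuous_push_simplex])
  show "finite (\<Union>J)" using J by auto
  then show "underlying_space J \<subseteq> closed_simplex (\<Union>J)"
    unfolding underlying_space_def using closed_simplex_mono by (intro UN_least) blast
qed

text \<open>
  If \<open>\<sigma> \<union> \<phi> ` \<sigma>\<close> is always a simplex, the segment from a point to its image stays inside the complex.
\<close>

lemma contiguous_deformation:
  assumes K: "simplicial K" and M: "simplicial M"
    and con: "\<And>\<sigma>. \<sigma> \<in> M \<Longrightarrow> \<sigma> \<union> \<phi> ` \<sigma> \<in> K" and f: "tame M square f" "collapses_boundary f"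
  shows "sphere_homotopic (realization K) f (push \<phi> \<circ> f)"
    and "tame ((`) \<phi> ` M) square (push \<phi> \<circ> f)"
proof -
  obtain J where J: "continuous_on square f" "finite J" "J \<subseteq> M" "simplicial J" "f ` square \<subseteq> underlying_space J"
    using tameE[OF f(1) M] .
  have fin: "finite \<sigma>" if "\<sigma> \<in> J" for \<sigma> using simplicialD(1)[OF J(4) that] .
  have cpush: "continuous_on (underlying_space J) (push \<phi>)"
    by (rule continuous_push_finite[OF J(2) fin])
  let ?D = "\<lambda>(s::real, y). \<lambda>u. (1 - s) * y u + s * push \<phi> y u"
  have D: "?D (s, y) \<in> closed_simplex (\<sigma> \<union> \<phi> ` \<sigma>)" if "s \<in> {0..1}" "y \<in> closed_simplex \<sigma>" "\<sigma> \<in> J" for s y \<sigma>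
  proof -
    have "y \<in> closed_simplex (\<sigma> \<union> \<phi> ` \<sigma>)" "push \<phi> y \<in> closed_simplex (\<sigma> \<union> \<phi> ` \<sigma>)"
      using that(2) closed_simplex_mono[of "\<sigma> \<union> \<phi> ` \<sigma>"] push_closed_simplex(2)[OF fin[OF that(3)] that(2), of \<phi>] fin[OF that(3)]
      by (metis finite_Un finite_imageI subsetD sup_ge1 sup_ge2)+
    then show ?thesis using closed_simplex_convex[OF _ _ that(1)] by simp
  qed
  have "sphere_homotopic (realization K) f (\<lambda>t. ?D (1, f t))"
  proof (rule sphere_homotopic_deform[OF J(1,5) f(2)])
    have "continuous_on ({0..1} \<times> underlying_space J) (\<lambda>x. (1 - fst x) * snd x u + fst x * push \<phi> (snd x) u)" for u
    proof -
      have "continuous_on ({0..1} \<times> underlying_space J) (\<lambda>x::real \<times> ('a \<Rightarrow> real). snd x u)"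
        by (rule continuous_on_product_then_coordinatewise[OF continuous_on_snd[OF continuous_on_id]])
      moreover have "continuous_on ({0..1} \<times> underlying_space J) (\<lambda>x::real \<times> ('a \<Rightarrow> real). push \<phi> (snd x) u)"
        by (rule continuous_on_product_then_coordinatewise[OF continuous_on_compose2[OF cpush continuous_on_snd[OF continuous_on_id]]]) auto
      ultimately show ?thesis by (intro continuous_intros)
    qed
    then have "continuous_on ({0..1} \<times> underlying_space J) ?D"
      by (intro continuous_on_coordinatewise_then_product) (simp add: case_prod_beta')
    then show "tame K ({0..1} \<times> underlying_space J) ?D"
    proof (rule tameI[where J = "(\<lambda>\<sigma>. \<sigma> \<union> \<phi> ` \<sigma>) ` J"])
      show "?D ` ({0..1} \<times> underlying_space J) \<subseteq> underlying_space ((\<lambda>\<sigma>. \<sigma> \<union> \<phi> ` \<sigma>) ` J)"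
      proof (rule image_subsetI)
        fix x :: "real \<times> ('a \<Rightarrow> real)" assume "x \<in> {0..1} \<times> underlying_space J"
        then obtain s y \<sigma> where "x = (s, y)" "s \<in> {0..1}" "y \<in> closed_simplex \<sigma>" "\<sigma> \<in> J"
          by (auto simp: underlying_space_def)
        with D[of s y \<sigma>] show "?D x \<in> underlying_space ((\<lambda>\<sigma>. \<sigma> \<union> \<phi> ` \<sigma>) ` J)"
          by (auto simp: underlying_space_def)
      qed
    qed (use J con in auto)
  qed auto
  then show "sphere_homotopic (realization K) f (push \<phi> \<circ> f)"
    by (simp add: o_def)
  show "tame ((`) \<phi> ` M) square (push \<phi> \<circ> f)"
  proof (rule tameI[where J = "(`) \<phi> ` J"])
    show "continuous_on square (push \<phi> \<circ> f)"
      by (rule continuous_on_compose[OF J(1) continuous_on_subset[OF cpush J(5)]])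
    show "(push \<phi> \<circ> f) ` square \<subseteq> underlying_space ((`) \<phi> ` J)"
    proof (rule image_subsetI)
      fix t assume "t \<in> square"
      then obtain \<sigma> where s: "\<sigma> \<in> J" "f t \<in> closed_simplex \<sigma>"
        using J(5) by (auto simp: underlying_space_def)
      then show "(push \<phi> \<circ> f) t \<in> underlying_space ((`) \<phi> ` J)"
        using push_closed_simplex(2)[OF fin[OF s(1)] s(2)] by (auto simp: underlying_space_def)
    qed
  qed (use J in auto)
qed

section \<open>Graphs have no nontrivial spheres\<close>

text \<open>
  Walks are stored with their current end in front. Reduced walks never go straight back along the last
  edge, so each of them is determined by its end point in the universal covering tree of the graph.
\<close>

inductive reduced_walk :: "'v set set \<Rightarrow> 'v \<Rightarrow> 'v list \<Rightarrow> bool" for G r where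
  root: "reduced_walk G r [r]"
| step: "reduced_walk G r (y # ys) \<Longrightarrow> {x, y} \<in> G \<Longrightarrow> x \<noteq> y \<Longrightarrow> ys = [] \<or> hd ys \<noteq> x \<Longrightarrow> reduced_walk G r (x # y # ys)"

definition tree :: "'v set set \<Rightarrow> 'v \<Rightarrow> 'v list set set" where
  "tree G r = {{w} | w. reduced_walk G r w} \<union> {{w, x # w} | x w. w \<noteq> [] \<and> reduced_walk G r (x # w)}"

lemma reduced_walk_nonempty: "reduced_walk G r w \<Longrightarrow> w \<noteq> []"
  by (induction rule: reduced_walk.induct) auto

lemma reduced_walk_tl:
  assumes "reduced_walk G r (x # w)" "w \<noteq> []"
  shows "reduced_walk G r w" "{x, hd w} \<in> G" "x \<noteq> hd w" "tl w = [] \<or> hd (tl w) \<noteq> x"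
  using assms by (auto elim: reduced_walk.cases)

lemma tree_star:
  assumes "\<sigma> \<in> tree G r" "w \<in> \<sigma>"
  shows "reduced_walk G r w" "\<sigma> = {w} \<or> (\<exists>z. reduced_walk G r (z # w) \<and> \<sigma> = {w, z # w}) \<or> (tl w \<noteq> [] \<and> \<sigma> = {w, tl w})"
  using assms reduced_walk_tl(1)[of G r] by (auto simp: tree_def)

lemma tree_simplicial: "simplicial (tree G r)"
  unfolding simplicial_def
proof (intro ballI conjI allI impI)
  fix \<sigma> assume s: "\<sigma> \<in> tree G r"
  then show "finite \<sigma>" "\<sigma> \<noteq> {}" by (auto simp: tree_def)
  fix \<tau> assume t: "\<tau> \<subseteq> \<sigma>" "\<tau> \<noteq> {}"
  consider w where "\<sigma> = {w}" | w z where "\<sigma> = {w, z}"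
    using s unfolding tree_def by blast
  then have "\<tau> = \<sigma> \<or> (\<exists>w\<in>\<sigma>. \<tau> = {w})"
  proof cases
    case (1 w)
    then show ?thesis using t by blast
  next
    case (2 w z)
    then have "\<tau> = {w} \<or> \<tau> = {z} \<or> \<tau> = {w, z}" using t by blast
    then show ?thesis using 2 by blast
  qed
  then show "\<tau> \<in> tree G r"
    using s tree_star(1)[OF s] by (auto simp: tree_def)
qed

lemma reduced_walk_hd:
  assumes "simplicial G" "{r} \<in> G" "reduced_walk G r w"
  shows "{hd w} \<in> G"
  using assms(3) by cases (use assms simplicialD(3)[OF assms(1)] in auto)

text \<open>
  An edge at the end of a reduced walk lifts in exactly one way: either it undoes the last step or it
  extends the walk to a reduced walk.
\<close>

lemma tree_cover:
  assumes G: "simplicial G" "\<And>\<sigma>. \<sigma> \<in> G \<Longrightarrow> card \<sigma> \<le> 2" and r: "{r} \<in> G"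
  shows "simplicial_cover hd (tree G r) G"
proof
  show "simplicial (tree G r)" "simplicial G" by (rule tree_simplicial G)+
  show "hd ` \<sigma> \<in> G" if "\<sigma> \<in> tree G r" for \<sigma>
    using that reduced_walk_hd[OF G(1) r] reduced_walk_tl(2)[of G r] by (auto simp: tree_def insert_commute)
  show "inj_on hd \<sigma>" if "\<sigma> \<in> tree G r" for \<sigma>
    using that reduced_walk_tl(3)[of G r] by (force simp: tree_def)
  show "\<exists>\<sigma>\<in>tree G r. w \<in> \<sigma> \<and> hd ` \<sigma> = \<tau>" if w: "{w} \<in> tree G r" and t: "\<tau> \<in> G" "hd w \<in> \<tau>" for w \<tau>
  proof -
    have red: "reduced_walk G r w" using tree_star(1)[OF w] by simp
    have "finite \<tau>" "card \<tau> \<le> 2" using G t simplicialD(1) by blast+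
    show ?thesis
    proof (cases "\<tau> = {hd w}")
      case True
      then show ?thesis using w by (intro bexI[of _ "{w}"]) auto
    next
      case False
      then obtain z where z: "z \<in> \<tau>" "z \<noteq> hd w" using t(2) by blast
      then have "{hd w, z} \<subseteq> \<tau>" "card {hd w, z} = 2" using t(2) by auto
      then have \<tau>: "\<tau> = {hd w, z}"
        using \<open>finite \<tau>\<close> \<open>card \<tau> \<le> 2\<close> by (metis card_seteq)
      show ?thesis
      proof (cases "tl w \<noteq> [] \<and> hd (tl w) = z")
        case True
        obtain x where x: "w = x # tl w" using reduced_walk_nonempty[OF red] by (metis list.collapse)
        have "{tl w, w} \<in> tree G r"
          using True red x unfolding tree_def by (metis (mono_tags, lifting) UnCI mem_Collect_eq)
        then show ?thesis using True \<tau> by (intro bexI[of _ "{tl w, w}"]) auto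
      next
        case False
        obtain y ys where y: "w = y # ys" using reduced_walk_nonempty[OF red] by (cases w) auto
        have "reduced_walk G r (z # w)"
          using red z \<tau> t(1) False unfolding y by (intro reduced_walk.step) (auto simp: insert_commute)
        then have "{w, z # w} \<in> tree G r" using y by (auto simp: tree_def)
        then show ?thesis using \<tau> by (intro bexI[of _ "{w, z # w}"]) auto
      qed
    qed
  qed
  show "\<sigma>1 = \<sigma>2" if s: "\<sigma>1 \<in> tree G r" "\<sigma>2 \<in> tree G r" "w \<in> \<sigma>1" "w \<in> \<sigma>2" "hd ` \<sigma>1 = hd ` \<sigma>2" for \<sigma>1 \<sigma>2 w
  proof -
    have w: "w \<noteq> []" by (rule reduced_walk_nonempty[OF tree_star(1)[OF s(1,3)]])
    have up: "z \<noteq> hd w" "tl w = [] \<or> hd (tl w) \<noteq> z" if "reduced_walk G r (z # w)" for z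
      using reduced_walk_tl(3,4)[OF that w] by auto
    have dn: "hd w \<noteq> hd (tl w)" if "tl w \<noteq> []"
      using reduced_walk_tl(3)[of G r "hd w" "tl w"] tree_star(1)[OF s(1,3)] that w by simp
    show ?thesis
      using tree_star(2)[OF s(1,3)] tree_star(2)[OF s(2,4)] s(5) up dn
      by (elim disjE exE conjE) (simp_all add: doubleton_eq_iff, metis+)
  qed
qed

text \<open>
  Moving the nodes of maximal depth to their parents is contiguous to the identity and lowers the depth.
\<close>

lemma tree_null_sphere:
  assumes "tame {\<sigma> \<in> tree G r. \<forall>w\<in>\<sigma>. length w \<le> n} square f" "collapses_boundary f"
  shows "null_sphere (realization (tree G r)) f"
  using assms
proof (induction n arbitrary: f)
  case (0 f)
  have "(0, 0) \<in> square" by (simp add: square_def)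
  from tame_values[OF "0.prems"(1) this]
  obtain \<sigma> where "\<sigma> \<in> tree G r" "\<forall>w\<in>\<sigma>. length w \<le> 0" unfolding underlying_space_def by blast
  moreover obtain w where "w \<in> \<sigma>" using simplicialD(2)[OF tree_simplicial \<open>\<sigma> \<in> tree G r\<close>] by blast
  ultimately have "reduced_walk G r w" "w = []" using tree_star(1)[of \<sigma> G r w] by auto
  then show ?case using reduced_walk_nonempty[of G r w] by simp
next
  case (Suc n f)
  let ?M = "\<lambda>n. {\<sigma> \<in> tree G r. \<forall>w\<in>\<sigma>. length w \<le> n}"
  show ?case
  proof (cases "n = 0")
    case True
    have "f t = (\<lambda>w. if w = [r] then 1 else 0)" if t: "t \<in> square" for t
    proof -
      obtain \<sigma> where s: "\<sigma> \<in> tree G r" "\<forall>w\<in>\<sigma>. length w \<le> 1" "f t \<in> closed_simplex \<sigma>"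
        using tame_values[OF Suc.prems(1) t] True unfolding underlying_space_def by auto
      have "w = [r]" if "w \<in> \<sigma>" for w
      proof -
        have "reduced_walk G r w" "length w \<le> 1" using tree_star(1)[OF s(1) that] s(2) that by auto
        then show ?thesis by cases simp_all
      qed
      then have "\<sigma> = {[r]}" using simplicialD(2)[OF tree_simplicial s(1)] by blast
      then have "f t w = (if w = [r] then 1 else 0)" for w using s(3) by (simp add: closed_simplex_def)
      then show ?thesis by blast
    qed
    then have "sphere_homotopic (realization (tree G r)) f (\<lambda>_. (\<lambda>w. if w = [r] then 1 else 0))"
      unfolding sphere_homotopic_def
    proof (intro homotopic_with_equal)
      show "collapses_boundary (\<lambda>_. (\<lambda>w. if w = [r] then 1 else (0::real)))"
        by (auto simp: collapses_boundary_def)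
      show "continuous_map (top_of_set square) (realization (tree G r)) f"
        by (rule tame_imp_continuous_map[OF tame_mono[OF Suc.prems(1)]]) auto
    qed (use Suc.prems in \<open>simp_all del: split_paired_All\<close>)
    then show ?thesis by (auto simp: null_sphere_def)
  next
    case False
    let ?\<phi> = "\<lambda>w. if length w = Suc n then tl w else w"
    have M: "simplicial (?M m)" for m
      using tree_simplicial[of G r] unfolding simplicial_def by blast
    have img: "\<sigma> \<union> ?\<phi> ` \<sigma> \<in> tree G r \<and> ?\<phi> ` \<sigma> \<in> ?M n" if s: "\<sigma> \<in> ?M (Suc n)" for \<sigma>
    proof -
      have st: "\<sigma> \<in> tree G r" "\<And>w. w \<in> \<sigma> \<Longrightarrow> length w \<le> Suc n" using s by auto
      from st(1) consider w where "reduced_walk G r w" "\<sigma> = {w}"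
        | x w where "w \<noteq> []" "reduced_walk G r (x # w)" "\<sigma> = {w, x # w}"
        by (auto simp: tree_def)
      then show ?thesis
      proof cases
        case (1 w)
        show ?thesis
        proof (cases "length w = Suc n")
          case True
          obtain x v where v: "w = x # v" "v \<noteq> []" using True False by (cases w) auto
          then have "{v, x # v} \<in> tree G r" "{v} \<in> tree G r"
            using 1(1) reduced_walk_tl(1)[of G r x v] by (auto simp: tree_def)
          then show ?thesis using v True 1 by (auto simp: insert_commute)
        next
          case False
          then show ?thesis using st 1 by auto
        qed
      next
        case (2 x w)
        have "{w} \<in> tree G r" using reduced_walk_tl(1)[OF 2(2,1)] by (auto simp: tree_def)
        have len: "length w \<le> n" using st(2)[of "x # w"] 2(3) by simp
        then have "?\<phi> ` \<sigma> = (if length w = n then {w} else {w, x # w})" using 2(3) by auto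
        then show ?thesis
          using st 2 len \<open>{w} \<in> tree G r\<close> by (auto simp: insert_commute insert_absorb split: if_splits)
      qed
    qed
    have "sphere_homotopic (realization (tree G r)) f (push ?\<phi> \<circ> f)"
      by (rule contiguous_deformation(1)[OF tree_simplicial M _ Suc.prems]) (use img in blast)
    moreover have "tame ((`) ?\<phi> ` ?M (Suc n)) square (push ?\<phi> \<circ> f)"
      by (rule contiguous_deformation(2)[OF tree_simplicial M _ Suc.prems]) (use img in blast)
    then have "tame (?M n) square (push ?\<phi> \<circ> f)"
      by (rule tame_mono) (use img in blast)
    moreover have "collapses_boundary (push ?\<phi> \<circ> f)"
      using Suc.prems(2) by (auto simp: collapses_boundary_def)
    ultimately show ?thesis using Suc.IH null_sphere_step by blast
  qed
qed

theorem graph_null_sphere: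
  assumes G: "simplicial G" "\<And>\<sigma>. \<sigma> \<in> G \<Longrightarrow> card \<sigma> \<le> 2" and f: "tame G square f" "collapses_boundary f"
  shows "null_sphere (realization G) f"
proof -
  have sq: "(0, 0) \<in> square" by (simp add: square_def)
  have f0: "f (0, 0) \<in> underlying_space G" using tame_values[OF f(1) sq] .
  obtain r where r: "f (0, 0) r > 0" using space_supp_nonempty[OF G(1) f0] by blast
  have "{r} \<in> G"
    using f0 r simplicialD(3)[OF G(1), of "supp (f (0, 0))" "{r}"] by (auto simp: space_iff[OF G(1)])
  then have "simplicial_cover hd (tree G r) G" by (intro tree_cover[OF G])
  then interpret simplicial_cover hd "tree G r" G .
  show ?thesis
  proof (rule null_sphere_downstairs[OF f])
    show "{[r]} \<in> tree G r" by (auto simp: tree_def intro: reduced_walk.root)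
    show "f (0, 0) (hd [r]) \<noteq> 0" using r by simp
    fix g assume g: "tame (tree G r) square g" "collapses_boundary g"
    obtain J where J: "continuous_on square g" "finite J" "J \<subseteq> tree G r" "simplicial J" "g ` square \<subseteq> underlying_space J"
      using tameE[OF g(1) tree_simplicial] .
    have "finite (\<Union>J)" using J(2) simplicialD(1)[OF J(4)] by auto
    then obtain n where "\<forall>w\<in>\<Union>J. length w \<le> n"
      by (metis finite_imageI finite_nat_set_iff_bounded_le imageI)
    then have "tame {\<sigma> \<in> tree G r. \<forall>w\<in>\<sigma>. length w \<le> n} square g"
      using J by (intro tameI[where J = J]) auto
    then show "null_sphere (realization (tree G r)) g"
      by (rule tree_null_sphere[OF _ g(2)])
  qed
qed

section \<open>Collapsing a cell through a free face\<close>

text \<open>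
  As \<open>B\<close> is compact and misses \<open>p\<close>, there is \<open>c < 1\<close> with \<open>x \<bullet> p \<le> c\<close> on \<open>B\<close>. Look at the disc from
  the outer point \<open>p / c\<close>: the tangents touch the sphere where \<open>x \<bullet> p = c\<close>, so \<open>B\<close> lies on the far
  side. The retraction moves every point away from \<open>p / c\<close> until it reaches the far side.
\<close>

lemma retract_disc_onto_circle:
  fixes p :: "'a::euclidean_space"
  assumes p: "norm p = 1" and B: "compact B" "B \<subseteq> sphere 0 1" "p \<notin> B"
  obtains r where "continuous_on (cball 0 1) r" "\<And>x. x \<in> cball 0 1 \<Longrightarrow> norm (r x) = 1" "\<And>x. x \<in> B \<Longrightarrow> r x = x"
proof -
  obtain c where c: "0 < c" "c < 1" "\<And>x. x \<in> B \<Longrightarrow> x \<bullet> p \<le> c"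
  proof (cases "B = {}")
    case True
    then show ?thesis using that[of "1/2"] by auto
  next
    case False
    have "continuous_on B (\<lambda>x. x \<bullet> p)" by (intro continuous_intros)
    then obtain b where b: "b \<in> B" "\<forall>x\<in>B. x \<bullet> p \<le> b \<bullet> p"
      using continuous_attains_sup[OF B(1) False] by blast
    have "norm b = 1" using b B(2) by auto
    have "b \<bullet> p \<noteq> 1"
    proof
      assume "b \<bullet> p = 1"
      then have "(b - p) \<bullet> (b - p) = 0"
        using p \<open>norm b = 1\<close> by (simp add: inner_diff_left inner_diff_right inner_commute norm_eq_1)
      then show False using b(1) B(3) by simp
    qed
    moreover have "b \<bullet> p \<le> 1" using norm_cauchy_schwarz[of b p] p \<open>norm b = 1\<close> by simp
    ultimately show ?thesis
      using that[of "max (b \<bullet> p) (1/2)"] b(2) by (auto simp: le_max_iff_disj)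
  qed
  define d where "d x = x - p /\<^sub>R c" for x
  \<comment> \<open>The larger root of \<open>norm (x + t *\<^sub>R d x) = 1\<close>.\<close>
  define t where "t x = (- (x \<bullet> d x) + sqrt ((x \<bullet> d x)\<^sup>2 + (d x \<bullet> d x) * (1 - x \<bullet> x))) / (d x \<bullet> d x)" for x
  define r where "r x = x + t x *\<^sub>R d x" for x
  have dd: "d x \<bullet> d x > 0" if "x \<in> cball 0 1" for x
  proof -
    have "norm (p /\<^sub>R c) > 1" using p c by (simp add: divide_simps)
    then have "x \<noteq> p /\<^sub>R c" using that by auto
    then show ?thesis by (simp add: d_def)
  qed
  have xx: "x \<bullet> x \<le> 1" if "x \<in> cball 0 1" for x :: 'a
    using that by (simp add: dot_square_norm abs_square_le_1 flip: power2_norm_eq_inner)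
  have "continuous_on (cball 0 1) r"
    unfolding r_def t_def d_def
    by (intro continuous_intros) (use dd in \<open>force simp: d_def\<close>)
  moreover have "norm (r x) = 1" if x: "x \<in> cball 0 1" for x
  proof -
    let ?a = "d x \<bullet> d x" and ?b = "x \<bullet> d x"
    have s: "(sqrt (?b\<^sup>2 + ?a * (1 - x \<bullet> x)))\<^sup>2 = ?b\<^sup>2 + ?a * (1 - x \<bullet> x)"
      using dd[OF x] xx[OF x] by (simp add: mult_nonneg_nonneg)
    have "t x * ?a = - ?b + sqrt (?b\<^sup>2 + ?a * (1 - x \<bullet> x))"
      using dd[OF x] by (simp add: t_def)
    then have "(t x * ?a + ?b)\<^sup>2 = ?b\<^sup>2 + ?a * (1 - x \<bullet> x)" using s by simp
    then have "?a * ((t x)\<^sup>2 * ?a + 2 * t x * ?b + x \<bullet> x - 1) = 0"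
      by (simp add: power2_eq_square algebra_simps)
    then have "(t x)\<^sup>2 * ?a + 2 * t x * ?b + x \<bullet> x = 1" using dd[OF x] by simp
    then have "r x \<bullet> r x = 1"
      by (simp add: r_def inner_add_left inner_add_right inner_commute power2_eq_square algebra_simps)
    then show ?thesis by (simp add: norm_eq_1)
  qed
  moreover have "r x = x" if x: "x \<in> B" for x
  proof -
    have n: "x \<bullet> x = 1" using x B(2) by (auto simp: norm_eq_1)
    have "x \<bullet> d x = 1 - (x \<bullet> p) / c" using n by (simp add: d_def inner_diff_right divide_inverse mult.commute)
    also have "\<dots> \<ge> 0" using c x by simp
    finally have "t x = 0" using n by (simp add: t_def)
    then show ?thesis by (simp add: r_def)
  qed
  ultimately show ?thesis using that by blast
qed

lemma Hausdorff_functions: "Hausdorff_space (top_of_set (S :: ('v \<Rightarrow> real) set))"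
  unfolding powertop_eq[symmetric]
  by (intro Hausdorff_space_subtopology) (simp add: Hausdorff_space_product_topology)

lemma continuous_on_inv_into_functions:
  fixes f :: "'d::t2_space \<Rightarrow> 'v \<Rightarrow> real"
  assumes "compact S" "continuous_on S f" "inj_on f S"
  shows "continuous_on (f ` S) (inv_into S f)"
proof -
  have "homeomorphic_map (top_of_set S) (top_of_set (f ` S)) f"
    using assms by (intro T1_Spaces.continuous_imp_homeomorphic_map Hausdorff_functions) (auto simp: compact_space_subtopology)
  then obtain g where "homeomorphic_maps (top_of_set S) (top_of_set (f ` S)) f g"
    unfolding homeomorphic_map_maps by blast
  then have g: "continuous_on (f ` S) g" "\<forall>x\<in>S. g (f x) = x"
    by (auto simp: homeomorphic_maps_def)
  show ?thesis
    using g assms(3) by (intro continuous_on_eq[OF g(1)]) auto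
qed

lemma star_simplicial:
  assumes M: "simplicial M" shows "simplicial {\<sigma> \<in> M. insert e \<sigma> \<in> M}"
  unfolding simplicial_def
proof (intro ballI conjI allI impI)
  fix \<sigma> assume s: "\<sigma> \<in> {\<sigma> \<in> M. insert e \<sigma> \<in> M}"
  then show "finite \<sigma>" "\<sigma> \<noteq> {}" using simplicialD(1,2)[OF M] by auto
  fix \<tau> assume t: "\<tau> \<subseteq> \<sigma>" "\<tau> \<noteq> {}"
  have "insert e \<tau> \<subseteq> insert e \<sigma>" using t by blast
  then show "\<tau> \<in> {\<sigma> \<in> M. insert e \<sigma> \<in> M}"
    using s t simplicialD(3)[OF M, of \<sigma> \<tau>] simplicialD(3)[OF M, of "insert e \<sigma>" "insert e \<tau>"] by simp
qed

text \<open>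
  The closed star of \<open>e\<close> is a disc whose boundary sphere contains the vertex \<open>a\<close>. Since every simplex at
  \<open>a\<close> lies in this star, the rest of the complex meets the sphere only in points with vanishing
  coordinate at \<open>a\<close>. A retraction of the disc onto its sphere that fixes those points, joined to the
  identity by straight lines in the disc, pushes everything off \<open>e\<close> and extends by the identity.
\<close>

lemma collapse_cell:
  assumes M: "simplicial M" and ae: "{a, e} \<in> M" "a \<noteq> e"
    and free: "\<And>\<sigma>. \<sigma> \<in> M \<Longrightarrow> a \<in> \<sigma> \<Longrightarrow> insert e \<sigma> \<in> M"
    and fin: "finite {\<sigma> \<in> M. insert e \<sigma> \<in> M}"
    and \<Psi>: "continuous_on (cball 0 1) \<Psi>" "inj_on \<Psi> (cball 0 1)"
      "\<Psi> ` cball (0 :: 'a::euclidean_space) 1 = underlying_space {\<sigma> \<in> M. insert e \<sigma> \<in> M}"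
      "\<And>x. x \<in> cball 0 1 \<Longrightarrow> \<Psi> x e = 0 \<longleftrightarrow> norm x = 1"
    and f: "tame M square f" "collapses_boundary f"
  obtains f' where "sphere_homotopic (realization M) f f'" "tame {\<sigma> \<in> M. e \<notin> \<sigma>} square f'" "collapses_boundary f'"
proof -
  define St where "St = {\<sigma> \<in> M. insert e \<sigma> \<in> M}"
  let ?C = "cball (0::'a) 1"
  have St: "simplicial St" "finite St" "St \<subseteq> M"
    using star_simplicial[OF M] fin by (auto simp: St_def)
  have \<Psi>im: "\<Psi> ` ?C = underlying_space St" using \<Psi>(3) by (simp add: St_def)
  define \<delta> where "\<delta> v = (if v = a then 1 else (0::real))" for v
  have "\<delta> \<in> closed_simplex {a}" by (auto simp: \<delta>_def closed_simplex_def)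
  moreover have "{a} \<in> St"
    using ae simplicialD(3)[OF M ae(1), of "{a}"] by (auto simp: St_def insert_commute)
  ultimately have "\<delta> \<in> \<Psi> ` ?C" unfolding \<Psi>im by (auto simp: underlying_space_def)
  then obtain p where p: "p \<in> ?C" "\<Psi> p = \<delta>" by auto
  have np: "norm p = 1" using \<Psi>(4)[OF p(1)] ae(2) by (auto simp: p(2) \<delta>_def)
  define B where "B = {x \<in> sphere 0 1. \<Psi> x a = 0}"
  have cC: "continuous_on ?C (\<lambda>x. \<Psi> x v)" for v
    by (rule continuous_on_product_then_coordinatewise[OF \<Psi>(1)])
  have "closed B"
    unfolding B_def
  proof (rule continuous_closed_preimage_constant)
    show "continuous_on (sphere 0 1) (\<lambda>x. \<Psi> x a)" by (rule continuous_on_subset[OF cC]) auto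
  qed auto
  then have "compact (sphere 0 1 \<inter> B)" by (rule compact_Int_closed[OF compact_sphere])
  moreover have "sphere 0 1 \<inter> B = B" by (auto simp: B_def)
  ultimately have "compact B" by simp
  moreover have "p \<notin> B" using p(2) by (simp add: B_def \<delta>_def)
  moreover have "B \<subseteq> sphere 0 1" by (auto simp: B_def)
  ultimately have cB: "compact B" "B \<subseteq> sphere 0 1" "p \<notin> B" by auto
  obtain r where r: "continuous_on ?C r" "\<And>x. x \<in> ?C \<Longrightarrow> norm (r x) = 1" "\<And>x. x \<in> B \<Longrightarrow> r x = x"
    using retract_disc_onto_circle[OF np cB] by blast
  define \<Theta> where "\<Theta> = inv_into ?C \<Psi>"
  have \<Theta>: "continuous_on (underlying_space St) \<Theta>"
    using continuous_on_inv_into_functions[OF compact_cball \<Psi>(1,2)] \<Psi>im by (simp add: \<Theta>_def)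
  have \<Theta>1: "\<Theta> y \<in> ?C" "\<Psi> (\<Theta> y) = y" if "y \<in> underlying_space St" for y
    using that inv_into_into[of y \<Psi> ?C] f_inv_into_f[of y \<Psi> ?C] unfolding \<Psi>im[symmetric] \<Theta>_def by simp_all
  obtain J0 where J0: "continuous_on square f" "finite J0" "J0 \<subseteq> M" "simplicial J0" "f ` square \<subseteq> underlying_space J0"
    using tameE[OF f(1) M] .
  define Z where "Z = {y \<in> underlying_space J0. y e = 0 \<and> y a = 0}"
  let ?U = "underlying_space St"
  have closed: "closed ?U" "closed Z"
  proof -
    have "closed {y :: 'b \<Rightarrow> real. y e = 0 \<and> y a = 0}"
      by (intro closed_Collect_conj closed_Collect_eq continuous_intros) simp_all
    moreover have "Z = underlying_space J0 \<inter> {y. y e = 0 \<and> y a = 0}" by (auto simp: Z_def)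
    ultimately show "closed Z" using closed_space_finite[OF J0(2)] by auto
  qed (rule closed_space_finite[OF St(2)])
  have cover: "f ` square \<subseteq> ?U \<union> Z"
  proof
    fix y assume "y \<in> f ` square"
    then have y: "y \<in> underlying_space J0" "y \<in> underlying_space M" using J0(5) space_mono[OF J0(3)] by auto
    have sy: "supp y \<in> M" using y(2) by (simp add: space_iff[OF M])
    have "supp y \<in> St" if "y e \<noteq> 0 \<or> y a \<noteq> 0"
      using that free[OF sy] sy by (auto simp: St_def insert_absorb)
    then have "y \<in> ?U" if "y e \<noteq> 0 \<or> y a \<noteq> 0"
      using that y(2) by (simp add: space_iff[OF M] space_iff[OF St(1)])
    then show "y \<in> ?U \<union> Z" using y(1) by (auto simp: Z_def)
  qed
  have fixed: "r (\<Theta> y) = \<Theta> y" if "y \<in> ?U" "y \<in> Z" for y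
  proof (rule r(3))
    show "\<Theta> y \<in> B"
      using \<Theta>1[OF that(1)] \<Psi>(4)[of "\<Theta> y"] that(2) by (auto simp: B_def Z_def)
  qed
  let ?G = "\<lambda>(s::real, y). \<Psi> ((1 - s) *\<^sub>R \<Theta> y + s *\<^sub>R r (\<Theta> y))"
  let ?D = "\<lambda>x. if snd x \<in> ?U then ?G x else snd x"
  have conv: "(1 - s) *\<^sub>R \<Theta> y + s *\<^sub>R r (\<Theta> y) \<in> ?C" if "s \<in> {0..1}" "y \<in> ?U" for s y
    using convexD_alt[OF convex_cball, of "\<Theta> y" 0 1 "r (\<Theta> y)" s] \<Theta>1[OF that(2)] r(2) that(1) by auto
  have "continuous_on ({0..1::real} \<times> ?U \<union> {0..1::real} \<times> Z) ?D"
  proof (rule continuous_on_cases)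
    show "closed ({0..1::real} \<times> ?U)" "closed ({0..1::real} \<times> Z)"
      by (intro closed_Times closed closed_atLeastAtMost)+
    have c\<Theta>: "continuous_on ({0..1::real} \<times> ?U) (\<lambda>x::real \<times> ('b \<Rightarrow> real). \<Theta> (snd x))"
      by (rule continuous_on_compose2[OF \<Theta> continuous_on_snd[OF continuous_on_id]]) auto
    have cr: "continuous_on ({0..1::real} \<times> ?U) (\<lambda>x::real \<times> ('b \<Rightarrow> real). r (\<Theta> (snd x)))"
      by (rule continuous_on_compose2[OF r(1) c\<Theta>]) (use \<Theta>1(1) in auto)
    have "continuous_on ({0..1::real} \<times> ?U) (\<lambda>x. \<Psi> ((1 - fst x) *\<^sub>R \<Theta> (snd x) + fst x *\<^sub>R r (\<Theta> (snd x))))"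
    proof (rule continuous_on_compose2[OF \<Psi>(1)])
      show "continuous_on ({0..1::real} \<times> ?U) (\<lambda>x. (1 - fst x) *\<^sub>R \<Theta> (snd x) + fst x *\<^sub>R r (\<Theta> (snd x)))"
        by (intro continuous_intros c\<Theta> cr)
    qed (use conv in auto)
    then show "continuous_on ({0..1::real} \<times> ?U) ?G" by (simp add: case_prod_beta')
    show "continuous_on ({0..1::real} \<times> Z) snd" by (intro continuous_intros)
    show "\<forall>x. x \<in> {0..1::real} \<times> ?U \<and> \<not> snd x \<in> ?U \<or> x \<in> {0..1::real} \<times> Z \<and> snd x \<in> ?U \<longrightarrow> ?G x = snd x"
      using fixed \<Theta>1(2) by (auto simp flip: scaleR_left_distrib)
  qed
  then have D: "tame M ({0..1::real} \<times> (?U \<union> Z)) ?D"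
    unfolding Sigma_Un_distrib2
  proof (rule tameI[where J = "St \<union> J0"])
    show "?D ` ({0..1::real} \<times> ?U \<union> {0..1::real} \<times> Z) \<subseteq> underlying_space (St \<union> J0)"
    proof (rule image_subsetI)
      fix x assume x: "x \<in> {0..1::real} \<times> ?U \<union> {0..1::real} \<times> Z"
      have "\<Psi> ((1 - fst x) *\<^sub>R \<Theta> (snd x) + fst x *\<^sub>R r (\<Theta> (snd x))) \<in> ?U" if "snd x \<in> ?U"
        using conv[of "fst x" "snd x"] x that unfolding \<Psi>im[symmetric] by auto
      then show "?D x \<in> underlying_space (St \<union> J0)"
        using x by (auto simp: underlying_space_def Z_def case_prod_beta)
    qed
  qed (use St J0 in auto)
  have hom: "sphere_homotopic (realization M) f (\<lambda>t. ?D (1, f t))"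
    by (rule sphere_homotopic_deform[OF J0(1) cover f(2) D]) (use \<Theta>1(2) in auto)
  have M': "simplicial {\<sigma> \<in> M. e \<notin> \<sigma>}"
    using M unfolding simplicial_def by blast
  define f' where "f' t = ?D (1, f t)" for t
  have "tame M ({1::real} \<times> (?U \<union> Z)) ?D" by (rule tame_subset[OF D]) auto
  then have tD: "tame M square f'"
    unfolding f'_def by (rule tame_compose) (use cover in \<open>auto intro!: continuous_intros J0(1)\<close>)
  have fe: "f' t e = 0" if t: "t \<in> square" for t
  proof (cases "f t \<in> ?U")
    case True
    then show ?thesis using \<Psi>(4)[of "r (\<Theta> (f t))"] r(2) \<Theta>1(1)[OF True] by (auto simp: f'_def)
  next
    case False
    then show ?thesis using cover t by (auto simp: Z_def f'_def)
  qed
  have "f' ` square \<subseteq> underlying_space {\<sigma> \<in> M. e \<notin> \<sigma>}"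
  proof (rule image_subsetI)
    fix t assume t: "t \<in> square"
    show "f' t \<in> underlying_space {\<sigma> \<in> M. e \<notin> \<sigma>}"
      using tame_values[OF tD t] fe[OF t] by (simp add: space_iff[OF M] space_iff[OF M'])
  qed
  then have "tame {\<sigma> \<in> M. e \<notin> \<sigma>} square f'"
    using tD unfolding tame_iff[OF M] tame_iff[OF M'] by blast
  moreover have "collapses_boundary f'"
  proof -
    obtain y where "\<forall>t\<in>square_boundary. f t = y" using f(2) by (auto simp: collapses_boundary_def)
    then have "\<forall>t\<in>square_boundary. f' t = ?D (1, y)" unfolding f'_def by simp
    then show ?thesis unfolding collapses_boundary_def by (rule exI[of _ "?D (1, y)"])
  qed
  ultimately show ?thesis using that hom unfolding f'_def by blast
qed

section \<open>Homotopy classes of paths\<close>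

definition vertex :: "'v \<Rightarrow> 'v \<Rightarrow> real" where
  "vertex v = (\<lambda>u. if u = v then 1 else 0)"

definition segment_path :: "('v \<Rightarrow> real) \<Rightarrow> ('v \<Rightarrow> real) \<Rightarrow> real \<Rightarrow> 'v \<Rightarrow> real" where
  "segment_path x y = (\<lambda>t v. (1 - t) * x v + t * y v)"

text \<open>
  Paths that are homotopic in the realization with fixed ends; by compactness a finite subcomplex
  suffices for the homotopy.
\<close>

definition homotopic :: "'v set set \<Rightarrow> (real \<Rightarrow> 'v \<Rightarrow> real) \<Rightarrow> (real \<Rightarrow> 'v \<Rightarrow> real) \<Rightarrow> bool" where
  "homotopic K p q \<longleftrightarrow> (\<exists>J. finite J \<and> J \<subseteq> K \<and> homotopic_paths (underlying_space J) p q)"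

lemma vertex_in_simplex: "finite \<sigma> \<Longrightarrow> v \<in> \<sigma> \<Longrightarrow> vertex v \<in> closed_simplex \<sigma>"
  by (auto simp: closed_simplex_def vertex_def)

lemma supp_vertex [simp]: "supp (vertex v) = {v}"
  by (auto simp: supp_def vertex_def)

lemma vertex_eq_iff [simp]: "vertex v = vertex w \<longleftrightarrow> v = w"
  by (metis singleton_inject supp_vertex)

lemma segment_path_ends [simp]:
  "pathstart (segment_path x y) = x" "pathfinish (segment_path x y) = y"
  "segment_path x y 0 = x" "segment_path x y 1 = y"
  by (simp_all add: segment_path_def pathstart_def pathfinish_def)

lemma segment_path_refl [simp]: "segment_path x x = (\<lambda>_. x)"
  by (auto simp: segment_path_def fun_eq_iff algebra_simps)

lemma reversepath_segment_path [simp]: "reversepath (segment_path x y) = segment_path y x"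
  by (auto simp: segment_path_def reversepath_def fun_eq_iff algebra_simps)

lemma supp_segment_path: "supp (segment_path x y t) \<subseteq> supp x \<union> supp y"
  by (auto simp: segment_path_def)

lemma homotopic_refl_iff: "homotopic K p p \<longleftrightarrow> tame K {0..1} p"
  by (auto simp: homotopic_def tame_def path_def path_image_def)

lemma homotopic_sym: "homotopic K p q \<Longrightarrow> homotopic K q p"
  unfolding homotopic_def using homotopic_paths_sym by blast

lemma homotopic_trans:
  assumes "homotopic K p q" "homotopic K q r" shows "homotopic K p r"
proof -
  obtain J1 J2 where J: "finite J1" "J1 \<subseteq> K" "homotopic_paths (underlying_space J1) p q"
    "finite J2" "J2 \<subseteq> K" "homotopic_paths (underlying_space J2) q r"
    using assms by (auto simp: homotopic_def)
  have "homotopic_paths (underlying_space (J1 \<union> J2)) p r"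
    by (rule homotopic_paths_trans[OF homotopic_paths_subset[OF J(3)] homotopic_paths_subset[OF J(6)]])
       (intro space_mono; simp)+
  then show ?thesis using J by (auto simp: homotopic_def intro!: exI[of _ "J1 \<union> J2"])
qed

lemma homotopic_left: "homotopic K p q \<Longrightarrow> homotopic K p p" and homotopic_right: "homotopic K p q \<Longrightarrow> homotopic K q q"
  using homotopic_trans homotopic_sym by blast+

lemma homotopic_ends: "homotopic K p q \<Longrightarrow> pathstart p = pathstart q" "homotopic K p q \<Longrightarrow> pathfinish p = pathfinish q"
  unfolding homotopic_def using homotopic_paths_imp_pathstart homotopic_paths_imp_pathfinish by blast+

lemma homotopic_join:
  assumes "homotopic K p p'" "homotopic K q q'" "pathfinish p = pathstart q"
  shows "homotopic K (p +++ q) (p' +++ q')"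
proof -
  obtain J1 J2 where J: "finite J1" "J1 \<subseteq> K" "homotopic_paths (underlying_space J1) p p'"
    "finite J2" "J2 \<subseteq> K" "homotopic_paths (underlying_space J2) q q'"
    using assms by (auto simp: homotopic_def)
  have "homotopic_paths (underlying_space (J1 \<union> J2)) (p +++ q) (p' +++ q')"
    by (rule homotopic_paths_join[OF homotopic_paths_subset[OF J(3)] homotopic_paths_subset[OF J(6)] assms(3)])
       (intro space_mono; simp)+
  then show ?thesis using J by (auto simp: homotopic_def intro!: exI[of _ "J1 \<union> J2"])
qed

lemma homotopic_assoc:
  assumes "homotopic K p p" "homotopic K q q" "homotopic K r r" "pathfinish p = pathstart q" "pathfinish q = pathstart r"
  shows "homotopic K (p +++ (q +++ r)) ((p +++ q) +++ r)"
proof -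
  obtain J1 J2 J3 where J: "finite J1" "J1 \<subseteq> K" "path p" "path_image p \<subseteq> underlying_space J1"
    "finite J2" "J2 \<subseteq> K" "path q" "path_image q \<subseteq> underlying_space J2"
    "finite J3" "J3 \<subseteq> K" "path r" "path_image r \<subseteq> underlying_space J3"
    using assms(1-3) unfolding homotopic_def homotopic_paths_refl by blast
  have sub: "underlying_space J1 \<subseteq> underlying_space (J1 \<union> J2 \<union> J3)" "underlying_space J2 \<subseteq> underlying_space (J1 \<union> J2 \<union> J3)"
    "underlying_space J3 \<subseteq> underlying_space (J1 \<union> J2 \<union> J3)"
    by (intro space_mono; blast)+
  have "homotopic_paths (underlying_space (J1 \<union> J2 \<union> J3)) (p +++ (q +++ r)) ((p +++ q) +++ r)"
    by (rule homotopic_paths_assoc) (use J sub assms in auto)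
  then show ?thesis using J by (auto simp: homotopic_def intro!: exI[of _ "J1 \<union> J2 \<union> J3"])
qed

text \<open>
  All homotopies of paths below are images of straight-line homotopies in a convex parameter set.
\<close>

lemma homotopic_convex:
  fixes S :: "'a::real_normed_vector set"
  assumes S: "convex S" and h: "tame K S h"
    and p: "path p" "path_image p \<subseteq> S" and q: "path q" "path_image q \<subseteq> S"
    and ends: "pathstart p = pathstart q" "pathfinish p = pathfinish q"
  shows "homotopic K (h \<circ> p) (h \<circ> q)"
proof -
  obtain J where J: "continuous_on S h" "finite J" "J \<subseteq> K" "h ` S \<subseteq> underlying_space J"
    using h by (auto simp: tame_def)
  have "homotopic_paths S p q"
  proof (rule homotopic_paths_linear[OF p(1) q(1) ends(1)[symmetric] ends(2)[symmetric]])
    show "closed_segment (p t) (q t) \<subseteq> S" if "t \<in> {0..1}" for t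
    proof (rule closed_segment_subset[OF _ _ S])
      show "p t \<in> S" "q t \<in> S" using p(2) q(2) that by (auto simp: path_image_def)
    qed
  qed
  then have "homotopic_paths (underlying_space J) (h \<circ> p) (h \<circ> q)"
    by (rule homotopic_paths_continuous_image) (use J in auto)
  then show ?thesis using J by (auto simp: homotopic_def)
qed

lemma homotopic_reparametrize:
  assumes "tame K {0..1::real} p" "path g" "path_image g \<subseteq> {0..1}" "path g'" "path_image g' \<subseteq> {0..1}"
    "pathstart g = pathstart g'" "pathfinish g = pathfinish g'"
  shows "homotopic K (p \<circ> g) (p \<circ> g')"
  by (rule homotopic_convex[OF _ assms]) auto

lemma segment01: "path_image (linepath a b) \<subseteq> {0..1}" if "a \<in> {0..1}" "b \<in> {0..1}" for a b :: real
  using that closed_segment_subset[of a "{0..1}" b] by auto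

lemma compose_linepath:
  "p \<circ> linepath 0 1 = p" "p \<circ> linepath 1 0 = reversepath p" "p \<circ> linepath c c = (\<lambda>_. p c)"
  for p :: "real \<Rightarrow> 'b::topological_space"
  by (auto simp: linepath_def reversepath_def fun_eq_iff algebra_simps)

lemma homotopic_join_reparametrize:
  assumes p: "tame K {0..1::real} p" and "a \<in> {0..1}" "b \<in> {0..1}" "c \<in> {0..1}"
  shows "homotopic K ((p \<circ> linepath a b) +++ (p \<circ> linepath b c)) (p \<circ> linepath a c)"
proof -
  have "path_image (linepath a b +++ linepath b c) \<subseteq> {0..1}"
    by (rule subset_path_image_join[OF segment01[OF assms(2,3)] segment01[OF assms(3,4)]])
  then have "homotopic K (p \<circ> (linepath a b +++ linepath b c)) (p \<circ> linepath a c)"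
    by (intro homotopic_reparametrize[OF p] segment01 assms) auto
  then show ?thesis by (simp add: path_compose_join)
qed

lemma homotopic_rid:
  assumes "homotopic K p p" "x = pathfinish p" shows "homotopic K (p +++ (\<lambda>_. x)) p"
  using homotopic_join_reparametrize[of K p 0 1 1] assms
  by (simp add: homotopic_refl_iff compose_linepath(1,3) pathfinish_def)

lemma homotopic_lid:
  assumes "homotopic K p p" "x = pathstart p" shows "homotopic K ((\<lambda>_. x) +++ p) p"
  using homotopic_join_reparametrize[of K p 0 0 1] assms
  by (simp add: homotopic_refl_iff compose_linepath(1,3) pathstart_def)

lemma homotopic_rinv:
  assumes "homotopic K p p" shows "homotopic K (p +++ reversepath p) (\<lambda>_. pathstart p)"
  using homotopic_join_reparametrize[of K p 0 1 0] assms
  by (simp add: homotopic_refl_iff compose_linepath(1,2,3) pathstart_def)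

lemma homotopic_subpaths:
  assumes "homotopic K p p" "a \<in> {0..1}" "b \<in> {0..1}" "c \<in> {0..1}"
  shows "homotopic K ((p \<circ> linepath a b) +++ (p \<circ> linepath b c)) (p \<circ> linepath a c)"
    and "homotopic K (p \<circ> linepath a b) (p \<circ> linepath a b)"
  using homotopic_join_reparametrize[of K p a b c] homotopic_join_reparametrize[of K p a b b] homotopic_join_reparametrize[of K p a a b] assms
    homotopic_right by (auto simp: homotopic_refl_iff)

lemma homotopic_reversepath_refl: "homotopic K p p \<Longrightarrow> homotopic K (reversepath p) (reversepath p)"
  unfolding homotopic_def homotopic_paths_refl by simp

lemma homotopic_const_refl: "simplicial K \<Longrightarrow> x \<in> underlying_space K \<Longrightarrow> homotopic K (\<lambda>_. x) (\<lambda>_. x)"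
  unfolding homotopic_refl_iff by (auto simp: tame_iff image_constant_conv)

lemma tame_segment_path:
  assumes "x \<in> closed_simplex \<sigma>" "y \<in> closed_simplex \<sigma>" "\<sigma> \<in> K"
  shows "tame K {0..1} (segment_path x y)"
proof (rule tameI[where J = "{\<sigma>}"])
  show "continuous_on {0..1} (segment_path x y)"
    unfolding segment_path_def by (intro continuous_on_coordinatewise_then_product continuous_intros)
  show "segment_path x y ` {0..1} \<subseteq> underlying_space {\<sigma>}"
    using closed_simplex_convex[OF assms(1,2)] by (auto simp: underlying_space_def segment_path_def)
qed (use assms in auto)

text \<open>
  The straight contraction of the star towards \<open>v\<close> is a map of the unit square; the two paths are
  the images of the two ways around its boundary.
\<close>

lemma homotopic_star:
  assumes K: "simplicial K" and p: "homotopic K p p" and v: "\<And>t. t \<in> {0..1} \<Longrightarrow> insert v (supp (p t)) \<in> K"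
  shows "homotopic K (p +++ segment_path (p 1) (vertex v)) (segment_path (p 0) (vertex v))"
proof -
  let ?S = "{0..1} \<times> {0..1} :: (real \<times> real) set"
  define Q where "Q x = segment_path (p (fst x)) (vertex v) (snd x)" for x :: "real \<times> real"
  have p': "continuous_on {0..1} p" "p ` {0..1} \<subseteq> underlying_space K" "finite (supp ` p ` {0..1})"
    using p by (auto simp: homotopic_refl_iff tame_iff[OF K])
  have Q: "tame K ?S Q"
  proof (rule tameI[where J = "(insert v) ` supp ` p ` {0..1}"])
    have "continuous_on ?S (\<lambda>x. (1 - snd x) * p (fst x) u + snd x * vertex v u)" for u
      by (intro continuous_intros continuous_on_compose2[OF continuous_on_product_then_coordinatewise[OF p'(1)]]) auto
    then show "continuous_on ?S Q"
      unfolding Q_def segment_path_def by (intro continuous_on_coordinatewise_then_product)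
    show "insert v ` supp ` p ` {0..1} \<subseteq> K" using v by auto
    show "Q ` ?S \<subseteq> underlying_space (insert v ` supp ` p ` {0..1})"
    proof (rule image_subsetI)
      fix x assume x: "x \<in> ?S"
      let ?s = "insert v (supp (p (fst x)))"
      have "?s \<in> K" by (rule v) (use x in auto)
      then have f: "finite ?s" by (rule simplicialD(1)[OF K])
      have "p (fst x) \<in> underlying_space K" using p'(2) x by auto
      then have "p (fst x) \<in> closed_simplex ?s"
        unfolding space_iff[OF K] closed_simplex_iff[OF f] by blast
      then have "Q x \<in> closed_simplex ?s"
        using closed_simplex_convex[OF _ vertex_in_simplex[OF f, of v], of "p (fst x)" "snd x"] x
        by (auto simp: Q_def segment_path_def)
      then show "Q x \<in> underlying_space (insert v ` supp ` p ` {0..1})"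
        using x by (auto simp: underlying_space_def)
    qed
  qed (use p' in auto)
  have sub: "path_image (linepath a b) \<subseteq> ?S" if "a \<in> ?S" "b \<in> ?S" for a b
    using that closed_segment_subset[of a ?S b] by (auto intro: convex_Times)
  have "homotopic K (Q \<circ> (linepath (0,0) (1,0) +++ linepath (1,0) (1,1))) (Q \<circ> (linepath (0,0) (0,1) +++ linepath (0,1) (1,1)))"
  proof (rule homotopic_convex[OF _ Q])
    show "convex ?S" by (intro convex_Times) auto
    show "path_image (linepath (0,0) (1,0) +++ linepath (1,0) (1,1)) \<subseteq> ?S"
      "path_image (linepath (0,0) (0,1) +++ linepath (0,1) (1,1)) \<subseteq> ?S"
      by (intro subset_path_image_join sub; simp)+
  qed auto
  moreover have "Q \<circ> linepath (0,0) (1,0) = p" "Q \<circ> linepath (1,0) (1,1) = segment_path (p 1) (vertex v)"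
    "Q \<circ> linepath (0,0) (0,1) = segment_path (p 0) (vertex v)" "Q \<circ> linepath (0,1) (1,1) = (\<lambda>_. vertex v)"
    by (auto simp: Q_def linepath_def fun_eq_iff segment_path_def)
  ultimately have "homotopic K (p +++ segment_path (p 1) (vertex v)) (segment_path (p 0) (vertex v) +++ (\<lambda>_. vertex v))"
    by (simp add: path_compose_join)
  moreover have "homotopic K (segment_path (p 0) (vertex v)) (segment_path (p 0) (vertex v))"
  proof -
    let ?s = "insert v (supp (p 0))"
    have s: "?s \<in> K" by (rule v) simp
    note s = s simplicialD(1)[OF K s]
    have "p 0 \<in> underlying_space K" using p'(2) by auto
    then have "p 0 \<in> closed_simplex ?s"
      unfolding space_iff[OF K] closed_simplex_iff[OF s(2)] by blast
    then show ?thesis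
      unfolding homotopic_refl_iff using s(1) vertex_in_simplex[OF s(2), of v] by (intro tame_segment_path[where \<sigma> = ?s]) simp_all
  qed
  ultimately show ?thesis using homotopic_rid homotopic_trans by fastforce
qed

section \<open>The universal cover\<close>

fun loop_power :: "(real \<Rightarrow> 'b::topological_space) \<Rightarrow> nat \<Rightarrow> real \<Rightarrow> 'b" where
  "loop_power l 0 = (\<lambda>_. pathstart l)"
| "loop_power l (Suc n) = loop_power l n +++ l"

locale based_complex =
  fixes K :: "'v set set" and b :: 'v
  assumes K: "simplicial K" and b: "{b} \<in> K"
begin

definition path_at :: "(real \<Rightarrow> 'v \<Rightarrow> real) \<Rightarrow> ('v \<Rightarrow> real) \<Rightarrow> ('v \<Rightarrow> real) \<Rightarrow> bool" where
  "path_at q x y \<longleftrightarrow> homotopic K q q \<and> pathstart q = x \<and> pathfinish q = y"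

definition path_class :: "(real \<Rightarrow> 'v \<Rightarrow> real) \<Rightarrow> (real \<Rightarrow> 'v \<Rightarrow> real) set" where
  "path_class p = {q. homotopic K p q}"

text \<open>
  The points over \<open>y\<close> in the universal cover.
\<close>

definition fibre :: "('v \<Rightarrow> real) \<Rightarrow> (real \<Rightarrow> 'v \<Rightarrow> real) set set" where
  "fibre y = {path_class p | p. path_at p (vertex b) y}"

text \<open>
  The end of the lift of the path \<open>q\<close> that starts at \<open>\<kappa>\<close>.
\<close>

definition transport :: "(real \<Rightarrow> 'v \<Rightarrow> real) set \<Rightarrow> (real \<Rightarrow> 'v \<Rightarrow> real) \<Rightarrow> (real \<Rightarrow> 'v \<Rightarrow> real) set" where
  "transport \<kappa> q = {r. \<exists>p\<in>\<kappa>. homotopic K (p +++ q) r}"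

lemma path_class_eq: "homotopic K p q \<Longrightarrow> path_class p = path_class q"
  unfolding path_class_def using homotopic_trans homotopic_sym by blast

lemma path_class_eqD: "path_class p = path_class q \<Longrightarrow> homotopic K q q \<Longrightarrow> homotopic K p q"
  unfolding path_class_def by blast

lemma path_at_join: "path_at p x y \<Longrightarrow> path_at q y z \<Longrightarrow> path_at (p +++ q) x z"
  unfolding path_at_def using homotopic_join[of K p p q q] by simp

lemma path_at_reverse: "path_at p x y \<Longrightarrow> path_at (reversepath p) y x"
  unfolding path_at_def using homotopic_reversepath_refl[of K p] by simp

lemma transport_path_class:
  assumes "path_at p x y" "path_at q y z"
  shows "transport (path_class p) q = path_class (p +++ q)"
proof
  show "transport (path_class p) q \<subseteq> path_class (p +++ q)"
  proof
    fix r assume "r \<in> transport (path_class p) q"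
    then obtain p' where p': "homotopic K p p'" "homotopic K (p' +++ q) r" by (auto simp: transport_def path_class_def)
    have "homotopic K (p +++ q) (p' +++ q)"
      using homotopic_join[OF p'(1)] assms by (simp add: path_at_def)
    then show "r \<in> path_class (p +++ q)" using homotopic_trans p'(2) by (auto simp: path_class_def)
  qed
  show "path_class (p +++ q) \<subseteq> transport (path_class p) q"
    using assms by (auto simp: transport_def path_class_def path_at_def)
qed

lemma transport_fibre: "\<kappa> \<in> fibre y \<Longrightarrow> path_at q y z \<Longrightarrow> transport \<kappa> q \<in> fibre z"
  unfolding fibre_def using transport_path_class path_at_join by blast

lemma transport_join:
  assumes "\<kappa> \<in> fibre x" "path_at p x y" "path_at q y z"
  shows "transport \<kappa> (p +++ q) = transport (transport \<kappa> p) q"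
proof -
  obtain g where g: "\<kappa> = path_class g" "path_at g (vertex b) x" using assms(1) by (auto simp: fibre_def)
  have "homotopic K (g +++ (p +++ q)) ((g +++ p) +++ q)"
    using g(2) assms by (intro homotopic_assoc) (auto simp: path_at_def)
  then have "path_class (g +++ (p +++ q)) = path_class ((g +++ p) +++ q)" by (rule path_class_eq)
  then show ?thesis
    using transport_path_class[OF g(2) path_at_join[OF assms(2,3)]] transport_path_class[OF g(2) assms(2)]
      transport_path_class[OF path_at_join[OF g(2) assms(2)] assms(3)] g(1) by simp
qed

lemma transport_homotopic:
  assumes "\<kappa> \<in> fibre (pathstart p)" "homotopic K p q"
  shows "transport \<kappa> p = transport \<kappa> q"
proof -
  obtain g where g: "\<kappa> = path_class g" "path_at g (vertex b) (pathstart p)" using assms(1) by (auto simp: fibre_def)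
  have pq: "path_at p (pathstart p) (pathfinish p)" "path_at q (pathstart p) (pathfinish p)"
    using homotopic_left[OF assms(2)] homotopic_right[OF assms(2)] homotopic_ends[OF assms(2)] by (simp_all add: path_at_def)
  have "homotopic K (g +++ p) (g +++ q)"
    using g(2) assms(2) by (intro homotopic_join) (auto simp: path_at_def)
  then show ?thesis
    using transport_path_class[OF g(2) pq(1)] transport_path_class[OF g(2) pq(2)] path_class_eq g(1) by simp
qed

lemma transport_const:
  assumes "\<kappa> \<in> fibre x" shows "transport \<kappa> (\<lambda>_. x) = \<kappa>"
proof -
  obtain g where g: "\<kappa> = path_class g" "path_at g (vertex b) x" using assms(1) by (auto simp: fibre_def)
  have "homotopic K (g +++ (\<lambda>_. x)) g" using g(2) by (intro homotopic_rid) (auto simp: path_at_def)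
  then have "path_class (g +++ (\<lambda>_. x)) = path_class g" by (rule path_class_eq)
  moreover have "x \<in> underlying_space K"
    using g(2) tame_values[of K "{0..1}" g 1] by (auto simp: path_at_def homotopic_refl_iff pathfinish_def)
  then have "path_at (\<lambda>_. x) x x"
    using homotopic_const_refl[OF K] by (simp add: path_at_def pathstart_def pathfinish_def)
  ultimately show ?thesis using transport_path_class[OF g(2)] g(1) by simp
qed

lemma transport_reverse:
  assumes "\<kappa> \<in> fibre x" "path_at p x y"
  shows "transport (transport \<kappa> p) (reversepath p) = \<kappa>"
proof -
  have "transport (transport \<kappa> p) (reversepath p) = transport \<kappa> (p +++ reversepath p)"
    using transport_join[OF assms path_at_reverse[OF assms(2)]] by simp
  also have "\<dots> = transport \<kappa> (\<lambda>_. x)"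
    using assms homotopic_rinv[of K p] by (intro transport_homotopic) (auto simp: path_at_def)
  finally show ?thesis using transport_const[OF assms(1)] by simp
qed

text \<open>
  The fundamental group acts freely on the universal cover.
\<close>

lemma transport_loop_trivial:
  assumes "\<kappa> \<in> fibre x" "path_at p x x" "transport \<kappa> p = \<kappa>"
  shows "homotopic K p (\<lambda>_. x)"
proof -
  obtain g where g: "\<kappa> = path_class g" "path_at g (vertex b) x" using assms(1) by (auto simp: fibre_def)
  have r: "path_at (reversepath g) x (vertex b)" by (rule path_at_reverse[OF g(2)])
  have gg: "homotopic K (reversepath g +++ g) (\<lambda>_. x)"
    using homotopic_rinv[of K "reversepath g"] r by (simp add: path_at_def)
  have "homotopic K (g +++ p) g"
    using assms(3) transport_path_class[OF g(2) assms(2)] g path_class_eqD by (auto simp: path_at_def)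
  then have "homotopic K (reversepath g +++ (g +++ p)) (reversepath g +++ g)"
    using r g(2) by (intro homotopic_join) (auto simp: path_at_def)
  then have 1: "homotopic K (reversepath g +++ (g +++ p)) (\<lambda>_. x)" using gg homotopic_trans by blast
  have "homotopic K (reversepath g +++ (g +++ p)) ((reversepath g +++ g) +++ p)"
    using r g(2) assms(2) by (intro homotopic_assoc) (auto simp: path_at_def)
  moreover have "homotopic K ((reversepath g +++ g) +++ p) ((\<lambda>_. x) +++ p)"
    using gg assms(2) g(2) by (intro homotopic_join) (auto simp: path_at_def)
  moreover have "homotopic K ((\<lambda>_. x) +++ p) p" using assms(2) by (intro homotopic_lid) (auto simp: path_at_def)
  ultimately show ?thesis using 1 homotopic_trans homotopic_sym by blast
qed

abbreviation edge :: "'v \<Rightarrow> 'v \<Rightarrow> real \<Rightarrow> 'v \<Rightarrow> real" where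
  "edge c d \<equiv> segment_path (vertex c) (vertex d)"

lemma path_at_segment:
  assumes "x \<in> closed_simplex \<sigma>" "y \<in> closed_simplex \<sigma>" "\<sigma> \<in> K"
  shows "path_at (segment_path x y) x y"
  using tame_segment_path[OF assms] by (simp add: path_at_def homotopic_refl_iff)

lemma path_at_edge: "{c, d} \<in> K \<Longrightarrow> path_at (edge c d) (vertex c) (vertex d)"
  by (rule path_at_segment) (auto intro: vertex_in_simplex)

lemma transport_star:
  assumes "\<kappa> \<in> fibre x" "path_at p x y" "\<And>t. t \<in> {0..1} \<Longrightarrow> insert v (supp (p t)) \<in> K"
  shows "transport (transport \<kappa> p) (segment_path y (vertex v)) = transport \<kappa> (segment_path x (vertex v))"
proof -
  have ends: "p 0 = x" "p 1 = y" using assms(2) by (auto simp: path_at_def pathstart_def pathfinish_def)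
  have h: "homotopic K (p +++ segment_path y (vertex v)) (segment_path x (vertex v))"
    using homotopic_star[OF K _ assms(3)] assms(2) ends by (auto simp: path_at_def)
  have y: "y \<in> underlying_space K" "insert v (supp y) \<in> K"
    using assms(2) assms(3)[of 1] ends tame_values[of K "{0..1}" p 1] by (auto simp: path_at_def homotopic_refl_iff)
  have f: "finite (insert v (supp y))" using simplicialD(1)[OF K y(2)] .
  have "path_at (segment_path y (vertex v)) y (vertex v)"
    using y vertex_in_simplex[OF f, of v] by (intro path_at_segment[OF _ _ y(2)]) (auto simp: closed_simplex_iff[OF f] space_iff[OF K])
  then have "transport (transport \<kappa> p) (segment_path y (vertex v)) = transport \<kappa> (p +++ segment_path y (vertex v))"
    using transport_join[OF assms(1,2)] by simp
  also have "\<dots> = transport \<kappa> (segment_path x (vertex v))"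
    using assms(1,2) h by (intro transport_homotopic) (auto simp: path_at_def)
  finally show ?thesis .
qed

definition endpoint :: "(real \<Rightarrow> 'v \<Rightarrow> real) set \<Rightarrow> 'v" where
  "endpoint \<kappa> = (THE c. \<kappa> \<in> fibre (vertex c))"

lemma fibre_unique:
  assumes "\<kappa> \<in> fibre x" "\<kappa> \<in> fibre y" shows "x = y"
proof -
  obtain g h where "\<kappa> = path_class g" "path_at g (vertex b) x" "\<kappa> = path_class h" "path_at h (vertex b) y"
    using assms by (auto simp: fibre_def)
  then have "homotopic K g h" using path_class_eqD by (auto simp: path_at_def)
  then show ?thesis using homotopic_ends(2) \<open>path_at g (vertex b) x\<close> \<open>path_at h (vertex b) y\<close> by (auto simp: path_at_def)
qed

lemma endpoint_eq: "\<kappa> \<in> fibre (vertex c) \<Longrightarrow> endpoint \<kappa> = c"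
  unfolding endpoint_def
proof (rule the_equality)
  fix d assume k: "\<kappa> \<in> fibre (vertex c)" "\<kappa> \<in> fibre (vertex d)"
  show "d = c" using fibre_unique[OF k] by simp
qed

definition extend :: "(real \<Rightarrow> 'v \<Rightarrow> real) set \<Rightarrow> 'v \<Rightarrow> (real \<Rightarrow> 'v \<Rightarrow> real) set" where
  "extend \<kappa> d = transport \<kappa> (edge (endpoint \<kappa>) d)"

text \<open>
  The vertices are the classes of paths that end at a vertex. A simplex lifts to such a class by
  appending the edges from its end to the vertices of the simplex; it does not matter at which vertex of
  the simplex one starts, because the triangles inside it are contractible.
\<close>

definition universal_cover :: "(real \<Rightarrow> 'v \<Rightarrow> real) set set set" where
  "universal_cover = {extend \<kappa> ` \<sigma> | \<kappa> \<sigma>. \<sigma> \<in> K \<and> endpoint \<kappa> \<in> \<sigma> \<and> \<kappa> \<in> fibre (vertex (endpoint \<kappa>))}"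

lemma sub_simplex: "\<sigma> \<in> K \<Longrightarrow> c \<in> \<sigma> \<Longrightarrow> d \<in> \<sigma> \<Longrightarrow> {c, d} \<in> K"
  using simplicialD(3)[OF K] by simp

lemma extend_fibre:
  assumes "\<kappa> \<in> fibre (vertex (endpoint \<kappa>))" "{endpoint \<kappa>, d} \<in> K"
  shows "extend \<kappa> d \<in> fibre (vertex d)" "endpoint (extend \<kappa> d) = d"
proof -
  show "extend \<kappa> d \<in> fibre (vertex d)"
    unfolding extend_def using transport_fibre[OF assms(1) path_at_edge[OF assms(2)]] .
  then show "endpoint (extend \<kappa> d) = d" by (rule endpoint_eq)
qed

lemma extend_self: "\<kappa> \<in> fibre (vertex (endpoint \<kappa>)) \<Longrightarrow> extend \<kappa> (endpoint \<kappa>) = \<kappa>"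
  unfolding extend_def using transport_const by simp

lemma extend_ext:
  assumes "\<kappa> \<in> fibre (vertex (endpoint \<kappa>))" "\<sigma> \<in> K" "endpoint \<kappa> \<in> \<sigma>" "c \<in> \<sigma>" "d \<in> \<sigma>"
  shows "extend (extend \<kappa> c) d = extend \<kappa> d"
proof -
  have e: "{endpoint \<kappa>, c} \<in> K" using sub_simplex assms by blast
  have "transport (transport \<kappa> (edge (endpoint \<kappa>) c)) (segment_path (vertex c) (vertex d)) = transport \<kappa> (segment_path (vertex (endpoint \<kappa>)) (vertex d))"
  proof (rule transport_star[OF assms(1) path_at_edge[OF e]])
    show "insert d (supp (edge (endpoint \<kappa>) c t)) \<in> K" if "t \<in> {0..1}" for t
      using supp_segment_path[of "vertex (endpoint \<kappa>)" "vertex c" t] assms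
      by (intro simplicialD(3)[OF K assms(2)]) auto
  qed
  then show ?thesis using extend_fibre(2)[OF assms(1) e] by (simp add: extend_def)
qed

lemma universal_cover_star:
  assumes "\<sigma>' \<in> universal_cover" "\<kappa> \<in> \<sigma>'"
  shows "\<kappa> \<in> fibre (vertex (endpoint \<kappa>))" "endpoint ` \<sigma>' \<in> K" "endpoint \<kappa> \<in> endpoint ` \<sigma>'" "\<sigma>' = extend \<kappa> ` endpoint ` \<sigma>'" "inj_on endpoint \<sigma>'"
proof -
  obtain \<kappa>0 \<sigma> where s: "\<sigma>' = extend \<kappa>0 ` \<sigma>" "\<sigma> \<in> K" "endpoint \<kappa>0 \<in> \<sigma>" "\<kappa>0 \<in> fibre (vertex (endpoint \<kappa>0))"
    using assms(1) by (auto simp: universal_cover_def)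
  obtain d where d: "\<kappa> = extend \<kappa>0 d" "d \<in> \<sigma>" using assms(2) s(1) by auto
  have endpoint: "endpoint (extend \<kappa>0 c) = c" "extend \<kappa>0 c \<in> fibre (vertex c)" if "c \<in> \<sigma>" for c
    using extend_fibre[OF s(4)] sub_simplex[OF s(2,3) that] by auto
  have im: "endpoint ` \<sigma>' = \<sigma>" unfolding s(1) image_image using endpoint by simp
  show "\<kappa> \<in> fibre (vertex (endpoint \<kappa>))" using d endpoint by simp
  show "endpoint ` \<sigma>' \<in> K" "endpoint \<kappa> \<in> endpoint ` \<sigma>'" using im s(2) assms(2) by auto
  have "extend \<kappa> c = extend \<kappa>0 c" if "c \<in> \<sigma>" for c
    unfolding d(1) by (rule extend_ext[OF s(4,2,3) d(2) that])
  then show "\<sigma>' = extend \<kappa> ` endpoint ` \<sigma>'" unfolding im using s(1) by simp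
  show "inj_on endpoint \<sigma>'" unfolding s(1) using endpoint by (intro inj_onI) auto
qed

lemma universal_coverI: "\<kappa> \<in> fibre (vertex (endpoint \<kappa>)) \<Longrightarrow> \<sigma> \<in> K \<Longrightarrow> endpoint \<kappa> \<in> \<sigma> \<Longrightarrow> extend \<kappa> ` \<sigma> \<in> universal_cover"
  unfolding universal_cover_def by blast

lemma universal_cover_simplicial: "simplicial universal_cover"
  unfolding simplicial_def
proof (intro ballI conjI allI impI)
  fix \<sigma>' assume s: "\<sigma>' \<in> universal_cover"
  then show "finite \<sigma>'" "\<sigma>' \<noteq> {}" using simplicialD(1)[OF K] by (auto simp: universal_cover_def)
  fix \<tau>' assume t: "\<tau>' \<subseteq> \<sigma>'" "\<tau>' \<noteq> {}"
  then obtain \<kappa> where k: "\<kappa> \<in> \<tau>'" by blast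
  then have k': "\<kappa> \<in> \<sigma>'" using t by blast
  have st: "\<kappa> \<in> fibre (vertex (endpoint \<kappa>))" "endpoint ` \<sigma>' \<in> K" "\<sigma>' = extend \<kappa> ` endpoint ` \<sigma>'"
    by (rule universal_cover_star[OF s k'])+
  have e: "extend \<kappa> (endpoint \<mu>) = \<mu>" if "\<mu> \<in> \<sigma>'" for \<mu>
  proof -
    have "\<mu> \<in> extend \<kappa> ` endpoint ` \<sigma>'" by (rule subst[OF st(3), of "\<lambda>X. \<mu> \<in> X"]) (rule that)
    then obtain \<nu> where n: "\<nu> \<in> \<sigma>'" "\<mu> = extend \<kappa> (endpoint \<nu>)" by blast
    have "{endpoint \<kappa>, endpoint \<nu>} \<in> K" using sub_simplex[OF st(2)] k' n(1) by simp
    then show ?thesis using extend_fibre(2)[OF st(1)] n(2) by simp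
  qed
  have "\<tau>' = extend \<kappa> ` endpoint ` \<tau>'" using e t(1) by (force simp: image_image)
  moreover have "endpoint ` \<tau>' \<in> K" using simplicialD(3)[OF K st(2), of "endpoint ` \<tau>'"] t by auto
  ultimately show "\<tau>' \<in> universal_cover" using universal_coverI[OF st(1), of "endpoint ` \<tau>'"] k by auto
qed

lemma universal_cover_cover: "simplicial_cover endpoint universal_cover K"
proof
  show "simplicial universal_cover" "simplicial K" by (rule universal_cover_simplicial K)+
  show "endpoint ` \<sigma>' \<in> K" "inj_on endpoint \<sigma>'" if s: "\<sigma>' \<in> universal_cover" for \<sigma>'
  proof -
    obtain \<kappa> where "\<kappa> \<in> \<sigma>'" using simplicialD(2)[OF universal_cover_simplicial s] by blast
    then show "endpoint ` \<sigma>' \<in> K" "inj_on endpoint \<sigma>'" by (rule universal_cover_star[OF s])+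
  qed
  show "\<exists>\<sigma>'\<in>universal_cover. \<kappa> \<in> \<sigma>' \<and> endpoint ` \<sigma>' = \<tau>" if k: "{\<kappa>} \<in> universal_cover" and t: "\<tau> \<in> K" "endpoint \<kappa> \<in> \<tau>" for \<kappa> \<tau>
  proof -
    have k': "\<kappa> \<in> fibre (vertex (endpoint \<kappa>))" using universal_cover_star(1)[OF k] by simp
    have "endpoint (extend \<kappa> c) = c" if "c \<in> \<tau>" for c
      using extend_fibre(2)[OF k'] sub_simplex[OF t that] by simp
    then have "endpoint ` extend \<kappa> ` \<tau> = \<tau>" by (simp add: image_image)
    moreover have "\<kappa> \<in> extend \<kappa> ` \<tau>" using extend_self[OF k'] t(2) by (metis imageI)
    ultimately show ?thesis using universal_coverI[OF k' t] by blast
  qed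
  show "\<sigma>1 = \<sigma>2" if "\<sigma>1 \<in> universal_cover" "\<sigma>2 \<in> universal_cover" "\<kappa> \<in> \<sigma>1" "\<kappa> \<in> \<sigma>2" "endpoint ` \<sigma>1 = endpoint ` \<sigma>2" for \<sigma>1 \<sigma>2 \<kappa>
    by (rule trans[OF universal_cover_star(4)[OF that(1,3)]], unfold that(5), rule universal_cover_star(4)[OF that(2,4), symmetric])
qed

lemma base_vertex: "path_class (\<lambda>_. vertex b) \<in> fibre (vertex b)" "{path_class (\<lambda>_. vertex b)} \<in> universal_cover" "endpoint (path_class (\<lambda>_. vertex b)) = b"
proof -
  have "vertex b \<in> underlying_space K"
    using b vertex_in_simplex[of "{b}" b] by (auto simp: underlying_space_def)
  then have "path_at (\<lambda>_. vertex b) (vertex b) (vertex b)"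
    using homotopic_const_refl[OF K] by (auto simp: path_at_def pathstart_def pathfinish_def)
  then show 1: "path_class (\<lambda>_. vertex b) \<in> fibre (vertex b)" by (auto simp: fibre_def)
  then show 2: "endpoint (path_class (\<lambda>_. vertex b)) = b" by (rule endpoint_eq)
  show "{path_class (\<lambda>_. vertex b)} \<in> universal_cover"
    using universal_coverI[of "path_class (\<lambda>_. vertex b)" "{b}"] 1 2 b extend_self[of "path_class (\<lambda>_. vertex b)"] by simp
qed

subsection \<open>Lifting paths of a subcomplex\<close>

definition steps :: "'v set set \<Rightarrow> ((real \<Rightarrow> 'v \<Rightarrow> real) set \<times> (real \<Rightarrow> 'v \<Rightarrow> real) set) set" where
  "steps L = {(\<kappa>, extend \<kappa> d) | \<kappa> d. \<kappa> \<in> fibre (vertex (endpoint \<kappa>)) \<and> {endpoint \<kappa>, d} \<in> L}"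

lemma stepsI: "\<kappa> \<in> fibre (vertex c) \<Longrightarrow> {c, d} \<in> L \<Longrightarrow> (\<kappa>, transport \<kappa> (edge c d)) \<in> steps L"
  unfolding steps_def using endpoint_eq by (auto simp: extend_def)

lemma transport_segment_back:
  assumes "\<kappa> \<in> fibre x" "path_at (segment_path x y) x y"
  shows "transport (transport \<kappa> (segment_path x y)) (segment_path y x) = \<kappa>"
  using transport_reverse[OF assms] by simp

text \<open>
  Near a given parameter the path stays in the open star of a vertex \<open>v\<close>. There it can be replaced by the
  two edges through \<open>v\<close>, which are steps of the subcomplex. Bisection reduces to this local case.
\<close>

lemma path_lift:
  assumes L: "L \<subseteq> K" "simplicial L" and q: "homotopic K q q" "\<And>t. t \<in> {0..1} \<Longrightarrow> supp (q t) \<in> L"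
    and ab: "a \<le> b'" "0 \<le> a" "b' \<le> 1" "c \<in> supp (q a)" "d \<in> supp (q b')" "\<kappa> \<in> fibre (vertex c)"
  shows "(\<kappa>, transport (transport (transport \<kappa> (segment_path (vertex c) (q a))) (q \<circ> linepath a b')) (segment_path (q b') (vertex d))) \<in> (steps L)\<^sup>*"
proof -
  have qK: "q t \<in> closed_simplex (supp (q t))" "supp (q t) \<in> K" "finite (supp (q t))" if "t \<in> {0..1}" for t
  proof -
    have "q t \<in> underlying_space K" using tame_values[of K "{0..1}" q t] q(1) that by (simp add: homotopic_refl_iff)
    then show "supp (q t) \<in> K" by (simp add: space_iff[OF K])
    then show f: "finite (supp (q t))" by (rule simplicialD(1)[OF K])
    show "q t \<in> closed_simplex (supp (q t))"
      using \<open>q t \<in> underlying_space K\<close> by (simp add: closed_simplex_iff[OF f] space_iff[OF K])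
  qed
  have seg: "path_at (segment_path (vertex c) (q t)) (vertex c) (q t)" "path_at (segment_path (q t) (vertex c)) (q t) (vertex c)"
    if "t \<in> {0..1}" "c \<in> supp (q t)" for t c
    using path_at_segment[OF _ _ qK(2)] qK(1,3) vertex_in_simplex[of "supp (q t)" c] that by blast+
  have sub: "path_at (q \<circ> linepath s t) (q s) (q t)" if "s \<in> {0..1}" "t \<in> {0..1}" for s t
    using homotopic_subpaths(2)[OF q(1) that that(2)] by (simp add: path_at_def pathstart_compose pathfinish_compose)
  let ?T = "\<lambda>\<kappa> c s t d. transport (transport (transport \<kappa> (segment_path (vertex c) (q s))) (q \<circ> linepath s t)) (segment_path (q t) (vertex d))"
  have "0 \<le> a \<longrightarrow> b' \<le> 1 \<longrightarrow> (\<forall>c\<in>supp (q a). \<forall>d\<in>supp (q b'). \<forall>\<kappa>\<in>fibre (vertex c). (\<kappa>, ?T \<kappa> c a b' d) \<in> (steps L)\<^sup>*)"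
    using ab(1)
  proof (induction a b' rule: Bolzano)
    case (trans r s t)
    show ?case
    proof (intro impI ballI)
      fix c d \<kappa> assume r: "0 \<le> r" "t \<le> 1" and c: "c \<in> supp (q r)" and d: "d \<in> supp (q t)" and k: "\<kappa> \<in> fibre (vertex c)"
      have i: "r \<in> {0..1}" "s \<in> {0..1}" "t \<in> {0..1}" using trans r by auto
      obtain m where m: "m \<in> supp (q s)" using simplicialD(2)[OF L(2) q(2)[OF i(2)]] by blast
      let ?\<mu> = "transport \<kappa> (segment_path (vertex c) (q r))"
      have mu: "?\<mu> \<in> fibre (q r)" by (rule transport_fibre[OF k seg(1)[OF i(1) c]])
      have nu: "transport ?\<mu> (q \<circ> linepath r s) \<in> fibre (q s)" by (rule transport_fibre[OF mu sub[OF i(1,2)]])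
      have s01: "0 \<le> s" "s \<le> 1" using i(2) by auto
      have 1: "(\<kappa>, ?T \<kappa> c r s m) \<in> (steps L)\<^sup>*" using trans(1) r s01 c m k by blast
      have "?T \<kappa> c r s m \<in> fibre (vertex m)" by (rule transport_fibre[OF nu seg(2)[OF i(2) m]])
      then have 2: "(?T \<kappa> c r s m, ?T (?T \<kappa> c r s m) m s t d) \<in> (steps L)\<^sup>*" using trans(2) r s01 d m by blast
      have "transport (?T \<kappa> c r s m) (segment_path (vertex m) (q s)) = transport ?\<mu> (q \<circ> linepath r s)"
        by (rule transport_segment_back[OF nu seg(2)[OF i(2) m]])
      moreover have "transport (transport ?\<mu> (q \<circ> linepath r s)) (q \<circ> linepath s t) = transport ?\<mu> (q \<circ> linepath r t)"
      proof -
        have "transport (transport ?\<mu> (q \<circ> linepath r s)) (q \<circ> linepath s t) = transport ?\<mu> ((q \<circ> linepath r s) +++ (q \<circ> linepath s t))"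
          using transport_join[OF mu sub[OF i(1,2)] sub[OF i(2,3)]] by simp
        also have "\<dots> = transport ?\<mu> (q \<circ> linepath r t)"
          using mu homotopic_subpaths(1)[OF q(1) i] by (intro transport_homotopic) (simp_all add: pathstart_compose del: o_apply)
        finally show ?thesis .
      qed
      ultimately have "?T (?T \<kappa> c r s m) m s t d = ?T \<kappa> c r t d" by simp
      then show "(\<kappa>, ?T \<kappa> c r t d) \<in> (steps L)\<^sup>*" using 1 2 by simp
    qed
  next
    case (local x)
    show ?case
    proof (cases "x \<in> {0..1}")
      case False
      then show ?thesis by (intro exI[of _ 1]) auto
    next
      case True
      obtain v where v: "v \<in> supp (q x)" using simplicialD(2)[OF L(2) q(2)[OF True]] by blast
      have "continuous_on {0..1} (\<lambda>t. q t v)"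
        by (rule continuous_on_product_then_coordinatewise) (use q(1) in \<open>simp add: homotopic_refl_iff tame_def\<close>)
      then have "openin (top_of_set {0..1}) ({0..1} \<inter> (\<lambda>t. q t v) -` (- {0}))"
        by (rule continuous_openin_preimage_gen) auto
      then obtain \<delta> where d: "\<delta> > 0" "ball x \<delta> \<inter> {0..1} \<subseteq> {0..1} \<inter> (\<lambda>t. q t v) -` (- {0})"
        unfolding openin_contains_ball using True v by (metis (no_types, lifting) ComplI IntI in_supp singletonD vimageI)
      have near: "q t v \<noteq> 0" if "t \<in> {0..1}" "\<bar>t - x\<bar> < \<delta>" for t
        using d(2) that by (auto simp: dist_real_def abs_minus_commute subset_iff)
      show ?thesis
      proof (intro exI[of _ \<delta>] conjI allI impI ballI d(1))
        fix r s c d \<kappa> assume rs: "r \<le> x \<and> x \<le> s \<and> s - r < \<delta>" "0 \<le> r" "s \<le> 1"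
          and c: "c \<in> supp (q r)" and d: "d \<in> supp (q s)" and k: "\<kappa> \<in> fibre (vertex c)"
        have i: "r \<in> {0..1}" "s \<in> {0..1}" using rs True by auto
        have vt: "v \<in> supp (q t)" if "t \<in> {r..s}" for t
        proof -
          have "\<bar>t - x\<bar> < \<delta>" "t \<in> {0..1}" using that rs by auto
          then show ?thesis using near[of t] by simp
        qed
        have vr: "v \<in> supp (q r)" "v \<in> supp (q s)" using vt rs by auto
        let ?\<mu> = "transport \<kappa> (segment_path (vertex c) (q r))"
        let ?\<nu> = "transport ?\<mu> (q \<circ> linepath r s)"
        have mu: "?\<mu> \<in> fibre (q r)" by (rule transport_fibre[OF k seg(1)[OF i(1) c]])
        have nu: "?\<nu> \<in> fibre (q s)" by (rule transport_fibre[OF mu sub[OF i]])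
        have "transport ?\<nu> (segment_path (q s) (vertex v)) = transport ?\<mu> (segment_path (q r) (vertex v))"
        proof (rule transport_star[OF mu sub[OF i]])
          fix t :: real assume t: "t \<in> {0..1}"
          let ?u = "linepath r s t"
          have "?u \<in> {r..s}"
            using t rs linepath_in_path[of t r s] by (auto simp: closed_segment_eq_real_ivl)
          then have "v \<in> supp (q ?u)" "?u \<in> {0..1}" using vt i by auto
          then show "insert v (supp ((q \<circ> linepath r s) t)) \<in> K"
            using qK(2) by (simp add: insert_absorb del: in_supp)
        qed
        also have "\<dots> = transport \<kappa> (edge c v)"
        proof (rule transport_star[OF k seg(1)[OF i(1) c]])
          fix t :: real assume t: "t \<in> {0..1}"
          show "insert v (supp (segment_path (vertex c) (q r) t)) \<in> K"
            using supp_segment_path[of "vertex c" "q r" t] c vr(1) by (intro simplicialD(3)[OF K qK(2)[OF i(1)]]) auto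
        qed
        finally have eq1: "transport ?\<nu> (segment_path (q s) (vertex v)) = transport \<kappa> (edge c v)" .
        have eq2: "transport (transport ?\<nu> (segment_path (q s) (vertex v))) (edge v d) = transport ?\<nu> (segment_path (q s) (vertex d))"
        proof (rule transport_star[OF nu seg(2)[OF i(2) vr(2)]])
          fix t :: real assume t: "t \<in> {0..1}"
          show "insert d (supp (segment_path (q s) (vertex v) t)) \<in> K"
            using supp_segment_path[of "q s" "vertex v" t] d vr(2) by (intro simplicialD(3)[OF K qK(2)[OF i(2)]]) auto
        qed
        have "{c, v} \<in> L" "{v, d} \<in> L"
          using simplicialD(3)[OF L(2) q(2)[OF i(1)], of "{c, v}"] simplicialD(3)[OF L(2) q(2)[OF i(2)], of "{v, d}"] c d vr by auto
        then have "(\<kappa>, transport \<kappa> (edge c v)) \<in> steps L"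
          "(transport \<kappa> (edge c v), transport (transport \<kappa> (edge c v)) (edge v d)) \<in> steps L"
          using stepsI[OF k, of v L] stepsI[OF transport_fibre[OF k path_at_edge], of v d L] L(1) by auto
        then show "(\<kappa>, ?T \<kappa> c r s d) \<in> (steps L)\<^sup>*" using eq1 eq2 by auto
      qed
    qed
  qed
  then show ?thesis using ab by blast
qed

lemma loop_power_path_at:
  assumes "path_at l x x" shows "path_at (loop_power l n) x x"
proof (induction n)
  case 0
  have "x \<in> underlying_space K"
    using assms tame_values[of K "{0..1}" l 1] by (auto simp: path_at_def homotopic_refl_iff pathfinish_def)
  then show ?case
    using homotopic_const_refl[OF K] assms by (auto simp: path_at_def pathstart_def pathfinish_def)
next
  case (Suc n)
  then show ?case using path_at_join assms by simp
qed

lemma loop_power_values: "loop_power l n ` {0..1} \<subseteq> l ` {0..1}"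
proof (induction n)
  case (Suc n)
  have "loop_power l (Suc n) ` {0..1} \<subseteq> loop_power l n ` {0..1} \<union> l ` {0..1}"
    using path_image_join_subset[of "loop_power l n" l] by (simp add: path_image_def)
  then show ?case using Suc by blast
qed (auto simp: pathstart_def)

text \<open>
  Lifting the powers of \<open>l\<close> leads to classes that are pairwise different: if two of them were equal, the
  action of some power of \<open>l\<close> would have a fixed point and that power would be trivial.
\<close>

lemma infinite_reachable:
  assumes L: "L \<subseteq> K" "simplicial L" and l: "path_at l x x" "\<And>t. t \<in> {0..1} \<Longrightarrow> supp (l t) \<in> L"
    and inf: "\<And>n. n > 0 \<Longrightarrow> \<not> homotopic K (loop_power l n) (\<lambda>_. x)"
    and c: "c \<in> supp x" and k: "\<kappa> \<in> fibre (vertex c)"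
  shows "infinite {\<kappa>'. (\<kappa>, \<kappa>') \<in> (steps L)\<^sup>*}"
proof -
  let ?S = "segment_path (vertex c) x" and ?S' = "segment_path x (vertex c)"
  have x: "x = l 0" using l(1) by (auto simp: path_at_def pathstart_def)
  have "x \<in> underlying_space K"
    using l(1) tame_values[of K "{0..1}" l 1] by (auto simp: path_at_def homotopic_refl_iff pathfinish_def)
  then have sx: "supp x \<in> K" and f: "finite (supp x)" and "x \<in> closed_simplex (supp x)"
    using simplicialD(1)[OF K] closed_simplex_iff[of "supp x" x] by (auto simp: space_iff[OF K])
  then have seg: "path_at ?S (vertex c) x" "path_at ?S' x (vertex c)"
    using path_at_segment[OF _ _ sx] vertex_in_simplex[OF f c] by blast+
  let ?\<mu> = "transport \<kappa> ?S"
  have mu: "?\<mu> \<in> fibre x" by (rule transport_fibre[OF k seg(1)])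
  have lp: "path_at (loop_power l n) x x" for n by (rule loop_power_path_at[OF l(1)])
  define g where "g n = transport (transport ?\<mu> (loop_power l n)) ?S'" for n
  have reach: "(\<kappa>, g n) \<in> (steps L)\<^sup>*" for n
  proof -
    have e: "loop_power l n 0 = x" "loop_power l n 1 = x" using lp[of n] by (auto simp: path_at_def pathstart_def pathfinish_def)
    have "supp (loop_power l n t) \<in> L" if "t \<in> {0..1}" for t
    proof -
      have "loop_power l n t \<in> l ` {0..1}" by (rule subsetD[OF loop_power_values imageI[OF that]])
      then show ?thesis using l(2) by auto
    qed
    then show ?thesis
      using path_lift[OF L, of "loop_power l n" 0 1 c c \<kappa>] lp[of n] e c k by (simp add: path_at_def g_def compose_linepath(1))
  qed
  let ?P = "\<lambda>\<mu>. transport \<mu> l"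
  have pow: "transport ?\<mu> (loop_power l n) = (?P ^^ n) ?\<mu> \<and> (?P ^^ n) ?\<mu> \<in> fibre x" for n
  proof (induction n)
    case 0
    then show ?case using transport_const[OF mu] mu l(1) by (simp add: path_at_def)
  next
    case (Suc n)
    then show ?case
      using transport_join[OF mu lp l(1), of n] transport_fibre[OF _ l(1), of "(?P ^^ n) ?\<mu>"] by simp
  qed
  have P_inj: "\<mu>1 = \<mu>2" if "\<mu>1 \<in> fibre x" "\<mu>2 \<in> fibre x" "(?P ^^ n) \<mu>1 = (?P ^^ n) \<mu>2" for n \<mu>1 \<mu>2
    using that
  proof (induction n arbitrary: \<mu>1 \<mu>2)
    case 0
    then show ?case by (simp only: funpow_0)
  next
    case (Suc n)
    have eq: "?P \<mu>1 = ?P \<mu>2"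
      by (rule Suc.IH) (use Suc.prems transport_fibre[OF _ l(1)] in \<open>simp_all add: funpow_Suc_right del: funpow.simps\<close>)
    have "\<mu>1 = transport (?P \<mu>1) (reversepath l)" by (rule transport_reverse[OF Suc.prems(1) l(1), symmetric])
    also have "\<dots> = transport (?P \<mu>2) (reversepath l)" by (simp only: eq)
    also have "\<dots> = \<mu>2" by (rule transport_reverse[OF Suc.prems(2) l(1)])
    finally show ?case .
  qed
  have neq: "g n \<noteq> g (n + k)" if "k > 0" for n k
  proof
    assume eq: "g n = g (n + k)"
    have t: "transport (g m) ?S = (?P ^^ m) ?\<mu>" for m
      unfolding g_def using transport_segment_back[OF _ seg(2), of "transport ?\<mu> (loop_power l m)"] pow[of m] by simp
    have "(?P ^^ n) ?\<mu> = transport (g n) ?S" by (rule t[symmetric])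
    also have "\<dots> = transport (g (n + k)) ?S" by (simp only: eq)
    also have "\<dots> = (?P ^^ (n + k)) ?\<mu>" by (rule t)
    finally have "(?P ^^ n) ?\<mu> = (?P ^^ (n + k)) ?\<mu>" .
    then have "(?P ^^ n) ?\<mu> = (?P ^^ n) ((?P ^^ k) ?\<mu>)" by (simp add: funpow_add)
    then have "?\<mu> = (?P ^^ k) ?\<mu>" using pow[of k] by (intro P_inj[OF mu, of "(?P ^^ k) ?\<mu>" n]) simp_all
    then have "transport ?\<mu> (loop_power l k) = ?\<mu>" using pow[of k] by simp
    then have "homotopic K (loop_power l k) (\<lambda>_. x)" by (rule transport_loop_trivial[OF mu lp])
    then show False using inf that by blast
  qed
  have "inj g"
  proof (rule injI)
    fix m n assume "g m = g n"
    show "m = n"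
    proof (rule ccontr)
      assume "m \<noteq> n"
      then consider "m < n" | "n < m" by linarith
      then show False
      proof cases
        case 1
        then obtain k where "k > 0" "m + k = n" using less_imp_add_positive by blast
        then show False using neq[of k m] \<open>g m = g n\<close> by simp
      next
        case 2
        then obtain k where "k > 0" "n + k = m" using less_imp_add_positive by blast
        then show False using neq[of k n] \<open>g m = g n\<close> by simp
      qed
    qed
  qed
  then have "infinite (range g)" by (rule range_inj_infinite)
  moreover have "range g \<subseteq> {\<kappa>'. (\<kappa>, \<kappa>') \<in> (steps L)\<^sup>*}" using reach by auto
  ultimately show ?thesis using finite_subset by blast
qed

end

section \<open>Cells of regular complexes of dimension two\<close>

definition disc_set :: "nat \<Rightarrow> (nat \<Rightarrow> real) set" where
  "disc_set n = {x. (\<forall>i\<ge>n. x i = 0) \<and> (\<Sum>i<n. (x i)\<^sup>2) \<le> 1}"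

definition radius :: "nat \<Rightarrow> (nat \<Rightarrow> real) \<Rightarrow> real" where
  "radius n x = sqrt (\<Sum>i<n. (x i)\<^sup>2)"

lemma radius_nonneg [simp]: "0 \<le> radius n x"
  by (simp add: radius_def sum_nonneg)

lemma disc_eq: "disc n = top_of_set (disc_set n)"
  by (simp add: disc_def Euclidean_space_def powertop_eq subtopology_subtopology disc_set_def Collect_conj_eq)

lemma disc_set_iff: "x \<in> disc_set n \<longleftrightarrow> (\<forall>i\<ge>n. x i = 0) \<and> radius n x \<le> 1"
  by (simp add: disc_set_def radius_def sum_nonneg)

lemma disc_interior_iff: "x \<in> disc_interior n \<longleftrightarrow> (\<forall>i\<ge>n. x i = 0) \<and> radius n x < 1"
  by (simp add: disc_interior_def topspace_Euclidean_space radius_def sum_nonneg)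

lemma disc_boundary_iff: "x \<in> disc_boundary n \<longleftrightarrow> (\<forall>i\<ge>n. x i = 0) \<and> radius n x = 1"
  by (simp add: disc_boundary_def topspace_Euclidean_space radius_def sum_nonneg)

lemma disc_set_split: "disc_set n = disc_interior n \<union> disc_boundary n"
  by (auto simp: disc_set_iff disc_interior_iff disc_boundary_iff)

lemma radius_scale: "0 \<le> c \<Longrightarrow> radius n (\<lambda>i. c * x i) = c * radius n x"
  by (simp add: radius_def power_mult_distrib real_sqrt_mult flip: sum_distrib_left)

lemma radius_0_iff: "(\<forall>i\<ge>n. x i = 0) \<Longrightarrow> radius n x = 0 \<longleftrightarrow> x = (\<lambda>_. 0)"
proof
  assume x: "\<forall>i\<ge>n. x i = 0" and "radius n x = 0"
  then have "\<forall>i\<in>{..<n}. (x i)\<^sup>2 = 0"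
    unfolding radius_def by (subst sum_nonneg_eq_0_iff[symmetric]) auto
  with x show "x = (\<lambda>_. 0)" by (metis lessThan_iff linorder_not_less power_zero_numeral zero_eq_power2)
qed (simp add: radius_def)

lemma continuous_radius: "continuous_on S (radius n)"
  unfolding radius_def by (intro continuous_intros continuous_on_subset[OF continuous_on_product_coordinates]) auto

lemma compact_disc_set: "compact (disc_set n)"
proof -
  have "compactin (product_topology (\<lambda>_. euclideanreal) UNIV) (\<Pi>\<^sub>E i\<in>(UNIV::nat set). {-1..1::real})"
    by (simp add: compactin_PiE)
  then have "compact (\<Pi>\<^sub>E i\<in>(UNIV::nat set). {-1..1::real})" by (simp add: euclidean_product_topology)
  moreover have "closed (disc_set n)"
    unfolding disc_set_def
    by (intro closed_Collect_conj closed_Collect_all closed_Collect_imp closed_Collect_eq closed_Collect_le open_Collect_const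
        continuous_intros continuous_on_subset[OF continuous_on_product_coordinates]) auto
  ultimately have "compact ((\<Pi>\<^sub>E i\<in>(UNIV::nat set). {-1..1::real}) \<inter> disc_set n)" by (rule compact_Int_closed)
  moreover have "disc_set n \<subseteq> (\<Pi>\<^sub>E i\<in>(UNIV::nat set). {-1..1::real})"
  proof
    fix x assume x: "x \<in> disc_set n"
    have "\<bar>x i\<bar> \<le> 1" for i
    proof (cases "i < n")
      case True
      then have "(x i)\<^sup>2 \<le> (\<Sum>i<n. (x i)\<^sup>2)" by (intro member_le_sum) auto
      also have "\<dots> \<le> 1" using x by (simp add: disc_set_def)
      finally show ?thesis by (simp add: abs_square_le_1)
    qed (use x in \<open>auto simp: disc_set_def\<close>)
    then show "x \<in> (\<Pi>\<^sub>E i\<in>(UNIV::nat set). {-1..1::real})" by (auto simp: abs_le_iff PiE_iff minus_le_iff)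
  qed
  ultimately show ?thesis by (simp add: Int_absorb1)
qed

context regular_CW_complex
begin

definition char_map :: "nat \<Rightarrow> 'a set \<Rightarrow> (nat \<Rightarrow> real) \<Rightarrow> 'a" where
  "char_map n e = (SOME \<Phi>. embedding_map (disc n) X \<Phi> \<and> \<Phi> ` disc_interior n = e \<and>
     (\<exists>F. finite F \<and> F \<subseteq> (\<Union>m<n. cells m) \<and> \<Phi> ` disc_boundary n \<subseteq> \<Union>F))"

lemma char_map:
  assumes "e \<in> cells n"
  shows "embedding_map (disc n) X (char_map n e)" "char_map n e ` disc_interior n = e"
    "\<exists>F. finite F \<and> F \<subseteq> (\<Union>m<n. cells m) \<and> char_map n e ` disc_boundary n \<subseteq> \<Union>F"
  using someI_ex[OF characteristic_map[OF assms]] unfolding char_map_def by blast+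

lemma char_map_continuous: "e \<in> cells n \<Longrightarrow> continuous_map (disc n) X (char_map n e)"
  using char_map(1) by (meson continuous_map_in_subtopology embedding_map_def homeomorphic_imp_continuous_map)

lemma char_map_inj: "e \<in> cells n \<Longrightarrow> inj_on (char_map n e) (disc_set n)"
  using char_map(1) by (fastforce simp: embedding_map_def disc_eq dest: homeomorphic_imp_injective_map)

lemma char_map_closed:
  assumes "e \<in> cells n" shows "compactin X (char_map n e ` disc_set n)" "closedin X (char_map n e ` disc_set n)"
proof -
  show "compactin X (char_map n e ` disc_set n)"
    by (rule image_compactin[OF _ char_map_continuous[OF assms]]) (simp add: disc_eq compactin_subtopology compact_disc_set)
  then show "closedin X (char_map n e ` disc_set n)" by (rule compactin_imp_closedin[OF Hausdorff])
qed

text \<open>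
  A point of the boundary sphere is the limit of the interior points on its radius.
\<close>

lemma char_map_image:
  assumes e: "e \<in> cells n" shows "char_map n e ` disc_set n = X closure_of e"
proof
  show "X closure_of e \<subseteq> char_map n e ` disc_set n"
    using char_map(2)[OF e] by (intro closure_of_minimal char_map_closed[OF e]) (auto simp: disc_set_split)
  show "char_map n e ` disc_set n \<subseteq> X closure_of e"
  proof (rule image_subsetI)
    fix x assume x: "x \<in> disc_set n"
    let ?g = "\<lambda>t i. t * x i"
    have g: "radius n (?g t) = t * radius n x" if "0 \<le> t" for t using that by (rule radius_scale)
    have le: "t * radius n x \<le> t" if "0 \<le> t" for t using x that mult_left_le[of "radius n x" t] by (simp add: disc_set_iff)
    have "continuous_on {0..1::real} ?g"
      by (intro continuous_on_coordinatewise_then_product continuous_intros)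
    moreover have "?g ` {0..1} \<subseteq> disc_set n" using g le x by (force simp: disc_set_iff)
    ultimately have cont: "continuous_map (top_of_set {0..1}) X (char_map n e \<circ> ?g)"
      by (intro continuous_map_compose[OF _ char_map_continuous[OF e]]) (auto simp: disc_eq)
    have "?g ` {0..<1} \<subseteq> disc_interior n"
    proof (rule image_subsetI)
      fix t :: real assume "t \<in> {0..<1}"
      then show "?g t \<in> disc_interior n" using g[of t] le[of t] x by (simp add: disc_interior_iff disc_set_iff)
    qed
    then have sub: "(char_map n e \<circ> ?g) ` {0..<1} \<subseteq> e" using char_map(2)[OF e] by auto
    have "(top_of_set {0..1::real}) closure_of {0..<1} = {0..1}"
    proof -
      have "{0..1} \<inter> {0..<1} = {0..<1::real}" by auto
      then show ?thesis by (simp add: closure_of_subtopology)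
    qed
    then have "(char_map n e \<circ> ?g) 1 \<in> (char_map n e \<circ> ?g) ` ((top_of_set {0..1::real}) closure_of {0..<1})"
      by (intro imageI) simp
    also have "\<dots> \<subseteq> X closure_of ((char_map n e \<circ> ?g) ` {0..<1})"
      by (rule continuous_map_image_closure_subset[OF cont])
    also have "\<dots> \<subseteq> X closure_of e" by (rule closure_of_mono[OF sub])
    finally show "char_map n e x \<in> X closure_of e" by simp
  qed
qed

lemma cell_nonempty: "e \<in> cells n \<Longrightarrow> e \<noteq> {}"
proof -
  assume e: "e \<in> cells n"
  have "(\<lambda>_. 0) \<in> disc_interior n" by (simp add: disc_interior_iff radius_def)
  then have "char_map n e (\<lambda>_. 0) \<in> e" using char_map(2)[OF e] by blast
  then show "e \<noteq> {}" by blast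
qed

lemma cell_subset: "e \<in> cells n \<Longrightarrow> e \<subseteq> topspace X"
  using cells_cover by blast

lemma cell_in_closure: "e \<in> cells n \<Longrightarrow> e \<subseteq> X closure_of e"
  by (simp add: cell_subset closure_of_subset)

lemma cell_unique: "e \<in> cells m \<Longrightarrow> f \<in> cells n \<Longrightarrow> p \<in> e \<Longrightarrow> p \<in> f \<Longrightarrow> m = n \<and> e = f"
  using cells_disjoint by blast

lemma closure_split: "e \<in> cells n \<Longrightarrow> X closure_of e = e \<union> char_map n e ` disc_boundary n"
proof -
  assume e: "e \<in> cells n"
  show "X closure_of e = e \<union> char_map n e ` disc_boundary n"
    unfolding char_map_image[OF e, symmetric] disc_set_split image_Un char_map(2)[OF e] ..
qed

lemma closure_cases: "e \<in> cells n \<Longrightarrow> p \<in> X closure_of e \<Longrightarrow> p \<in> e \<or> p \<in> char_map n e ` disc_boundary n"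
  by (simp only: closure_split Un_iff)

lemma boundary_in_closure: "e \<in> cells n \<Longrightarrow> char_map n e ` disc_boundary n \<subseteq> X closure_of e"
  by (simp only: closure_split Un_upper2)

lemma closure_cells:
  assumes "e \<in> cells n" "p \<in> X closure_of e" "p \<notin> e"
  shows "\<exists>m<n. \<exists>c\<in>cells m. p \<in> c"
proof -
  obtain F where F: "F \<subseteq> (\<Union>m<n. cells m)" "char_map n e ` disc_boundary n \<subseteq> \<Union>F"
    using char_map(3)[OF assms(1)] by blast
  have "p \<in> char_map n e ` disc_boundary n" using closure_cases[OF assms(1,2)] assms(3) by simp
  then obtain c where "c \<in> F" "p \<in> c" using F(2) by blast
  then show ?thesis using F(1) by blast
qed

lemma boundary_cells:
  assumes "e \<in> cells n" "u \<in> disc_boundary n"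
  shows "\<exists>m<n. \<exists>c\<in>cells m. char_map n e u \<in> c"
proof -
  obtain F where F: "F \<subseteq> (\<Union>m<n. cells m)" "char_map n e ` disc_boundary n \<subseteq> \<Union>F"
    using char_map(3)[OF assms(1)] by blast
  obtain c where "c \<in> F" "char_map n e u \<in> c" using F(2) assms(2) by blast
  then show ?thesis using F(1) by blast
qed

lemma closure_mono': "c \<subseteq> X closure_of e \<Longrightarrow> X closure_of c \<subseteq> X closure_of e"
  by (simp add: closure_of_minimal)

lemma face_dim:
  assumes "c \<in> cells m" "e \<in> cells n" "c \<subseteq> X closure_of e"
  shows "c = e \<or> m < n"
proof -
  obtain p where p: "p \<in> c" using cell_nonempty[OF assms(1)] by blast
  show ?thesis
  proof (cases "p \<in> e")
    case True
    then show ?thesis using cell_unique[OF assms(1,2) p] by blast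
  next
    case False
    then obtain k d where "k < n" "d \<in> cells k" "p \<in> d" using closure_cells[OF assms(2)] assms(3) p by blast
    then show ?thesis using cell_unique[OF assms(1) _ p] by blast
  qed
qed

lemma finite_faces:
  assumes "e \<in> cells n" shows "finite {c. (\<exists>m. c \<in> cells m) \<and> c \<subseteq> X closure_of e}"
proof -
  obtain F where F: "finite F" "F \<subseteq> (\<Union>m<n. cells m)" "char_map n e ` disc_boundary n \<subseteq> \<Union>F"
    using char_map(3)[OF assms] by blast
  have "c \<in> insert e F" if c: "c \<in> cells m" "c \<subseteq> X closure_of e" for c m
  proof -
    obtain p where p: "p \<in> c" using cell_nonempty[OF c(1)] by blast
    then consider "p \<in> e" | d where "d \<in> F" "p \<in> d" using closure_cases[OF assms, of p] p c(2) F(3) by blast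
    then show ?thesis
    proof cases
      case 1
      then show ?thesis using cell_unique[OF c(1) assms p] by blast
    next
      case (2 d)
      then obtain k where "d \<in> cells k" using F(2) by blast
      then show ?thesis using cell_unique[OF c(1) _ p 2(2)] 2(1) by blast
    qed
  qed
  then have "{c. (\<exists>m. c \<in> cells m) \<and> c \<subseteq> X closure_of e} \<subseteq> insert e F" by blast
  then show ?thesis using F(1) finite_subset by blast
qed

lemma zero_cell: "e \<in> cells 0 \<Longrightarrow> \<exists>p. e = {p}"
proof -
  assume e: "e \<in> cells 0"
  have "disc_interior 0 = {\<lambda>_. 0}" by (auto simp: disc_interior_iff radius_def)
  then show ?thesis using char_map(2)[OF e] by (metis image_empty image_insert)
qed

definition circle :: "real \<Rightarrow> nat \<Rightarrow> real" where
  "circle \<theta> = (\<lambda>i. if i = 0 then cos \<theta> else if i = 1 then sin \<theta> else 0)"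

lemma radius_2: "radius 2 x = sqrt ((x 0)\<^sup>2 + (x 1)\<^sup>2)"
  by (simp add: radius_def numeral_2_eq_2)

lemma circle_boundary: "circle \<theta> \<in> disc_boundary 2"
  by (auto simp: circle_def disc_boundary_iff radius_2)

lemma circle_onto:
  assumes "u \<in> disc_boundary 2" obtains \<theta> where "u = circle \<theta>"
proof -
  have "(u 0)\<^sup>2 + (u 1)\<^sup>2 = 1" using assms by (simp add: disc_boundary_iff radius_2)
  then obtain \<theta> where "u 0 = cos \<theta>" "u 1 = sin \<theta>" using sincos_total_2pi by metis
  moreover have "u i = 0" if "i \<noteq> 0" "i \<noteq> 1" for i using assms that by (simp add: disc_boundary_iff)
  ultimately have "u = circle \<theta>" by (auto simp: circle_def fun_eq_iff)
  then show ?thesis using that by blast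
qed

lemma circle_inj:
  assumes "circle \<alpha> = circle \<beta>" "\<bar>\<alpha> - \<beta>\<bar> < 2" shows "\<alpha> = \<beta>"
proof -
  have cs: "cos \<alpha> = cos \<beta>" "sin \<alpha> = sin \<beta>"
    using fun_cong[OF assms(1), of 0] fun_cong[OF assms(1), of 1] by (simp_all add: circle_def)
  have "cos (\<alpha> - \<beta>) = 1" unfolding cos_diff cs using sin_cos_squared_add[of \<beta>] by (simp add: power2_eq_square)
  then have c: "cos \<bar>\<alpha> - \<beta>\<bar> = cos 0" by simp
  have "\<bar>\<alpha> - \<beta>\<bar> \<le> pi" using assms(2) pi_gt3 by linarith
  then have "\<bar>\<alpha> - \<beta>\<bar> = 0" by (rule cos_inj_pi[OF abs_ge_zero _ order_refl pi_ge_zero c])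
  then show ?thesis by simp
qed

text \<open>
  The boundary circle of a 2-cell cannot stop in the middle of an edge: where it runs inside the edge
  it is an injective path in an open interval, hence an open map. So it covers a set that is open and
  closed in the edge.
\<close>

lemma edge_in_boundary:
  assumes e: "e \<in> cells 2" and f: "f \<in> cells 1" and meet: "f \<inter> char_map 2 e ` disc_boundary 2 \<noteq> {}"
  shows "f \<subseteq> char_map 2 e ` disc_boundary 2"
proof -
  note [simp del] = One_nat_def
  let ?S = "char_map 2 e ` disc_boundary 2"
  obtain F where F: "finite F" "F \<subseteq> (\<Union>m<2. cells m)" "?S \<subseteq> \<Union>F" using char_map(3)[OF e] by blast
  \<comment> \<open>\<open>Q\<close> is a closed set that contains the part of the circle outside the edge and is disjoint from it.\<close>
  define Q where "Q = (\<Union>c\<in>F - {f}. X closure_of c)"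
  have cQ: "closedin X Q" unfolding Q_def using F(1) by (intro closedin_Union) auto
  have SQ: "?S \<subseteq> f \<union> Q"
  proof
    fix p assume "p \<in> ?S"
    then obtain c where c: "c \<in> F" "p \<in> c" using F(3) by blast
    then obtain k where "c \<in> cells k" using F(2) by blast
    then show "p \<in> f \<union> Q" using c cell_in_closure[of c k] by (cases "c = f") (auto simp: Q_def)
  qed
  have Qf: "p \<notin> f" if "p \<in> Q" for p
  proof
    assume pf: "p \<in> f"
    obtain c where c: "c \<in> F" "c \<noteq> f" "p \<in> X closure_of c" using \<open>p \<in> Q\<close> by (auto simp: Q_def)
    obtain k where k: "c \<in> cells k" "k < 2" using c(1) F(2) by blast
    show False
    proof (cases "p \<in> c")
      case True
      then show False using cell_unique[OF k(1) f _ pf] c(2) by blast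
    next
      case False
      then obtain j d where "j < k" "d \<in> cells j" "p \<in> d" using closure_cells[OF k(1) c(3)] by blast
      then show False using cell_unique[OF _ f _ pf, of d j] k(2) by auto
    qed
  qed
  define i1 :: "real \<Rightarrow> nat \<Rightarrow> real" where "i1 s = (\<lambda>i. if i = 0 then s else 0)" for s
  have i1_0: "i1 s 0 = s" for s by (simp add: i1_def)
  have i1_eq: "x = i1 (x 0)" if "\<forall>i\<ge>1. x i = 0" for x
    using that by (auto simp: i1_def fun_eq_iff)
  have radius1: "radius 1 x = \<bar>x 0\<bar>" for x by (simp add: radius_def lessThan_Suc One_nat_def)
  have i_int: "i1 s \<in> disc_interior 1 \<longleftrightarrow> \<bar>s\<bar> < 1" for s by (auto simp: disc_interior_iff radius1 i1_def)
  have ci: "continuous_on T i1" for T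
    unfolding i1_def
  proof (rule continuous_on_coordinatewise_then_product)
    show "continuous_on T (\<lambda>x. if i = 0 then x else 0)" for i :: nat by (cases "i = 0") auto
  qed
  let ?\<psi> = "\<lambda>s. char_map 1 f (i1 s)"
  have \<psi>: "?\<psi> ` {-1<..<1} = f"
  proof -
    have "i1 ` {-1<..<1} = disc_interior 1"
    proof
      show "disc_interior 1 \<subseteq> i1 ` {-1<..<1}"
      proof
        fix x assume x: "x \<in> disc_interior 1"
        then have "x = i1 (x 0)" by (intro i1_eq) (simp add: disc_interior_iff)
        moreover have "x 0 \<in> {-1<..<1}" using x by (auto simp: disc_interior_iff radius1 abs_less_iff)
        ultimately show "x \<in> i1 ` {-1<..<1}" by blast
      qed
      show "i1 ` {-1<..<1} \<subseteq> disc_interior 1"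
        by (rule image_subsetI) (simp add: i_int abs_less_iff)
    qed
    then have "char_map 1 f ` i1 ` {-1<..<1} = f" using char_map(2)[OF f] by simp
    then show ?thesis unfolding image_image .
  qed
  have c\<psi>: "continuous_map (top_of_set {-1<..<1}) X ?\<psi>"
  proof -
    have "continuous_map (top_of_set {-1<..<1}) X (char_map 1 f \<circ> i1)"
      using ci i_int by (intro continuous_map_compose[OF _ char_map_continuous[OF f]]) (auto simp: disc_eq disc_set_split abs_less_iff)
    then show ?thesis by (simp add: o_def)
  qed
  have cS: "closedin X ?S"
  proof -
    have "closed (disc_boundary 2)"
    proof -
      have "disc_boundary 2 = {x. \<forall>i\<ge>2. x i = 0} \<inter> {x. radius 2 x = 1}" by (auto simp: disc_boundary_iff)
      moreover have "closed {x::nat \<Rightarrow> real. \<forall>i\<ge>2. x i = 0}"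
        by (intro closed_Collect_all closed_Collect_imp closed_Collect_eq open_Collect_const continuous_intros) auto
      moreover have "closed {x. radius 2 x = 1}" by (intro closed_Collect_eq continuous_radius continuous_intros)
      ultimately show ?thesis by auto
    qed
    then have "compact (disc_set 2 \<inter> disc_boundary 2)" by (intro compact_Int_closed compact_disc_set)
    then have "compactin (disc 2) (disc_boundary 2)"
      by (simp add: disc_eq compactin_subtopology disc_set_split Int_absorb1)
    then have "compactin X ?S" by (rule image_compactin[OF _ char_map_continuous[OF e]])
    then show ?thesis by (rule compactin_imp_closedin[OF Hausdorff])
  qed
  define A where "A = {s \<in> {-1<..<1}. ?\<psi> s \<in> ?S}"
  have "closedin (top_of_set {-1<..<1}) A"
    using closedin_continuous_map_preimage[OF c\<psi> cS] by (simp add: A_def)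
  moreover have "open A"
  proof (subst open_subopen, intro ballI)
    fix s0 assume s0: "s0 \<in> A"
    then obtain u where "u \<in> disc_boundary 2" "?\<psi> s0 = char_map 2 e u" by (auto simp: A_def)
    then obtain \<theta>0 where \<theta>0: "?\<psi> s0 = char_map 2 e (circle \<theta>0)" by (metis circle_onto)
    let ?g = "\<lambda>\<theta>. char_map 2 e (circle \<theta>)"
    have cg: "continuous_map euclideanreal X ?g"
    proof -
      have cs: "continuous_on UNIV (\<lambda>x::real. cos x)" "continuous_on UNIV (\<lambda>x::real. sin x)"
        by (intro continuous_intros)+
      have "continuous_on UNIV circle"
        unfolding circle_def
      proof (rule continuous_on_coordinatewise_then_product)
        show "continuous_on UNIV (\<lambda>x::real. if i = 0 then cos x else if i = 1 then sin x else 0)" for i :: nat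
          by (cases "i = 0"; cases "i = 1") (simp_all add: cs)
      qed
      then have "continuous_map euclideanreal X (char_map 2 e \<circ> circle)"
        using circle_boundary
        by (intro continuous_map_compose[OF _ char_map_continuous[OF e]]) (auto simp: disc_eq disc_set_split continuous_map_in_subtopology)
      then show ?thesis by (simp add: o_def)
    qed
    \<comment> \<open>An interval of length two is short enough for the parametrization of the circle to be injective.\<close>
    define T where "T = {\<theta>. ?g \<theta> \<notin> Q} \<inter> {\<theta>0 - 1<..<\<theta>0 + 1}"
    have "closedin euclideanreal {\<theta> \<in> topspace euclideanreal. ?g \<theta> \<in> Q}"
      by (rule closedin_continuous_map_preimage[OF cg cQ])
    then have "closed {\<theta>. ?g \<theta> \<in> Q}" by simp
    moreover have "{\<theta>. ?g \<theta> \<notin> Q} = - {\<theta>. ?g \<theta> \<in> Q}" by auto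
    ultimately have openT: "open T" unfolding T_def by (intro open_Int) auto
    have gf: "?g \<theta> \<in> f" if "\<theta> \<in> T" for \<theta> using SQ circle_boundary[of \<theta>] that by (auto simp: T_def)
    obtain h where h: "homeomorphic_maps (disc 1) (subtopology X (char_map 1 f ` disc_set 1)) (char_map 1 f) h"
      using char_map(1)[OF f] unfolding embedding_map_def homeomorphic_map_maps by (auto simp: disc_eq)
    define j where "j \<theta> = h (?g \<theta>) 0" for \<theta>
    have fD: "f \<subseteq> char_map 1 f ` disc_set 1" using char_map(2)[OF f] by (auto simp: disc_set_split)
    have "continuous_map (top_of_set T) (subtopology X (char_map 1 f ` disc_set 1)) ?g"
      using continuous_map_from_subtopology[OF cg, of T] gf fD by (auto simp: continuous_map_in_subtopology)
    then have "continuous_map (top_of_set T) (disc 1) (h \<circ> ?g)"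
      using h by (intro continuous_map_compose) (auto simp: homeomorphic_maps_def)
    then have "continuous_on T (\<lambda>\<theta>. h (?g \<theta>))" by (simp add: disc_eq o_def)
    then have cj: "continuous_on T j" unfolding j_def by (rule continuous_on_product_then_coordinatewise)
    have hD: "h p \<in> disc_set 1" "char_map 1 f (h p) = p" if "p \<in> f" for p
    proof -
      have p: "p \<in> topspace (subtopology X (char_map 1 f ` disc_set 1))" using that fD cell_subset[OF f] by auto
      then show "h p \<in> disc_set 1" "char_map 1 f (h p) = p"
        using h by (auto simp: homeomorphic_maps_def disc_eq continuous_map_def Pi_iff)
    qed
    have hi: "h p = i1 (h p 0)" if "p \<in> f" for p
      using hD(1)[OF that] by (intro i1_eq) (simp add: disc_set_iff)
    have hj: "?\<psi> (j \<theta>) = ?g \<theta>" "j \<theta> \<in> {-1<..<1}" if t: "\<theta> \<in> T" for \<theta>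
    proof -
      show 1: "?\<psi> (j \<theta>) = ?g \<theta>" using hi[OF gf[OF t]] hD(2)[OF gf[OF t]] by (simp add: j_def)
      have "?g \<theta> \<in> char_map 1 f ` disc_interior 1" using gf[OF t] unfolding char_map(2)[OF f] .
      then obtain x where x: "x \<in> disc_interior 1" "char_map 1 f x = ?g \<theta>" by force
      have "x = h (?g \<theta>)"
        using inj_onD[OF char_map_inj[OF f], of x "h (?g \<theta>)"] x hD[OF gf[OF t]] by (auto simp: disc_set_split)
      then have "i1 (j \<theta>) \<in> disc_interior 1" using x(1) hi[OF gf[OF t]] by (simp add: j_def)
      then show "j \<theta> \<in> {-1<..<1}" using i_int by (auto simp: abs_less_iff)
    qed
    have "inj_on j T"
    proof (rule inj_onI)
      fix \<alpha> \<beta> assume ab: "\<alpha> \<in> T" "\<beta> \<in> T" "j \<alpha> = j \<beta>"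
      then have "?g \<alpha> = ?g \<beta>" using hj(1) by metis
      then have "circle \<alpha> = circle \<beta>"
        using inj_onD[OF char_map_inj[OF e], of "circle \<alpha>" "circle \<beta>"] circle_boundary by (auto simp: disc_set_split)
      then show "\<alpha> = \<beta>" by (rule circle_inj) (use ab in \<open>auto simp: T_def\<close>)
    qed
    then have "open (j ` T)" by (rule invariance_of_domain[OF cj openT])
    moreover have "s0 \<in> j ` T"
    proof -
      have "s0 \<in> {-1<..<1}" using s0 by (simp add: A_def)
      then have "char_map 1 f (i1 s0) \<in> (\<lambda>s. char_map 1 f (i1 s)) ` {-1<..<1}" by (rule imageI)
      then have "?g \<theta>0 \<in> f" unfolding \<psi> \<theta>0 .
      then have t: "\<theta>0 \<in> T" using Qf by (auto simp: T_def)
      have "i1 s0 \<in> disc_set 1" "i1 (j \<theta>0) \<in> disc_set 1"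
        using s0 hj(2)[OF t] i_int by (auto simp: A_def disc_set_split abs_less_iff)
      then have "i1 s0 = i1 (j \<theta>0)"
        using hj(1)[OF t] \<theta>0 by (intro inj_onD[OF char_map_inj[OF f]]) simp_all
      from fun_cong[OF this, of 0] have "s0 = j \<theta>0" by (simp add: i1_0)
      then show ?thesis using t by blast
    qed
    moreover have "j ` T \<subseteq> A" using hj circle_boundary by (auto simp: A_def)
    ultimately show "\<exists>T. open T \<and> s0 \<in> T \<and> T \<subseteq> A" by blast
  qed
  moreover have "A \<subseteq> {-1<..<1}" by (auto simp: A_def)
  moreover have "A \<noteq> {}"
  proof -
    obtain p where p: "p \<in> f" "p \<in> ?S" using meet by blast
    then have "p \<in> (\<lambda>s. char_map 1 f (i1 s)) ` {-1<..<1}" using \<psi> by simp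
    then obtain s where "s \<in> {-1<..<1}" "p = char_map 1 f (i1 s)" by blast
    then show ?thesis using p(2) by (auto simp: A_def)
  qed
  ultimately have "A = {-1<..<1}"
    using connected_clopen[of "{-1<..<1::real}"] open_subset[of A "{-1<..<1}"] connected_Ioo by blast
  then have "(\<lambda>s. char_map 1 f (i1 s)) ` {-1<..<1} \<subseteq> ?S" unfolding A_def by blast
  then show ?thesis unfolding \<psi> .
qed

text \<open>
  In dimension two only an edge could be contained partially, and \<open>edge_in_boundary\<close> excludes this.
  Hence a closed cell is the union of the cells that are its faces.
\<close>

lemma closed_cell_subcomplex:
  assumes e: "e \<in> cells n" "n \<le> 2" and c: "c \<in> cells m" and p: "p \<in> c" "p \<in> X closure_of e"
  shows "c \<subseteq> X closure_of e"
proof (cases "p \<in> e")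
  case True
  then have "c = e" using cell_unique[OF c e(1) p(1)] by blast
  then show ?thesis using cell_in_closure[OF e(1)] by simp
next
  case False
  then obtain k d where d: "k < n" "d \<in> cells k" "p \<in> d" using closure_cells[OF e(1) p(2)] by blast
  then have m: "m < n" using cell_unique[OF c d(2) p(1)] by blast
  show ?thesis
  proof (cases "m = 0")
    case True
    then show ?thesis using zero_cell[of c] c p by auto
  next
    case False
    then have "m = 1" "n = 2" using m e(2) by auto
    moreover have "p \<in> char_map n e ` disc_boundary n" using closure_cases[OF e(1) p(2)] \<open>p \<notin> e\<close> by simp
    ultimately have "c \<subseteq> char_map n e ` disc_boundary n" using edge_in_boundary[of e c] e c p(1) by auto
    then show ?thesis using boundary_in_closure[OF e(1)] by (rule order_trans)
  qed
qed

end

section \<open>The barycentric subdivision is homeomorphic to the complex\<close>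

lemma normalize_boundary:
  assumes "x \<in> disc_set n" "radius n x \<noteq> 0" shows "(\<lambda>i. x i / radius n x) \<in> disc_boundary n"
  using assms radius_scale[of "inverse (radius n x)" n x] by (simp add: disc_boundary_iff disc_set_iff divide_inverse mult.commute)

text \<open>
  Only the centre of the disc needs an argument; there the factor \<open>radius n x\<close> forces the limit.
\<close>

lemma continuous_on_cone:
  fixes b :: "(nat \<Rightarrow> real) \<Rightarrow> real"
  assumes b: "continuous_on (disc_boundary n) b" "\<And>u. u \<in> disc_boundary n \<Longrightarrow> \<bar>b u\<bar> \<le> 1"
  shows "continuous_on (disc_set n) (\<lambda>x. radius n x * b (\<lambda>i. x i / radius n x))"
  unfolding continuous_on_def
proof
  let ?h = "\<lambda>x. radius n x * b (\<lambda>i. x i / radius n x)"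
  note bd = normalize_boundary
  fix x assume x: "x \<in> disc_set n"
  show "(?h \<longlongrightarrow> ?h x) (at x within disc_set n)"
  proof (cases "radius n x = 0")
    case True
    have "(radius n \<longlongrightarrow> radius n x) (at x within disc_set n)"
      using continuous_radius[of "disc_set n" n] x by (simp add: continuous_on_def)
    then have lim: "(radius n \<longlongrightarrow> 0) (at x within disc_set n)" using True by simp
    have "\<bar>?h y\<bar> \<le> radius n y" if "y \<in> disc_set n" for y
      using bd[OF that] b(2) mult_left_le[of "\<bar>b (\<lambda>i. y i / radius n y)\<bar>" "radius n y"]
      by (cases "radius n y = 0") (auto simp: abs_mult)
    then have "eventually (\<lambda>y. norm (?h y) \<le> radius n y) (at x within disc_set n)"
      by (auto simp: eventually_at_filter)
    then have "(?h \<longlongrightarrow> 0) (at x within disc_set n)" by (rule Lim_null_comparison[OF _ lim])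
    then show ?thesis using True by simp
  next
    case False
    let ?V = "{y. radius n y \<noteq> 0}"
    have V: "open ?V" by (rule open_Collect_neq) (auto intro: continuous_radius)
    have "continuous_on (disc_set n \<inter> ?V) ?h"
    proof (intro continuous_on_mult continuous_radius continuous_on_compose2[OF b(1)])
      show "continuous_on (disc_set n \<inter> ?V) (\<lambda>x i. x i / radius n x)"
        by (intro continuous_on_coordinatewise_then_product continuous_on_divide continuous_radius
            continuous_on_subset[OF continuous_on_product_coordinates]) auto
    qed (use bd in auto)
    then have "(?h \<longlongrightarrow> ?h x) (at x within (disc_set n \<inter> ?V))"
      using x False by (simp add: continuous_on_def)
    moreover have "at x within (disc_set n \<inter> ?V) = at x within disc_set n"
      using V False by (intro at_within_nhd[of x ?V]) auto
    ultimately show ?thesis by simp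
  qed
qed

locale regular_CW_surface = regular_CW_complex +
  assumes dim_le_2: "2 < n \<Longrightarrow> cells n = {}"
begin

lemma cell_dim_le_2: "e \<in> cells n \<Longrightarrow> n \<le> 2"
  using dim_le_2[of n] by (cases "2 < n") auto

abbreviation K' :: "'a set set set" where
  "K' \<equiv> barycentric_subdivision X cells"

text \<open>
  The part of the subdivision that triangulates the closure of \<open>e\<close>.
\<close>

definition cell_sd :: "'a set \<Rightarrow> 'a set set set" where
  "cell_sd e = {\<sigma> \<in> K'. \<forall>c\<in>\<sigma>. c \<subseteq> X closure_of e}"

lemma K'_iff: "\<sigma> \<in> K' \<longleftrightarrow> \<sigma> \<noteq> {} \<and> finite \<sigma> \<and> (\<forall>c\<in>\<sigma>. \<exists>n. c \<in> cells n) \<and>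
    (\<forall>c\<in>\<sigma>. \<forall>d\<in>\<sigma>. c \<subseteq> X closure_of d \<or> d \<subseteq> X closure_of c)"
  by (auto simp: barycentric_subdivision_def face_of_cell_def)

lemma K'_cell: "\<sigma> \<in> K' \<Longrightarrow> c \<in> \<sigma> \<Longrightarrow> \<exists>n. c \<in> cells n"
  by (simp add: K'_iff)

lemma K'_comparable: "\<sigma> \<in> K' \<Longrightarrow> c \<in> \<sigma> \<Longrightarrow> d \<in> \<sigma> \<Longrightarrow> c \<subseteq> X closure_of d \<or> d \<subseteq> X closure_of c"
  by (simp add: K'_iff)

lemma simplicial_K': "simplicial K'"
  unfolding simplicial_def
proof (intro ballI conjI allI impI)
  fix \<sigma> assume s: "\<sigma> \<in> K'"
  show "finite \<sigma>" "\<sigma> \<noteq> {}" using s by (simp_all add: K'_iff)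
  fix \<tau> assume t: "\<tau> \<subseteq> \<sigma>" "\<tau> \<noteq> {}"
  show "\<tau> \<in> K'"
    unfolding K'_iff
  proof (intro conjI ballI t(2))
    show "finite \<tau>" using t(1) \<open>finite \<sigma>\<close> by (rule finite_subset)
    show "\<exists>n. c \<in> cells n" if "c \<in> \<tau>" for c
      using s subsetD[OF t(1) that] by (simp add: K'_iff)
    show "c \<subseteq> X closure_of d \<or> d \<subseteq> X closure_of c" if "c \<in> \<tau>" "d \<in> \<tau>" for c d
      using s subsetD[OF t(1) that(1)] subsetD[OF t(1) that(2)] by (simp add: K'_iff)
  qed
qed

lemma simplicial_cell_sd: "simplicial (cell_sd e)"
  unfolding simplicial_def
proof (intro ballI conjI allI impI)
  fix \<sigma> assume s: "\<sigma> \<in> cell_sd e"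
  then have sK: "\<sigma> \<in> K'" by (simp add: cell_sd_def)
  show "finite \<sigma>" "\<sigma> \<noteq> {}" using simplicialD(1,2)[OF simplicial_K' sK] by auto
  fix \<tau> assume t: "\<tau> \<subseteq> \<sigma>" "\<tau> \<noteq> {}"
  have "\<tau> \<in> K'" by (rule simplicialD(3)[OF simplicial_K' sK t])
  then show "\<tau> \<in> cell_sd e" using s t(1) unfolding cell_sd_def by blast
qed

lemma finite_cell_sd:
  assumes "e \<in> cells n" shows "finite (cell_sd e)"
proof (rule finite_subset)
  show "cell_sd e \<subseteq> Pow {c. (\<exists>m. c \<in> cells m) \<and> c \<subseteq> X closure_of e}"
    by (auto simp: cell_sd_def K'_iff)
qed (use finite_faces[OF assms] in simp)

lemma cell_sd_D: "\<sigma> \<in> cell_sd e \<Longrightarrow> c \<in> \<sigma> \<Longrightarrow> c \<subseteq> X closure_of e"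
  by (simp add: cell_sd_def)

lemma cell_sd_cell: "\<sigma> \<in> cell_sd e \<Longrightarrow> c \<in> \<sigma> \<Longrightarrow> \<exists>n. c \<in> cells n"
  by (simp add: cell_sd_def K'_iff)

lemma cell_sd_mono: "c \<subseteq> X closure_of e \<Longrightarrow> cell_sd c \<subseteq> cell_sd e"
  using closure_mono'[of c e] by (auto simp: cell_sd_def)

lemma cell_sd_insert:
  assumes "e \<in> cells n" "\<sigma> \<in> cell_sd e" shows "insert e \<sigma> \<in> cell_sd e"
  using assms cell_in_closure[OF assms(1)] by (auto simp: cell_sd_def K'_iff)

lemma chain_top:
  assumes "\<sigma> \<in> K'" obtains c where "c \<in> \<sigma>" "\<sigma> \<in> cell_sd c"
proof -
  define dim where "dim c = (SOME n. c \<in> cells n)" for c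
  have dim: "c \<in> cells (dim c)" if "c \<in> \<sigma>" for c
  proof -
    have "\<exists>n. c \<in> cells n" using assms that by (auto simp: K'_iff)
    then show ?thesis unfolding dim_def by (rule someI_ex)
  qed
  have "finite (dim ` \<sigma>)" "dim ` \<sigma> \<noteq> {}" using assms by (auto simp: K'_iff)
  then obtain c where c: "c \<in> \<sigma>" "dim c = Max (dim ` \<sigma>)" using Max_in by (metis imageE)
  have "d \<subseteq> X closure_of c" if d: "d \<in> \<sigma>" for d
  proof (rule ccontr)
    assume n: "\<not> d \<subseteq> X closure_of c"
    then have "c \<subseteq> X closure_of d" using assms c(1) d unfolding K'_iff by blast
    then have "c = d \<or> dim c < dim d" using face_dim[OF dim dim] c(1) d by blast
    moreover have "dim d \<le> dim c" unfolding c(2) using \<open>finite (dim ` \<sigma>)\<close> d by simp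
    ultimately have "c = d" by simp
    then show False using n cell_in_closure[OF dim[OF d]] by simp
  qed
  then show ?thesis using that c(1) assms by (simp add: cell_sd_def)
qed

text \<open>
  A closed cell is the cone over its boundary sphere with the barycentre as apex, and the triangulation
  is extended over these cones by induction on the dimension. The value of \<open>to_sd_upto n\<close> is meaningful
  on the cells of dimension less than \<open>n\<close>.
\<close>

fun to_sd_upto :: "nat \<Rightarrow> 'a \<Rightarrow> 'a set \<Rightarrow> real" where
  "to_sd_upto 0 p = (\<lambda>_. 0)"
| "to_sd_upto (Suc n) p = (if \<exists>e\<in>cells n. p \<in> e then
     (let e = (THE e. e \<in> cells n \<and> p \<in> e); x = (THE x. x \<in> disc_set n \<and> char_map n e x = p)
      in (\<lambda>c. (1 - radius n x) * vertex e c + radius n x * to_sd_upto n (char_map n e (\<lambda>i. x i / radius n x)) c))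
     else to_sd_upto n p)"

definition to_sd :: "'a \<Rightarrow> 'a set \<Rightarrow> real" where
  "to_sd = to_sd_upto 3"

lemma to_sd_upto_stable: "e \<in> cells m \<Longrightarrow> p \<in> e \<Longrightarrow> m < n \<Longrightarrow> to_sd_upto n p = to_sd_upto (Suc m) p"
proof (induction n)
  case (Suc n)
  show ?case
  proof (cases "m = n")
    case False
    then have "\<not> (\<exists>f\<in>cells n. p \<in> f)" using cell_unique Suc.prems by blast
    then have "to_sd_upto (Suc n) p = to_sd_upto n p" by simp
    then show ?thesis using Suc False by simp
  qed simp
qed simp

lemma to_sd_upto_cell:
  assumes e: "e \<in> cells m" and x: "x \<in> disc_set m" "char_map m e x \<in> e"
  shows "to_sd_upto (Suc m) (char_map m e x) = (\<lambda>c. (1 - radius m x) * vertex e c + radius m x * to_sd_upto m (char_map m e (\<lambda>i. x i / radius m x)) c)"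
proof -
  have "(THE f. f \<in> cells m \<and> char_map m e x \<in> f) = e"
    using e x cell_unique by (intro the_equality) blast+
  moreover have "(THE y. y \<in> disc_set m \<and> char_map m e y = char_map m e x) = x"
    using x inj_onD[OF char_map_inj[OF e]] by (intro the_equality) auto
  moreover have "\<exists>f\<in>cells m. char_map m e x \<in> f" using e x by blast
  ultimately show ?thesis by (simp add: Let_def)
qed

lemma to_sd_char_map:
  assumes e: "e \<in> cells m" and x: "x \<in> disc_set m"
  shows "to_sd (char_map m e x) = (\<lambda>c. (1 - radius m x) * vertex e c + radius m x * to_sd (char_map m e (\<lambda>i. x i / radius m x)) c)"
proof (cases "radius m x = 1")
  case False
  then have "x \<in> disc_interior m" using x by (auto simp: disc_set_iff disc_interior_iff)
  then have xe: "char_map m e x \<in> e" using char_map(2)[OF e] by blast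
  have "to_sd (char_map m e x) = to_sd_upto (Suc m) (char_map m e x)"
    unfolding to_sd_def using cell_dim_le_2[OF e] by (intro to_sd_upto_stable[OF e xe]) auto
  also have "\<dots> = (\<lambda>c. (1 - radius m x) * vertex e c + radius m x * to_sd_upto m (char_map m e (\<lambda>i. x i / radius m x)) c)"
    by (rule to_sd_upto_cell[OF e x xe])
  also have "\<dots> = (\<lambda>c. (1 - radius m x) * vertex e c + radius m x * to_sd (char_map m e (\<lambda>i. x i / radius m x)) c)"
  proof (cases "radius m x = 0")
    case False
    then obtain k d where d: "k < m" "d \<in> cells k" "char_map m e (\<lambda>i. x i / radius m x) \<in> d"
      using boundary_cells[OF e normalize_boundary[OF x]] by blast
    then show ?thesis
      unfolding to_sd_def using to_sd_upto_stable[OF d(2,3,1)] to_sd_upto_stable[OF d(2,3), of 3] cell_dim_le_2[OF d(2)] by simp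
  qed simp
  finally show ?thesis .
qed simp

lemma to_sd_center:
  assumes "e \<in> cells m" "x \<in> disc_set m" "radius m x = 0" shows "to_sd (char_map m e x) = vertex e"
  by (rule trans[OF to_sd_char_map[OF assms(1,2)]]) (simp add: assms(3))

text \<open>
  Both sides are cones over what is known in lower dimension: a closed cell over its boundary, which
  consists of the closures of the proper faces, and its subdivision over the chains of proper faces.
  For surjectivity, the apex coordinate of a point determines the radius, and the remaining coordinates,
  rescaled, form a point that belongs to the largest face in their carrier.
\<close>

lemma to_sd_props_aux:
  "e \<in> cells m \<Longrightarrow> continuous_map (subtopology X (X closure_of e)) euclidean to_sd \<and>
     to_sd ` (X closure_of e) = underlying_space (cell_sd e) \<and> (\<forall>x\<in>disc_set m. to_sd (char_map m e x) e = 1 - radius m x)"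
proof (induction m arbitrary: e rule: less_induct)
  case (less m)
  note e = less.prems
  have IH: "continuous_map (subtopology X (X closure_of c)) euclidean to_sd" "to_sd ` (X closure_of c) = underlying_space (cell_sd c)"
    if "k < m" "c \<in> cells k" for k c
    using less.IH[OF that] by blast+
  have bd: "to_sd (char_map m e u) \<in> underlying_space (cell_sd e)" "to_sd (char_map m e u) e = 0" if u: "u \<in> disc_boundary m" for u
  proof -
    obtain k c where c: "k < m" "c \<in> cells k" "char_map m e u \<in> c" using boundary_cells[OF e u] by blast
    have q: "char_map m e u \<in> X closure_of e" using boundary_in_closure[OF e] u by blast
    have ce: "c \<subseteq> X closure_of e" by (rule closed_cell_subcomplex[OF e cell_dim_le_2[OF e] c(2,3) q])
    have "char_map m e u \<in> X closure_of c" using cell_in_closure[OF c(2)] c(3) by blast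
    then have to_sd: "to_sd (char_map m e u) \<in> underlying_space (cell_sd c)" using IH(2)[OF c(1,2)] by blast
    then show "to_sd (char_map m e u) \<in> underlying_space (cell_sd e)" using space_mono[OF cell_sd_mono[OF ce]] by blast
    have s: "supp (to_sd (char_map m e u)) \<in> cell_sd c" using to_sd by (simp add: space_iff[OF simplicial_cell_sd])
    show "to_sd (char_map m e u) e = 0"
    proof (rule ccontr)
      assume "to_sd (char_map m e u) e \<noteq> 0"
      then have "e \<subseteq> X closure_of c" by (intro cell_sd_D[OF s]) simp
      then have "e = c" using face_dim[OF e c(2)] c(1) by auto
      moreover obtain p where "p \<in> e" using cell_nonempty[OF e] by blast
      ultimately show False using cell_unique[OF e c(2), of p] c(1) by simp
    qed
  qed
  have to_sd_top: "to_sd (char_map m e x) e = 1 - radius m x" if "x \<in> disc_set m" for x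
    using to_sd_char_map[OF e that] bd(2)[OF normalize_boundary[OF that]] by (cases "radius m x = 0") (simp_all add: vertex_def)
  have fe: "finite (insert e \<sigma>)" if "\<sigma> \<in> cell_sd e" for \<sigma> using simplicialD(1)[OF simplicial_cell_sd cell_sd_insert[OF e that]] .
  have e_in: "{e} \<in> cell_sd e" using e cell_in_closure[OF e] by (auto simp: cell_sd_def K'_iff)
  have to_sd_in: "to_sd (char_map m e x) \<in> underlying_space (cell_sd e)" if x: "x \<in> disc_set m" for x
  proof (cases "radius m x = 0")
    case True
    then have "to_sd (char_map m e x) = vertex e" by (rule to_sd_center[OF e x])
    then show ?thesis using vertex_in_simplex[of "{e}" e] e_in by (auto simp: underlying_space_def)
  next
    case False
    let ?y = "to_sd (char_map m e (\<lambda>i. x i / radius m x))"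
    have y: "?y \<in> underlying_space (cell_sd e)" by (rule bd(1)[OF normalize_boundary[OF x False]])
    then have s: "supp ?y \<in> cell_sd e" by (simp add: space_iff[OF simplicial_cell_sd])
    have "?y \<in> closed_simplex (insert e (supp ?y))"
      using y unfolding closed_simplex_iff[OF fe[OF s]] space_iff[OF simplicial_cell_sd] by blast
    moreover have "vertex e \<in> closed_simplex (insert e (supp ?y))" using fe[OF s] by (intro vertex_in_simplex) auto
    moreover have "radius m x \<in> {0..1}" using x by (simp add: disc_set_iff)
    ultimately have "to_sd (char_map m e x) \<in> closed_simplex (insert e (supp ?y))"
      unfolding to_sd_char_map[OF e x] by (intro closed_simplex_convex)
    then show ?thesis using cell_sd_insert[OF e s] by (auto simp: underlying_space_def)
  qed
  have image: "to_sd ` (X closure_of e) = underlying_space (cell_sd e)"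
  proof
    show "to_sd ` (X closure_of e) \<subseteq> underlying_space (cell_sd e)"
      unfolding char_map_image[OF e, symmetric] using to_sd_in by blast
    show "underlying_space (cell_sd e) \<subseteq> to_sd ` (X closure_of e)"
    proof
      fix y assume y: "y \<in> underlying_space (cell_sd e)"
      then have ys: "supp y \<in> cell_sd e" "\<And>v. 0 \<le> y v" "sum y (supp y) = 1"
        by (auto simp: space_iff[OF simplicial_cell_sd])
      have fin: "finite (supp y)" using simplicialD(1)[OF simplicial_cell_sd ys(1)] .
      have sum_e: "sum y (supp y - {e}) = 1 - y e"
      proof (cases "e \<in> supp y")
        case True
        then show ?thesis using sum.remove[OF fin, of e y] ys(3) by simp
      next
        case False
        then show ?thesis using ys(3) by simp
      qed
      define r where "r = 1 - y e"
      have r0: "0 \<le> r" using sum_nonneg[of "supp y - {e}" y] ys(2) sum_e by (simp add: r_def)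
      show "y \<in> to_sd ` (X closure_of e)"
      proof (cases "r = 0")
        case True
        then have y0: "y v = 0" if "v \<noteq> e" for v
        proof (cases "v \<in> supp y")
          case True
          then show ?thesis
            using sum_nonneg_eq_0_iff[of "supp y - {e}" y] fin ys(2) sum_e \<open>r = 0\<close> that by (simp add: r_def) blast
        qed simp
        have "y = vertex e"
        proof
          fix v show "y v = vertex e v"
            using True y0[of v] by (cases "v = e") (simp_all add: vertex_def r_def)
        qed
        moreover have z: "(\<lambda>_. 0) \<in> disc_set m" "radius m (\<lambda>_. 0) = 0" by (auto simp: disc_set_iff radius_def)
        then have "to_sd (char_map m e (\<lambda>_. 0)) = vertex e" by (rule to_sd_center[OF e])
        moreover have "char_map m e (\<lambda>_. 0) \<in> X closure_of e"
          using \<open>(\<lambda>_. 0) \<in> disc_set m\<close> char_map_image[OF e] by blast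
        ultimately have "y = to_sd (char_map m e (\<lambda>_. 0))" "char_map m e (\<lambda>_. 0) \<in> X closure_of e" by simp_all
        then show ?thesis by (rule image_eqI)
      next
        case False
        then have rpos: "r > 0" using r0 by simp
        define z where "z v = (if v = e then 0 else y v / r)" for v
        have sz: "supp z = supp y - {e}"
        proof (rule Set.set_eqI)
          show "v \<in> supp z \<longleftrightarrow> v \<in> supp y - {e}" for v using rpos by (cases "v = e") (simp_all add: z_def)
        qed
        have "sum z (supp z) = sum (\<lambda>v. y v / r) (supp y - {e})"
          unfolding sz by (intro sum.cong) (auto simp: z_def)
        then have sumz: "sum z (supp z) = 1" using sum_e rpos by (simp add: r_def flip: sum_divide_distrib)
        then have "supp z \<noteq> {}" by auto
        then have szK: "supp z \<in> cell_sd e" using simplicialD(3)[OF simplicial_cell_sd ys(1)] sz by blast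
        then have "supp z \<in> K'" by (simp add: cell_sd_def)
        then obtain c where c: "c \<in> supp z" "supp z \<in> cell_sd c" by (rule chain_top)
        obtain k where k: "c \<in> cells k" using cell_sd_cell[OF szK c(1)] by blast
        have "c \<noteq> e" using c(1) unfolding sz by blast
        moreover have "c \<subseteq> X closure_of e" by (rule cell_sd_D[OF szK c(1)])
        ultimately have "c \<noteq> e" "c \<subseteq> X closure_of e" by blast+
        then have km: "k < m" using face_dim[OF k e] by blast
        have "z \<in> underlying_space (cell_sd c)"
          using c(2) sumz ys(2) rpos by (simp add: space_iff[OF simplicial_cell_sd] z_def)
        then obtain q where q: "q \<in> X closure_of c" "z = to_sd q" using IH(2)[OF km k] by blast
        have "q \<in> X closure_of e" using closure_mono'[OF \<open>c \<subseteq> X closure_of e\<close>] q(1) by blast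
        moreover have "q \<notin> e"
        proof
          assume "q \<in> e"
          show False
          proof (cases "q \<in> c")
            case True
            then show False using cell_unique[OF k e True \<open>q \<in> e\<close>] km by simp
          next
            case False
            then obtain j d where "j < k" "d \<in> cells j" "q \<in> d" using closure_cells[OF k q(1)] by blast
            then show False using cell_unique[OF _ e, of d j q] \<open>q \<in> e\<close> km by simp
          qed
        qed
        ultimately obtain u where u: "u \<in> disc_boundary m" "q = char_map m e u" using closure_cases[OF e] by blast
        let ?x = "\<lambda>i. r * u i"
        have r1: "r \<le> 1" using ys(2)[of e] by (simp add: r_def)
        have nx: "radius m ?x = r" using radius_scale[OF r0, of m u] u(1) by (simp add: disc_boundary_iff)
        then have xD: "?x \<in> disc_set m" using u(1) r1 by (simp add: disc_set_iff disc_boundary_iff)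
        have "(\<lambda>i. ?x i / radius m ?x) = u" using nx rpos by (simp add: fun_eq_iff)
        then have "to_sd (char_map m e ?x) = (\<lambda>c. (1 - r) * vertex e c + r * z c)"
          using to_sd_char_map[OF e xD] nx u(2) q(2) by simp
        also have "\<dots> = y" using rpos by (auto simp: fun_eq_iff vertex_def z_def r_def)
        finally have "y = to_sd (char_map m e ?x)" ..
        moreover have "char_map m e ?x \<in> X closure_of e" using xD char_map_image[OF e] by blast
        ultimately show ?thesis by (rule image_eqI)
      qed
    qed
  qed
  have "continuous_map (subtopology X (X closure_of e)) euclidean to_sd"
  proof -
    let ?S = "char_map m e ` disc_boundary m"
    let ?F = "{c. (\<exists>k<m. c \<in> cells k) \<and> c \<subseteq> X closure_of e}"
    have "continuous_map (subtopology X ?S) euclidean to_sd"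
    proof (rule pasting_lemma_closed[where I = ?F and T = "\<lambda>c. ?S \<inter> X closure_of c" and f = "\<lambda>_. to_sd"])
      show "finite ?F" by (rule finite_subset[OF _ finite_faces[OF e]]) blast
      fix c assume "c \<in> ?F"
      then obtain k where k: "k < m" "c \<in> cells k" by blast
      show "closedin (subtopology X ?S) (?S \<inter> X closure_of c)"
        by (rule closedin_subtopology_Int_closed) simp
      show "continuous_map (subtopology (subtopology X ?S) (?S \<inter> X closure_of c)) euclidean to_sd"
        unfolding subtopology_subtopology
        by (rule continuous_map_from_subtopology_mono[OF IH(1)[OF k]]) blast
    next
      fix q assume "q \<in> topspace (subtopology X ?S)"
      then have q: "q \<in> ?S" by simp
      then obtain u where u: "u \<in> disc_boundary m" "q = char_map m e u" by blast
      obtain k c where c: "k < m" "c \<in> cells k" "q \<in> c" using boundary_cells[OF e u(1)] u(2) by blast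
      have "q \<in> X closure_of e" using boundary_in_closure[OF e] q by blast
      then have "c \<subseteq> X closure_of e" by (rule closed_cell_subcomplex[OF e cell_dim_le_2[OF e] c(2,3)])
      then show "\<exists>j. j \<in> ?F \<and> q \<in> ?S \<inter> X closure_of j \<and> to_sd q = to_sd q"
        using c q cell_in_closure[OF c(2)] by blast
    qed simp
    moreover have "continuous_map (top_of_set (disc_boundary m)) (subtopology X ?S) (char_map m e)"
      using continuous_map_from_subtopology_mono[OF char_map_continuous[OF e, unfolded disc_eq], of "disc_boundary m"] disc_set_split[of m]
      by (simp add: continuous_map_in_subtopology)
    ultimately have "continuous_map (top_of_set (disc_boundary m)) euclidean (to_sd \<circ> char_map m e)"
      by (rule continuous_map_compose[rotated])
    then have B: "continuous_on (disc_boundary m) (\<lambda>u. to_sd (char_map m e u))" by (simp add: o_def)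
    have B1: "\<bar>to_sd (char_map m e u) c\<bar> \<le> 1" if "u \<in> disc_boundary m" for u c
    proof -
      have y: "\<forall>v. 0 \<le> to_sd (char_map m e u) v" "sum (to_sd (char_map m e u)) (supp (to_sd (char_map m e u))) = 1" "finite (supp (to_sd (char_map m e u)))"
        using bd(1)[OF that] simplicialD(1)[OF simplicial_cell_sd[of e]] by (auto simp: space_iff[OF simplicial_cell_sd])
      show ?thesis
        using member_le_sum[of c "supp (to_sd (char_map m e u))" "to_sd (char_map m e u)"] y by (cases "c \<in> supp (to_sd (char_map m e u))") auto
    qed
    have "continuous_on (disc_set m) (\<lambda>x. (1 - radius m x) * vertex e c + radius m x * to_sd (char_map m e (\<lambda>i. x i / radius m x)) c)" for c
      by (intro continuous_on_add continuous_on_mult continuous_on_diff continuous_on_const continuous_radius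
          continuous_on_cone[of m "\<lambda>u. to_sd (char_map m e u) c"] continuous_on_product_then_coordinatewise[OF B] B1)
    then have "continuous_on (disc_set m) (\<lambda>x. to_sd (char_map m e x) c)" for c
      by (rule continuous_on_eq) (use to_sd_char_map[OF e] in simp)
    then have cont: "continuous_on (disc_set m) (\<lambda>x. to_sd (char_map m e x))"
      by (rule continuous_on_coordinatewise_then_product)
    obtain h where h: "homeomorphic_maps (disc m) (subtopology X (char_map m e ` disc_set m)) (char_map m e) h"
      using char_map(1)[OF e] unfolding embedding_map_def homeomorphic_map_maps by (auto simp: disc_eq)
    have "continuous_map (disc m) euclidean (\<lambda>x. to_sd (char_map m e x))" using cont by (simp add: disc_eq)
    then have "continuous_map (subtopology X (char_map m e ` disc_set m)) euclidean ((\<lambda>x. to_sd (char_map m e x)) \<circ> h)"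
      using h by (intro continuous_map_compose[of _ "disc m"]) (auto simp: homeomorphic_maps_def)
    then have "continuous_map (subtopology X (char_map m e ` disc_set m)) euclidean to_sd"
      by (rule continuous_map_eq) (use h in \<open>auto simp: homeomorphic_maps_def\<close>)
    then show ?thesis by (simp only: char_map_image[OF e])
  qed
  with to_sd_top image show ?case by blast
qed

lemma to_sd_props:
  assumes "e \<in> cells m"
  shows "continuous_map (subtopology X (X closure_of e)) euclidean to_sd"
    and "to_sd ` (X closure_of e) = underlying_space (cell_sd e)"
    and "\<And>x. x \<in> disc_set m \<Longrightarrow> to_sd (char_map m e x) e = 1 - radius m x"
  using to_sd_props_aux[OF assms] by blast+

lemma point_in_cell: "p \<in> topspace X \<Longrightarrow> \<exists>n. \<exists>e\<in>cells n. p \<in> e"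
  using cells_cover by blast

lemma cell_interior_point:
  assumes "e \<in> cells m" "p \<in> e" obtains x where "x \<in> disc_set m" "radius m x < 1" "p = char_map m e x"
proof -
  have "p \<in> char_map m e ` disc_interior m" using assms(2) unfolding char_map(2)[OF assms(1)] .
  then show ?thesis using that by (auto simp: disc_interior_iff disc_set_iff)
qed

lemma to_sd_cell:
  assumes "e \<in> cells m" "p \<in> e" shows "to_sd p e > 0" "\<And>c. to_sd p c \<noteq> 0 \<Longrightarrow> c \<subseteq> X closure_of e"
proof -
  obtain x where x: "x \<in> disc_set m" "radius m x < 1" "p = char_map m e x" using cell_interior_point[OF assms] .
  show "to_sd p e > 0" using to_sd_props(3)[OF assms(1) x(1)] x by simp
  have "to_sd p \<in> underlying_space (cell_sd e)" using to_sd_props(2)[OF assms(1)] cell_in_closure[OF assms(1)] assms(2) by blast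
  then have "supp (to_sd p) \<in> cell_sd e" by (simp add: space_iff[OF simplicial_cell_sd])
  then show "c \<subseteq> X closure_of e" if "to_sd p c \<noteq> 0" for c using cell_sd_D[of "supp (to_sd p)" e c] that by simp
qed

text \<open>
  The cell of a point is the largest cell in the carrier of its image, the radius is read off from the
  coordinate there, and the direction from the other coordinates by induction.
\<close>

lemma to_sd_inj_cell: "e \<in> cells m \<Longrightarrow> p \<in> e \<Longrightarrow> q \<in> topspace X \<Longrightarrow> to_sd p = to_sd q \<Longrightarrow> p = q"
proof (induction m arbitrary: e p q rule: less_induct)
  case (less m)
  note e = less.prems(1)
  obtain k d where d: "d \<in> cells k" "q \<in> d" using point_in_cell[OF less.prems(3)] by blast
  have "e \<subseteq> X closure_of d" using to_sd_cell(1)[OF e less.prems(2)] to_sd_cell(2)[OF d, of e] less.prems(4) by simp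
  moreover have "d \<subseteq> X closure_of e" using to_sd_cell(1)[OF d] to_sd_cell(2)[OF e less.prems(2), of d] less.prems(4) by simp
  ultimately have "e = d"
    using face_dim[OF e d(1)] face_dim[OF d(1) e] by auto
  then have q: "q \<in> e" using d(2) by simp
  obtain x where x: "x \<in> disc_set m" "radius m x < 1" "p = char_map m e x" using cell_interior_point[OF e less.prems(2)] .
  obtain y where y: "y \<in> disc_set m" "radius m y < 1" "q = char_map m e y" using cell_interior_point[OF e q] .
  have r: "radius m x = radius m y"
    using to_sd_props(3)[OF e x(1)] to_sd_props(3)[OF e y(1)] less.prems(4) x(3) y(3) by simp
  show "p = q"
  proof (cases "radius m x = 0")
    case True
    then have "x = (\<lambda>_. 0)" "y = (\<lambda>_. 0)" using radius_0_iff[of m x] radius_0_iff[of m y] x(1) y(1) r by (auto simp: disc_set_iff)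
    then show ?thesis using x(3) y(3) by simp
  next
    case False
    let ?u = "\<lambda>i. x i / radius m x" and ?v = "\<lambda>i. y i / radius m x"
    have u: "?u \<in> disc_boundary m" "?v \<in> disc_boundary m"
      using normalize_boundary[OF x(1) False] normalize_boundary[OF y(1)] False r by simp_all
    have "to_sd (char_map m e ?u) c = to_sd (char_map m e ?v) c" for c
      using fun_cong[OF to_sd_char_map[OF e x(1)], of c] fun_cong[OF to_sd_char_map[OF e y(1)], of c] fun_cong[OF less.prems(4), of c] x(3) y(3) r False
      by simp
    then have eq: "to_sd (char_map m e ?u) = to_sd (char_map m e ?v)" by blast
    obtain j c where c: "j < m" "c \<in> cells j" "char_map m e ?u \<in> c" using boundary_cells[OF e u(1)] by blast
    have "char_map m e ?v \<in> topspace X"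
      using boundary_in_closure[OF e] u(2) closure_of_subset_topspace[of X e] by blast
    then have "char_map m e ?u = char_map m e ?v" by (rule less.IH[OF c _ eq])
    then have "?u = ?v" using inj_onD[OF char_map_inj[OF e]] u by (auto simp: disc_set_split)
    then have "x = y" using False by (auto simp: fun_eq_iff)
    then show ?thesis using x(3) y(3) by simp
  qed
qed

lemma to_sd_inj: "inj_on to_sd (topspace X)"
  using to_sd_inj_cell point_in_cell by (meson inj_onI)

lemma to_sd_continuous: "continuous_map X (realization K') to_sd"
  unfolding continuous_map_closedin
proof (intro conjI allI impI)
  have sub: "cell_sd e \<subseteq> K'" for e by (auto simp: cell_sd_def)
  have cell: "continuous_map (subtopology X (X closure_of e)) (realization K') to_sd" if "e \<in> cells n" for e n
    using to_sd_props(1,2)[OF that] finite_cell_sd[OF that] sub[of e] closure_of_subset_topspace[of X e]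
    by (intro continuous_map_into_realization[where J = "cell_sd e"]) (auto simp: Int_absorb1)
  show "to_sd \<in> topspace X \<rightarrow> topspace (realization K')"
  proof
    fix p assume "p \<in> topspace X"
    then obtain n e where e: "e \<in> cells n" "p \<in> e" using point_in_cell by blast
    then have "p \<in> topspace (subtopology X (X closure_of e))"
      using cell_in_closure[OF e(1)] cell_subset[OF e(1)] by auto
    then show "to_sd p \<in> topspace (realization K')" using cell[OF e(1)] by (auto simp: continuous_map_def)
  qed
  fix C assume C: "closedin (realization K') C"
  show "closedin X {x \<in> topspace X. to_sd x \<in> C}"
  proof (rule weak_topology)
    fix n e assume e: "e \<in> cells n"
    have "closedin (subtopology X (X closure_of e)) {x \<in> topspace (subtopology X (X closure_of e)). to_sd x \<in> C}"
      by (rule closedin_continuous_map_preimage[OF cell[OF e] C])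
    then have "closedin X {x \<in> topspace (subtopology X (X closure_of e)). to_sd x \<in> C}"
      by (rule closedin_trans_full) simp
    moreover have "{x \<in> topspace (subtopology X (X closure_of e)). to_sd x \<in> C} = {x \<in> topspace X. to_sd x \<in> C} \<inter> X closure_of e"
      by auto
    ultimately show "closedin X ({x \<in> topspace X. to_sd x \<in> C} \<inter> X closure_of e)" by simp
  qed auto
qed

definition of_sd :: "('a set \<Rightarrow> real) \<Rightarrow> 'a" where
  "of_sd = inv_into (topspace X) to_sd"

lemma of_sd_to_sd: "p \<in> topspace X \<Longrightarrow> of_sd (to_sd p) = p"
  unfolding of_sd_def using to_sd_inj by (rule inv_into_f_f)

text \<open>
  A simplex lies in the subdivision of its largest cell, and on a closed cell, which is compact,
  the inverse of the continuous bijection \<open>to_sd\<close> is continuous.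
\<close>

lemma of_sd_continuous: "continuous_map (realization K') X of_sd"
proof (rule continuous_map_from_realization)
  fix \<sigma> assume s: "\<sigma> \<in> K'"
  obtain e where e: "e \<in> \<sigma>" "\<sigma> \<in> cell_sd e" using chain_top[OF s] .
  obtain n where n: "e \<in> cells n" using cell_sd_cell[OF e(2,1)] by blast
  let ?E = "X closure_of e"
  have top: "topspace (subtopology X ?E) = ?E" using closure_of_subset_topspace[of X e] by auto
  have "homeomorphic_map (subtopology X ?E) (top_of_set (underlying_space (cell_sd e))) to_sd"
  proof (rule T1_Spaces.continuous_imp_homeomorphic_map)
    show "continuous_map (subtopology X ?E) (top_of_set (underlying_space (cell_sd e))) to_sd"
      using to_sd_props(1,2)[OF n] top by (auto simp: continuous_map_in_subtopology)
    show "compact_space (subtopology X ?E)"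
      using char_map_closed(1)[OF n] char_map_image[OF n] by (simp add: compact_space_subtopology)
    show "inj_on to_sd (topspace (subtopology X ?E))" using to_sd_inj by (rule inj_on_subset) auto
    show "to_sd ` topspace (subtopology X ?E) = topspace (top_of_set (underlying_space (cell_sd e)))"
      using to_sd_props(2)[OF n] top by simp
  qed (rule Hausdorff_functions)
  then obtain h where h: "homeomorphic_maps (subtopology X ?E) (top_of_set (underlying_space (cell_sd e))) to_sd h"
    unfolding homeomorphic_map_maps by blast
  then have ch: "continuous_map (top_of_set (underlying_space (cell_sd e))) X h"
    by (auto simp: homeomorphic_maps_def continuous_map_in_subtopology)
  have sub: "closed_simplex \<sigma> \<subseteq> underlying_space (cell_sd e)" using e(2) by (auto simp: underlying_space_def)
  show "continuous_map (top_of_set (closed_simplex \<sigma>)) X of_sd"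
  proof (rule continuous_map_eq)
    show "continuous_map (top_of_set (closed_simplex \<sigma>)) X h"
      by (rule continuous_map_from_subtopology_mono[OF ch sub])
    fix y assume "y \<in> topspace (top_of_set (closed_simplex \<sigma>))"
    then have y: "y \<in> underlying_space (cell_sd e)" using sub by auto
    then have "h y \<in> ?E" "to_sd (h y) = y"
      using h top by (auto simp: homeomorphic_maps_def continuous_map_def Pi_iff)
    then show "h y = of_sd y" using of_sd_to_sd[of "h y"] closure_of_subset_topspace[of X e] by auto
  qed
qed

definition vec2 :: "real \<times> real \<Rightarrow> nat \<Rightarrow> real" where
  "vec2 z = (\<lambda>i. if i = 0 then fst z else if i = 1 then snd z else 0)"

definition star_disc_map :: "'a set \<Rightarrow> real \<times> real \<Rightarrow> 'a set \<Rightarrow> real" where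
  "star_disc_map e z = to_sd (char_map 2 e (vec2 z))"

text \<open>
  A chain of cells can be extended by a 2-cell only if all its members are faces of that 2-cell. So the
  closed star of \<open>e\<close> is the subdivision of the closed cell, and the coordinate at \<open>e\<close> is one minus the
  radius.
\<close>

lemma disc_star:
  assumes e: "e \<in> cells 2"
  shows "continuous_on (cball 0 1) (star_disc_map e)" "inj_on (star_disc_map e) (cball 0 1)"
    "star_disc_map e ` cball 0 1 = underlying_space {\<sigma> \<in> K'. insert e \<sigma> \<in> K'}"
    "\<And>z. z \<in> cball 0 1 \<Longrightarrow> star_disc_map e z e = 0 \<longleftrightarrow> norm z = 1"
    "finite {\<sigma> \<in> K'. insert e \<sigma> \<in> K'}"
proof -
  have radius: "radius 2 (vec2 z) = norm z" for z
    unfolding radius_2 by (simp add: vec2_def norm_prod_def)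
  have D: "vec2 z \<in> disc_set 2 \<longleftrightarrow> z \<in> cball 0 1" for z
    unfolding disc_set_iff radius by (auto simp: vec2_def)
  have im: "vec2 ` cball 0 1 = disc_set 2"
  proof
    show "disc_set 2 \<subseteq> vec2 ` cball 0 1"
    proof
      fix x assume x: "x \<in> disc_set 2"
      then have "x = vec2 (x 0, x 1)" by (auto simp: disc_set_iff vec2_def fun_eq_iff)
      then show "x \<in> vec2 ` cball 0 1" using D x by (metis imageI)
    qed
  qed (use D in blast)
  have inj2: "z = w" if "vec2 z = vec2 w" for z w
    using fun_cong[OF that, of 0] fun_cong[OF that, of 1] by (simp add: vec2_def prod_eq_iff)
  have "continuous_on (cball 0 1) vec2"
    unfolding vec2_def
  proof (rule continuous_on_coordinatewise_then_product)
    show "continuous_on (cball 0 1) (\<lambda>z::real \<times> real. if i = 0 then fst z else if i = 1 then snd z else 0)" for i :: nat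
      by (cases "i = 0"; cases "i = 1") (auto intro!: continuous_intros)
  qed
  then have "continuous_map (top_of_set (cball 0 1)) X (char_map 2 e \<circ> vec2)"
    using D by (intro continuous_map_compose[OF _ char_map_continuous[OF e]]) (auto simp: disc_eq)
  then have "continuous_map (top_of_set (cball 0 1)) (realization K') (to_sd \<circ> (char_map 2 e \<circ> vec2))"
    using to_sd_continuous by (rule continuous_map_compose)
  from continuous_map_compose[OF this continuous_map_realization_euclidean]
  show "continuous_on (cball 0 1) (star_disc_map e)" by (simp add: o_def star_disc_map_def[abs_def])
  have top: "char_map 2 e ` disc_set 2 \<subseteq> topspace X" using char_map_image[OF e] closure_of_subset_topspace[of X e] by blast
  show "inj_on (star_disc_map e) (cball 0 1)"
  proof (rule inj_onI)
    fix z w :: "real \<times> real" assume zw: "z \<in> cball 0 1" "w \<in> cball 0 1" "star_disc_map e z = star_disc_map e w"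
    have "char_map 2 e (vec2 z) \<in> topspace X" "char_map 2 e (vec2 w) \<in> topspace X"
      using top D[of z] D[of w] zw(1,2) by blast+
    then have "char_map 2 e (vec2 z) = char_map 2 e (vec2 w)"
      using inj_onD[OF to_sd_inj] zw(3) by (simp add: star_disc_map_def)
    then show "z = w" using inj_onD[OF char_map_inj[OF e]] D zw inj2 by blast
  qed
  have "{\<sigma> \<in> K'. insert e \<sigma> \<in> K'} = cell_sd e"
  proof
    show "cell_sd e \<subseteq> {\<sigma> \<in> K'. insert e \<sigma> \<in> K'}" using cell_sd_insert[OF e] by (auto simp: cell_sd_def)
    show "{\<sigma> \<in> K'. insert e \<sigma> \<in> K'} \<subseteq> cell_sd e"
    proof
      fix \<sigma> assume s: "\<sigma> \<in> {\<sigma> \<in> K'. insert e \<sigma> \<in> K'}"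
      have "c \<subseteq> X closure_of e" if c: "c \<in> \<sigma>" for c
      proof -
        have s': "insert e \<sigma> \<in> K'" "c \<in> insert e \<sigma>" "e \<in> insert e \<sigma>" using s c by auto
        obtain k where k: "c \<in> cells k" using K'_cell[OF s'(1,2)] by blast
        have "c \<subseteq> X closure_of e \<or> e \<subseteq> X closure_of c" by (rule K'_comparable[OF s'])
        moreover have "e = c" if "e \<subseteq> X closure_of c" using face_dim[OF e k that] cell_dim_le_2[OF k] by auto
        ultimately show ?thesis using cell_in_closure[OF e] by blast
      qed
      then show "\<sigma> \<in> cell_sd e" using s by (auto simp: cell_sd_def)
    qed
  qed
  moreover have "star_disc_map e ` cball 0 1 = underlying_space (cell_sd e)"
  proof -
    have "star_disc_map e ` cball 0 1 = to_sd ` char_map 2 e ` vec2 ` cball 0 1" unfolding image_image star_disc_map_def ..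
    then show ?thesis unfolding im char_map_image[OF e] to_sd_props(2)[OF e] .
  qed
  ultimately show "star_disc_map e ` cball 0 1 = underlying_space {\<sigma> \<in> K'. insert e \<sigma> \<in> K'}" "finite {\<sigma> \<in> K'. insert e \<sigma> \<in> K'}"
    using finite_cell_sd[OF e] by simp_all
  show "star_disc_map e z e = 0 \<longleftrightarrow> norm z = 1" if "z \<in> cball 0 1" for z
    using to_sd_props(3)[OF e] D that radius by (auto simp: star_disc_map_def)
qed

end

section \<open>Based and free null-homotopies\<close>

lemma collapses_boundary_value: "collapses_boundary f \<Longrightarrow> s \<in> square_boundary \<Longrightarrow> t \<in> square_boundary \<Longrightarrow> f s = f t"
  unfolding collapses_boundary_def by auto

lemma square_boundary_subset: "square_boundary \<subseteq> square"
  by (auto simp: square_boundary_def square_def)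

lemma based_homotopicI:
  assumes "continuous_map (top_of_set ({0..1::real} \<times> square)) Y g"
    and "\<And>t. t \<in> square \<Longrightarrow> g (0, t) = f t" "\<And>t. t \<in> square \<Longrightarrow> g (1, t) = h t"
    and "\<And>s t. s \<in> {0..1} \<Longrightarrow> t \<in> square_boundary \<Longrightarrow> g (s, t) = x"
  shows "homotopic_with (\<lambda>h. \<forall>t\<in>square_boundary. h t = x) (top_of_set square) Y f h"
proof (subst homotopic_with)
  show "(\<forall>t\<in>square_boundary. h t = x) = (\<forall>t\<in>square_boundary. k t = x)"
    if "\<And>t. t \<in> topspace (top_of_set square) \<Longrightarrow> h t = k t" for h k :: "real \<times> real \<Rightarrow> 'a"
  proof -
    have "h t = k t" if "t \<in> square_boundary" for t
      using \<open>\<And>t. t \<in> topspace (top_of_set square) \<Longrightarrow> h t = k t\<close>[of t] square_boundary_subset that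
      by (auto simp del: split_paired_All)
    then show ?thesis by simp
  qed
  show "\<exists>g. continuous_map (prod_topology (top_of_set {0..1::real}) (top_of_set square)) Y g \<and>
      (\<forall>t\<in>topspace (top_of_set square). g (0, t) = f t) \<and>
      (\<forall>t\<in>topspace (top_of_set square). g (1, t) = h t) \<and>
      (\<forall>s\<in>{0..1}. \<forall>t\<in>square_boundary. g (s, t) = x)"
    by (rule exI[of _ g]) (use assms in \<open>simp del: split_paired_All\<close>)
qed

text \<open>
  A free contraction drags the image of the boundary along a path \<open>\<gamma>\<close>. Keep the boundary fixed
  instead: let the sphere occupy a smaller and smaller concentric square and fill the collar with the
  part of \<open>\<gamma>\<close> that has been traversed. At the end only a function of the distance to the boundary remains, which
  factors through \<open>\<gamma>\<close> and is contracted along \<open>\<gamma>\<close>.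
\<close>

lemma null_sphere_imp_based:
  assumes f: "null_sphere Y f" "\<And>t. t \<in> square_boundary \<Longrightarrow> f t = x"
  shows "homotopic_with (\<lambda>h. \<forall>t\<in>square_boundary. h t = x) (top_of_set square) Y f (\<lambda>_. x)"
proof -
  let ?P = "\<lambda>h. \<forall>t\<in>square_boundary. h t = x"
  let ?I = "top_of_set {0..1::real}" and ?Q = "top_of_set square"
  obtain c where "sphere_homotopic Y f (\<lambda>_. c)" using f(1) by (auto simp: null_sphere_def)
  then obtain H where H: "continuous_map (prod_topology ?I ?Q) Y H" "\<And>t. H (0, t) = f t" "\<And>t. H (1, t) = c"
    "\<And>s. s \<in> {0..1} \<Longrightarrow> collapses_boundary (\<lambda>t. H (s, t))"
    by (auto simp: sphere_homotopic_def homotopic_with_def)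
  define \<gamma> where "\<gamma> s = H (s, (0, 0))" for s
  have b0: "(0, 0) \<in> square_boundary" by (simp add: square_boundary_def)
  have side: "H (s, t) = \<gamma> s" if "s \<in> {0..1}" "t \<in> square_boundary" for s t
    using collapses_boundary_value[OF H(4)[OF that(1)] that(2) b0] by (simp add: \<gamma>_def)
  \<comment> \<open>The distance from the centre in the maximum norm, scaled to be 1 on the boundary.\<close>
  define m where "m t = max \<bar>2 * fst t - 1\<bar> \<bar>2 * snd t - 1\<bar>" for t :: "real \<times> real"
  \<comment> \<open>The square of size \<open>k\<close> around the centre is stretched to the unit square.\<close>
  define sc where "sc k t = (1/2 + (fst t - 1/2) / k, 1/2 + (snd t - 1/2) / k)" for k and t :: "real \<times> real"
  have m01: "0 \<le> m t" "m t \<le> 1" if "t \<in> square" for t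
    using that by (auto simp: m_def square_def abs_le_iff le_max_iff_disj)
  have m1: "m t = 1" if "t \<in> square_boundary" for t
    using that by (auto simp: m_def square_boundary_def max_def abs_if)
  have sc1: "sc 1 t = t" for t by (simp add: sc_def)
  have sc_sq: "sc k t \<in> square" if "k > 0" "m t \<le> k" for k t
  proof -
    have "\<bar>2 * fst t - 1\<bar> \<le> k" "\<bar>2 * snd t - 1\<bar> \<le> k" using that by (auto simp: m_def)
    then have "-1 \<le> (2 * fst t - 1) / k" "(2 * fst t - 1) / k \<le> 1" "-1 \<le> (2 * snd t - 1) / k" "(2 * snd t - 1) / k \<le> 1"
      using that(1) by (auto simp: field_simps abs_le_iff)
    moreover have "(fst t - 1/2) / k = ((2 * fst t - 1) / k) / 2" "(snd t - 1/2) / k = ((2 * snd t - 1) / k) / 2"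
      using that(1) by (simp_all add: field_simps)
    ultimately show ?thesis unfolding sc_def square_def by auto
  qed
  have sc_bd: "sc (m t) t \<in> square_boundary" if "m t > 0" for t
  proof -
    have sq: "sc (m t) t \<in> square" by (rule sc_sq[OF that]) simp
    have "\<bar>2 * fst t - 1\<bar> = m t \<or> \<bar>2 * snd t - 1\<bar> = m t" by (auto simp: m_def max_def)
    then have "fst (sc (m t) t) \<in> {0, 1} \<or> snd (sc (m t) t) \<in> {0, 1}"
      using that by (auto simp: sc_def abs_if field_simps split: if_splits)
    with sq show ?thesis by (auto simp: square_def square_boundary_def)
  qed
  have cm: "continuous_on S m" for S unfolding m_def by (intro continuous_intros)
  define G1 where "G1 = (\<lambda>(s, t). H (min s (2 * (1 - m t)), sc (max (1 - s/2) (m t)) t))"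
  define G2 where "G2 = (\<lambda>(s, t). \<gamma> ((1 - s) * min 1 (2 * (1 - m t))))"
  have HI: "continuous_map (top_of_set ({0..1} \<times> square)) Y H" using H(1) by simp
  let ?E = "\<lambda>t. \<gamma> (min 1 (2 * (1 - m t)))"
  have "homotopic_with ?P ?Q Y f ?E"
  proof (rule based_homotopicI)
    let ?g = "\<lambda>x. (min (fst x) (2 * (1 - m (snd x))), sc (max (1 - fst x/2) (m (snd x))) (snd x))"
    have pos: "max (1 - s/2) (m t) > 0" if "s \<in> {0..1}" for s t using that by (auto simp: less_max_iff_disj)
    have "continuous_on ({0..1} \<times> square) (\<lambda>x::real \<times> real \<times> real. m (snd x))"
      by (rule continuous_on_compose2[OF cm[of UNIV] continuous_on_snd[OF continuous_on_id]]) simp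
    moreover have "max (1 - fst x/2) (m (snd x)) \<noteq> 0" if "x \<in> {0..1} \<times> square" for x
      using pos[of "fst x" "snd x"] that by auto
    ultimately have "continuous_on ({0..1} \<times> square) ?g"
      unfolding sc_def by (intro continuous_intros) auto
    moreover have "?g ` ({0..1} \<times> square) \<subseteq> {0..1} \<times> square"
    proof (rule image_subsetI)
      fix x :: "real \<times> real \<times> real" assume x: "x \<in> {0..1} \<times> square"
      have "sc (max (1 - fst x/2) (m (snd x))) (snd x) \<in> square"
        using x pos[of "fst x" "snd x"] by (intro sc_sq) auto
      then show "?g x \<in> {0..1} \<times> square" using x m01[of "snd x"] by auto
    qed
    ultimately have "continuous_map (top_of_set ({0..1} \<times> square)) Y (H \<circ> ?g)"
      by (intro continuous_map_compose[OF _ HI]) (auto simp: continuous_map_in_subtopology)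
    then show "continuous_map (top_of_set ({0..1} \<times> square)) Y G1" by (simp add: G1_def o_def case_prod_beta')
    fix t assume t: "t \<in> square"
    show "G1 (0, t) = f t"
      using m01[OF t] by (simp add: G1_def H(2) sc1 min_absorb1 max_absorb1)
    show "G1 (1, t) = ?E t"
    proof (cases "m t \<le> 1/2")
      case True
      then have "min 1 (2 * (1 - m t)) = 1" by (simp add: min_def)
      then show ?thesis by (simp add: G1_def H(3) \<gamma>_def)
    next
      case False
      then have "max (1 - 1/2) (m t) = m t" by (simp add: max_def)
      then have "G1 (1, t) = H (min 1 (2 * (1 - m t)), sc (m t) t)" by (simp add: G1_def)
      also have "\<dots> = ?E t" using False m01[OF t] by (intro side sc_bd) (auto simp: min_def)
      finally show ?thesis .
    qed
  next
    fix s t assume s: "s \<in> {0..1::real}" and t: "t \<in> square_boundary"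
    have "max (1 - s/2) 1 = 1" "min s 0 = 0" using s by auto
    then show "G1 (s, t) = x" using m1[OF t] f(2)[OF t] by (simp add: G1_def H(2) sc1)
  qed
  moreover have "homotopic_with ?P ?Q Y ?E (\<lambda>_. x)"
  proof (rule based_homotopicI)
    let ?g = "\<lambda>x. ((1 - fst x) * min 1 (2 * (1 - m (snd x))), (0::real, 0::real))"
    have "continuous_on ({0..1} \<times> square) (\<lambda>x::real \<times> real \<times> real. m (snd x))"
      by (rule continuous_on_compose2[OF cm[of UNIV] continuous_on_snd[OF continuous_on_id]]) simp
    then have "continuous_on ({0..1} \<times> square) ?g" by (intro continuous_intros)
    moreover have "?g ` ({0..1} \<times> square) \<subseteq> {0..1} \<times> square"
    proof (rule image_subsetI)
      fix x :: "real \<times> real \<times> real" assume x: "x \<in> {0..1} \<times> square"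
      have "0 \<le> min 1 (2 * (1 - m (snd x)))" "min 1 (2 * (1 - m (snd x))) \<le> 1" using x m01[of "snd x"] by auto
      then have "(1 - fst x) * min 1 (2 * (1 - m (snd x))) \<in> {0..1}" using x by (auto intro: mult_le_one)
      then show "?g x \<in> {0..1} \<times> square" by (simp add: square_def)
    qed
    ultimately have "continuous_map (top_of_set ({0..1} \<times> square)) Y (H \<circ> ?g)"
      by (intro continuous_map_compose[OF _ HI]) (auto simp: continuous_map_in_subtopology)
    then show "continuous_map (top_of_set ({0..1} \<times> square)) Y G2" by (simp add: G2_def \<gamma>_def o_def case_prod_beta')
    have g0: "\<gamma> 0 = x" using f(2)[OF b0] by (simp add: \<gamma>_def H(2))
    show "G2 (0, t) = ?E t" "G2 (1, t) = x" for t using g0 by (simp_all add: G2_def)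
    show "G2 (s, t) = x" if "t \<in> square_boundary" for s t using m1[OF that] g0 by (simp add: G2_def)
  qed
  ultimately show ?thesis by (rule homotopic_with_trans)
qed

section \<open>Two-complexes without finite closed surfaces\<close>

lemma continuous_map_subcomplex:
  assumes "M \<subseteq> C" shows "continuous_map (realization M) (realization C) (\<lambda>y. y)"
proof (rule continuous_map_from_realization)
  fix \<sigma> assume "\<sigma> \<in> M"
  then show "continuous_map (top_of_set (closed_simplex \<sigma>)) (realization C) (\<lambda>y. y)"
    using assms by (intro continuous_map_into_realization[where J = "{\<sigma>}"]) (auto simp: underlying_space_def)
qed

lemma null_sphere_subcomplex: "M \<subseteq> C \<Longrightarrow> null_sphere (realization M) f \<Longrightarrow> null_sphere (realization C) f"
  using null_sphere_push[OF _ continuous_map_subcomplex, of M f C] by (simp add: o_def)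

lemma sphere_homotopic_subcomplex:
  assumes "M \<subseteq> C" "sphere_homotopic (realization M) f g" shows "sphere_homotopic (realization C) f g"
proof -
  have "sphere_homotopic (realization C) ((\<lambda>y. y) \<circ> f) ((\<lambda>y. y) \<circ> g)"
    using assms(2) unfolding sphere_homotopic_def
    by (rule homotopic_with_compose_continuous_map_left[OF _ continuous_map_subcomplex[OF assms(1)]]) (simp add: o_def)
  then show ?thesis by (simp add: o_def)
qed

text \<open>
  The set \<open>V2\<close> marks the vertices that stand for 2-cells. Each 2-cell is the closed star of its vertex
  and the simplices that avoid \<open>V2\<close> form the 1-skeleton.
\<close>

locale two_complex =
  fixes C :: "'w set set" and V2 :: "'w set"
  assumes C: "simplicial C"
    and at_most_one: "\<sigma> \<in> C \<Longrightarrow> e \<in> \<sigma> \<Longrightarrow> e' \<in> \<sigma> \<Longrightarrow> e \<in> V2 \<Longrightarrow> e' \<in> V2 \<Longrightarrow> e = e'"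
    and one_skeleton: "\<sigma> \<in> C \<Longrightarrow> \<sigma> \<inter> V2 = {} \<Longrightarrow> card \<sigma> \<le> 2"
    and star_finite: "e \<in> V2 \<Longrightarrow> {e} \<in> C \<Longrightarrow> finite {\<sigma> \<in> C. insert e \<sigma> \<in> C}"
    and star_disc: "e \<in> V2 \<Longrightarrow> {e} \<in> C \<Longrightarrow> \<exists>\<Psi> :: real \<times> real \<Rightarrow> 'w \<Rightarrow> real.
      continuous_on (cball 0 1) \<Psi> \<and> inj_on \<Psi> (cball 0 1) \<and>
      \<Psi> ` cball 0 1 = underlying_space {\<sigma> \<in> C. insert e \<sigma> \<in> C} \<and>
      (\<forall>x\<in>cball 0 1. \<Psi> x e = 0 \<longleftrightarrow> norm x = 1)"
begin

text \<open>
  Every collapse removes one of the finitely many 2-cells that the sphere meets and brings in no new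
  one; a sphere that meets none lies in the 1-skeleton.
\<close>

lemma avoid_null_sphere:
  assumes free: "\<And>F. finite F \<Longrightarrow> F \<noteq> {} \<Longrightarrow> F \<subseteq> V2 \<Longrightarrow> (\<forall>e\<in>F. {e} \<in> C) \<Longrightarrow>
      \<exists>e\<in>F. \<exists>a. a \<noteq> e \<and> {a, e} \<in> C \<and> (\<forall>\<sigma>\<in>C. \<sigma> \<inter> V2 \<subseteq> F \<longrightarrow> a \<in> \<sigma> \<longrightarrow> insert e \<sigma> \<in> C)"
    and F: "finite F" "F \<subseteq> V2" "\<forall>e\<in>F. {e} \<in> C"
    and f: "tame {\<sigma> \<in> C. \<sigma> \<inter> V2 \<subseteq> F} square f" "collapses_boundary f"
  shows "null_sphere (realization C) f"
  using F f
proof (induction "card F" arbitrary: F f)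
  case (0 F f)
  then have "F = {}" by simp
  have "null_sphere (realization {\<sigma> \<in> C. \<sigma> \<inter> V2 \<subseteq> F}) f"
  proof (rule graph_null_sphere)
    show "simplicial {\<sigma> \<in> C. \<sigma> \<inter> V2 \<subseteq> F}" using C unfolding simplicial_def by blast
    show "card \<sigma> \<le> 2" if "\<sigma> \<in> {\<sigma> \<in> C. \<sigma> \<inter> V2 \<subseteq> F}" for \<sigma> using one_skeleton that \<open>F = {}\<close> by auto
  qed (use 0 in auto)
  then show ?case by (rule null_sphere_subcomplex[rotated]) auto
next
  case (Suc n F f)
  then have "F \<noteq> {}" by auto
  then obtain e a where ea: "e \<in> F" "a \<noteq> e" "{a, e} \<in> C" "\<And>\<sigma>. \<sigma> \<in> C \<Longrightarrow> \<sigma> \<inter> V2 \<subseteq> F \<Longrightarrow> a \<in> \<sigma> \<Longrightarrow> insert e \<sigma> \<in> C"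
    using free[OF Suc.prems(1) _ Suc.prems(2,3)] by blast
  let ?M = "{\<sigma> \<in> C. \<sigma> \<inter> V2 \<subseteq> F}"
  have M: "simplicial ?M" using C unfolding simplicial_def by blast
  have e: "e \<in> V2" "{e} \<in> C" using ea(1) Suc.prems(2,3) by auto
  have insF: "insert e \<sigma> \<inter> V2 \<subseteq> F" if "\<sigma> \<inter> V2 \<subseteq> F" for \<sigma> using that ea(1) by blast
  have star: "{\<sigma> \<in> ?M. insert e \<sigma> \<in> ?M} = {\<sigma> \<in> C. insert e \<sigma> \<in> C}"
  proof -
    have "\<sigma> \<inter> V2 \<subseteq> F" if "insert e \<sigma> \<in> C" for \<sigma>
    proof
      fix w assume w: "w \<in> \<sigma> \<inter> V2"
      then have "w = e" using at_most_one[OF that, of w e] e(1) by blast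
      then show "w \<in> F" using ea(1) by simp
    qed
    then show ?thesis using insF by blast
  qed
  obtain \<Psi> :: "real \<times> real \<Rightarrow> 'w \<Rightarrow> real" where \<Psi>: "continuous_on (cball 0 1) \<Psi>" "inj_on \<Psi> (cball 0 1)"
    "\<Psi> ` cball 0 1 = underlying_space {\<sigma> \<in> C. insert e \<sigma> \<in> C}" "\<forall>x\<in>cball 0 1. \<Psi> x e = 0 \<longleftrightarrow> norm x = 1"
    using star_disc[OF e] by blast
  have aV: "a \<notin> V2" using at_most_one[OF ea(3), of a e] ea(2) e(1) by auto
  obtain f' where f': "sphere_homotopic (realization ?M) f f'" "tame {\<sigma> \<in> ?M. e \<notin> \<sigma>} square f'" "collapses_boundary f'"
  proof (rule collapse_cell[OF M _ ea(2) _ _ \<Psi>(1,2) _ _ Suc.prems(4,5)])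
    show "{a, e} \<in> ?M" using ea(1,3) aV by auto
    show "insert e \<sigma> \<in> ?M" if "\<sigma> \<in> ?M" "a \<in> \<sigma>" for \<sigma> using that ea(4) insF by auto
    show "finite {\<sigma> \<in> ?M. insert e \<sigma> \<in> ?M}" unfolding star by (rule star_finite[OF e])
    show "\<Psi> ` cball 0 1 = underlying_space {\<sigma> \<in> ?M. insert e \<sigma> \<in> ?M}" unfolding star by (rule \<Psi>(3))
    show "\<Psi> x e = 0 \<longleftrightarrow> norm x = 1" if "x \<in> cball 0 1" for x using \<Psi>(4) that by blast
  qed
  have "tame {\<sigma> \<in> C. \<sigma> \<inter> V2 \<subseteq> F - {e}} square f'" by (rule tame_mono[OF f'(2)]) blast
  moreover have "n = card (F - {e})" using Suc.hyps(2) Suc.prems(1) ea(1) by simp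
  ultimately have "null_sphere (realization C) f'"
    using Suc.hyps(1)[of "F - {e}" f'] Suc.prems(1-3) f'(3) by blast
  moreover have "sphere_homotopic (realization C) f f'"
    by (rule sphere_homotopic_subcomplex[OF _ f'(1)]) auto
  ultimately show ?case by (rule null_sphere_step[rotated])
qed

lemma free_null_sphere:
  assumes free: "\<And>F. finite F \<Longrightarrow> F \<noteq> {} \<Longrightarrow> F \<subseteq> V2 \<Longrightarrow> (\<forall>e\<in>F. {e} \<in> C) \<Longrightarrow>
      \<exists>e\<in>F. \<exists>a. a \<noteq> e \<and> {a, e} \<in> C \<and> (\<forall>\<sigma>\<in>C. \<sigma> \<inter> V2 \<subseteq> F \<longrightarrow> a \<in> \<sigma> \<longrightarrow> insert e \<sigma> \<in> C)"
    and f: "tame C square f" "collapses_boundary f"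
  shows "null_sphere (realization C) f"
proof -
  obtain J where J: "continuous_on square f" "finite J" "J \<subseteq> C" "simplicial J" "f ` square \<subseteq> underlying_space J"
    using tameE[OF f(1) C] .
  show ?thesis
  proof (rule avoid_null_sphere[OF free, where F = "V2 \<inter> \<Union>J"])
    show "finite (V2 \<inter> \<Union>J)" using J(2) simplicialD(1)[OF J(4)] by auto
    show "\<forall>e\<in>V2 \<inter> \<Union>J. {e} \<in> C"
    proof
      fix e assume "e \<in> V2 \<inter> \<Union>J"
      then obtain \<sigma> where "e \<in> \<sigma>" "\<sigma> \<in> J" by blast
      then show "{e} \<in> C" using simplicialD(3)[OF C, of \<sigma> "{e}"] J(3) by blast
    qed
    show "tame {\<sigma> \<in> C. \<sigma> \<inter> V2 \<subseteq> V2 \<inter> \<Union>J} square f"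
      by (rule tameI[OF J(1,2) _ J(5)]) (use J(3) in blast)
  qed (use f in auto)
qed

end

context simplicial_cover
begin

lemma push_space:
  assumes z: "z \<in> underlying_space C" shows "push p z \<in> underlying_space K"
proof -
  have s: "supp z \<in> C" using z by (simp add: space_iff[OF C])
  have f: "finite (supp z)" by (rule simplicialD(1)[OF C s])
  have "z \<in> closed_simplex (supp z)" using z unfolding closed_simplex_iff[OF f] space_iff[OF C] by blast
  then have "push p z \<in> closed_simplex (p ` supp z)" by (rule push_closed_simplex(2)[OF f])
  then show ?thesis using down[OF s] by (auto simp: underlying_space_def)
qed

lemma above_self:
  assumes z: "z \<in> underlying_space C" shows "above z (push p z)"
proof -
  have s: "supp z \<in> C" using z by (simp add: space_iff[OF C])
  have one: "push p z (p w) = z w" if w: "w \<in> supp z" for w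
  proof -
    have "{u. z u \<noteq> 0 \<and> p u = p w} = {w}"
      using inj_onD[OF inj[OF s]] w by auto
    then show ?thesis by (simp add: push_def)
  qed
  have "supp (push p z) = p ` supp z"
  proof
    show "supp (push p z) \<subseteq> p ` supp z"
    proof
      fix v assume "v \<in> supp (push p z)"
      then have "{w. z w \<noteq> 0 \<and> p w = v} \<noteq> {}" by (auto simp: push_def simp del: Collect_empty_eq)
      then show "v \<in> p ` supp z" by auto
    qed
    show "p ` supp z \<subseteq> supp (push p z)" using one by auto
  qed
  then show ?thesis using s one by (auto simp: above_def)
qed

lemma star_finite_lift:
  assumes w: "{w} \<in> C" and fin: "finite {\<sigma> \<in> K. insert (p w) \<sigma> \<in> K}"
  shows "finite {u. {w, u} \<in> C}" "finite {\<sigma> \<in> C. insert w \<sigma> \<in> C}"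
proof -
  have "p ` {u. {w, u} \<in> C} \<subseteq> \<Union>{\<sigma> \<in> K. insert (p w) \<sigma> \<in> K}"
  proof (rule image_subsetI)
    fix u assume "u \<in> {u. {w, u} \<in> C}"
    then have "{p w, p u} \<in> K" using down[of "{w, u}"] by simp
    then show "p u \<in> \<Union>{\<sigma> \<in> K. insert (p w) \<sigma> \<in> K}" by (intro UnionI[of "{p w, p u}"]) auto
  qed
  moreover have "finite (\<Union>{\<sigma> \<in> K. insert (p w) \<sigma> \<in> K})" using fin simplicialD(1)[OF K] by auto
  ultimately have "finite (p ` {u. {w, u} \<in> C})" by (rule finite_subset)
  moreover have "inj_on p {u. {w, u} \<in> C}" using edge_unique by (intro inj_onI) auto
  ultimately show N: "finite {u. {w, u} \<in> C}" by (rule finite_imageD)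
  have "{\<sigma> \<in> C. insert w \<sigma> \<in> C} \<subseteq> Pow {u. {w, u} \<in> C}"
    using simplicialD(3)[OF C] by auto
  then show "finite {\<sigma> \<in> C. insert w \<sigma> \<in> C}" using N by (meson finite_Pow_iff finite_subset)
qed

lemma star_disc_lift:
  fixes \<Psi> :: "'d::topological_space \<Rightarrow> 'v \<Rightarrow> real"
  assumes w: "{w} \<in> C" and fin: "finite {\<sigma> \<in> K. insert (p w) \<sigma> \<in> K}"
    and \<Psi>: "continuous_on D \<Psi>" "inj_on \<Psi> D" "\<Psi> ` D = underlying_space {\<sigma> \<in> K. insert (p w) \<sigma> \<in> K}"
  shows "continuous_on D (\<lambda>x. sheet w (\<Psi> x))" "inj_on (\<lambda>x. sheet w (\<Psi> x)) D"
    "(\<lambda>x. sheet w (\<Psi> x)) ` D = underlying_space {\<sigma> \<in> C. insert w \<sigma> \<in> C}"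
    "\<And>y. sheet w y w = y (p w)"
proof -
  let ?S = "{\<sigma> \<in> K. insert (p w) \<sigma> \<in> K}" and ?T = "{\<sigma> \<in> C. insert w \<sigma> \<in> C}"
  have S: "simplicial ?S" and T: "simplicial ?T" by (rule star_simplicial[OF K] star_simplicial[OF C])+
  have \<Psi>S: "\<Psi> x \<in> underlying_space K" "insert (p w) (supp (\<Psi> x)) \<in> K" if "x \<in> D" for x
  proof -
    have "\<Psi> x \<in> underlying_space ?S" using \<Psi>(3) that by blast
    then show "\<Psi> x \<in> underlying_space K" "insert (p w) (supp (\<Psi> x)) \<in> K"
      by (simp_all add: space_iff[OF S] space_iff[OF K])
  qed
  have "tame K D \<Psi>" by (rule tameI[OF \<Psi>(1) fin]) (use \<Psi>(3) in auto)
  then have "tame C D (\<lambda>x. sheet w (\<Psi> x))" by (rule tame_sheet[OF _ w \<Psi>S(2)])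
  then show "continuous_on D (\<lambda>x. sheet w (\<Psi> x))" by (simp add: tame_def)
  have ab: "above (sheet w (\<Psi> x)) (\<Psi> x)" "insert w (supp (sheet w (\<Psi> x))) \<in> C" if "x \<in> D" for x
    using sheet_above[OF w \<Psi>S[OF that]] by blast+
  show "inj_on (\<lambda>x. sheet w (\<Psi> x)) D"
  proof (rule inj_onI)
    fix x y assume xy: "x \<in> D" "y \<in> D" "sheet w (\<Psi> x) = sheet w (\<Psi> y)"
    have "\<Psi> x = push p (sheet w (\<Psi> x))" by (rule above_push[OF ab(1)[OF xy(1)], symmetric])
    also have "\<dots> = push p (sheet w (\<Psi> y))" by (simp only: xy(3))
    also have "\<dots> = \<Psi> y" by (rule above_push[OF ab(1)[OF xy(2)]])
    finally have "\<Psi> x = \<Psi> y" .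
    then show "x = y" using inj_onD[OF \<Psi>(2)] xy(1,2) by blast
  qed
  show "(\<lambda>x. sheet w (\<Psi> x)) ` D = underlying_space ?T"
  proof
    show "(\<lambda>x. sheet w (\<Psi> x)) ` D \<subseteq> underlying_space ?T"
    proof (rule image_subsetI)
      fix x assume x: "x \<in> D"
      have "sheet w (\<Psi> x) \<in> underlying_space C" by (rule above_space[OF ab(1)[OF x] \<Psi>S(1)[OF x]])
      then show "sheet w (\<Psi> x) \<in> underlying_space ?T"
        using ab(2)[OF x] by (simp add: space_iff[OF T] space_iff[OF C])
    qed
    show "underlying_space ?T \<subseteq> (\<lambda>x. sheet w (\<Psi> x)) ` D"
    proof
      fix z assume "z \<in> underlying_space ?T"
      then have z: "z \<in> underlying_space C" "insert w (supp z) \<in> C"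
        by (simp_all add: space_iff[OF T] space_iff[OF C])
      have a: "above z (push p z)" by (rule above_self[OF z(1)])
      have "insert (p w) (supp (push p z)) = p ` insert w (supp z)" using a by (simp add: above_def)
      then have "insert (p w) (supp (push p z)) \<in> K" using down[OF z(2)] by simp
      then have "push p z \<in> underlying_space ?S"
        using push_space[OF z(1)] by (simp add: space_iff[OF S] space_iff[OF K])
      then obtain x where x: "x \<in> D" "push p z = \<Psi> x" unfolding \<Psi>(3)[symmetric] by blast
      have "z = sheet w (\<Psi> x)" unfolding x(2)[symmetric] by (rule sheet_unique[OF a z(2)])
      then show "z \<in> (\<lambda>x. sheet w (\<Psi> x)) ` D" using x(1) by (rule image_eqI)
    qed
  qed
  show "sheet w y w = y (p w)" for y using w by (simp add: sheet_def)
qed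

text \<open>
  A closed star is contained in a single sheet, so it is carried over to the cover unchanged.
\<close>

lemma two_complex_lift:
  assumes "two_complex K V2" shows "two_complex C {w. p w \<in> V2}"
proof -
  interpret B: two_complex K V2 by (rule assms)
  show ?thesis
  proof
    show "simplicial C" by (rule C)
    show "e = e'" if "\<sigma> \<in> C" "e \<in> \<sigma>" "e' \<in> \<sigma>" "e \<in> {w. p w \<in> V2}" "e' \<in> {w. p w \<in> V2}" for \<sigma> e e'
      using B.at_most_one[OF down[OF that(1)], of "p e" "p e'"] that inj_onD[OF inj[OF that(1)], of e e'] by auto
    show "card \<sigma> \<le> 2" if "\<sigma> \<in> C" "\<sigma> \<inter> {w. p w \<in> V2} = {}" for \<sigma>
      using B.one_skeleton[OF down[OF that(1)]] that card_image[OF inj[OF that(1)]] by auto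
    fix e assume e: "e \<in> {w. p w \<in> V2}" "{e} \<in> C"
    have pe: "p e \<in> V2" "{p e} \<in> K" using e down[OF e(2)] by auto
    have fin: "finite {\<sigma> \<in> K. insert (p e) \<sigma> \<in> K}" by (rule B.star_finite[OF pe])
    show "finite {\<sigma> \<in> C. insert e \<sigma> \<in> C}" by (rule star_finite_lift(2)[OF e(2) fin])
    obtain \<Psi> :: "real \<times> real \<Rightarrow> 'v \<Rightarrow> real" where \<Psi>: "continuous_on (cball 0 1) \<Psi>" "inj_on \<Psi> (cball 0 1)"
      "\<Psi> ` cball 0 1 = underlying_space {\<sigma> \<in> K. insert (p e) \<sigma> \<in> K}" "\<forall>x\<in>cball 0 1. \<Psi> x (p e) = 0 \<longleftrightarrow> norm x = 1"
      using B.star_disc[OF pe] by blast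
    show "\<exists>\<Psi> :: real \<times> real \<Rightarrow> 'w \<Rightarrow> real. continuous_on (cball 0 1) \<Psi> \<and> inj_on \<Psi> (cball 0 1) \<and>
        \<Psi> ` cball 0 1 = underlying_space {\<sigma> \<in> C. insert e \<sigma> \<in> C} \<and> (\<forall>x\<in>cball 0 1. \<Psi> x e = 0 \<longleftrightarrow> norm x = 1)"
      using star_disc_lift[OF e(2) fin \<Psi>(1-3)] \<Psi>(4) by (intro exI[of _ "\<lambda>x. sheet e (\<Psi> x)"]) simp
  qed
qed

end

section \<open>Free faces in the universal cover\<close>

text \<open>
  The set \<open>E\<close> consists of the barycentres of the edges with exactly two adjacent 2-cells. The last
  assumption is the hypothesis on fundamental groups, in the form of a loop in the component of \<open>e\<close>.
\<close>

locale two_sided_complex = based_complex K b + base: two_complex K V2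
  for K :: "'v set set" and b :: 'v and V2 :: "'v set" +
  fixes E :: "'v set"
  assumes two_cofaces: "a \<in> E \<Longrightarrow> \<exists>e1 e2. e1 \<noteq> e2 \<and> {e \<in> V2. {a, e} \<in> K} = {e1, e2}"
    and flag_at_edge: "a \<in> E \<Longrightarrow> \<sigma> \<in> K \<Longrightarrow> a \<in> \<sigma> \<Longrightarrow> \<sigma> \<inter> V2 = {} \<Longrightarrow> e \<in> V2 \<Longrightarrow> {a, e} \<in> K \<Longrightarrow> insert e \<sigma> \<in> K"
    and edges_apart: "a \<in> E \<Longrightarrow> a' \<in> E \<Longrightarrow> {a, a'} \<in> K \<Longrightarrow> a = a'"
    and infinite_order: "e \<in> V2 \<Longrightarrow> {e} \<in> K \<Longrightarrow> \<exists>x l c. path_at l x x \<and>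
        (\<forall>t\<in>{0..1}. supp (l t) \<in> full_subcomplex K (V2 \<union> E)) \<and> (\<forall>n>0. \<not> homotopic K (loop_power l n) (\<lambda>_. x)) \<and>
        c \<in> supp x \<and> (e, c) \<in> {(c, d). {c, d} \<in> full_subcomplex K (V2 \<union> E)}\<^sup>*"
begin

abbreviation L :: "'v set set" where
  "L \<equiv> full_subcomplex K (V2 \<union> E)"

lemma L_sub: "L \<subseteq> K"
  by (auto simp: full_subcomplex_def)

lemma L_simplicial: "simplicial L"
  by (rule simplicial_full_subcomplex[OF K])

interpretation U: simplicial_cover endpoint universal_cover K by (rule universal_cover_cover)

lemma reach_lift:
  assumes "(e, c) \<in> {(c, d). {c, d} \<in> L}\<^sup>*" "\<kappa> \<in> fibre (vertex e)"
  shows "\<exists>\<mu>\<in>fibre (vertex c). (\<kappa>, \<mu>) \<in> (steps L)\<^sup>*"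
  using assms(1)
proof (induction rule: rtrancl_induct)
  case base
  then show ?case using assms(2) by blast
next
  case (step c d)
  then obtain \<mu> where m: "\<mu> \<in> fibre (vertex c)" "(\<kappa>, \<mu>) \<in> (steps L)\<^sup>*" by blast
  have cd: "{c, d} \<in> L" using step by simp
  then have "{c, d} \<in> K" using L_sub by blast
  then have "transport \<mu> (edge c d) \<in> fibre (vertex d)" by (rule transport_fibre[OF m(1) path_at_edge])
  moreover have "(\<kappa>, transport \<mu> (edge c d)) \<in> (steps L)\<^sup>*"
    using m(2) stepsI[OF m(1) cd] by (rule rtrancl_into_rtrancl)
  ultimately show ?case by blast
qed

lemma steps_edge:
  assumes "(\<kappa>, \<kappa>') \<in> steps L"
  shows "{\<kappa>, \<kappa>'} \<in> universal_cover" "{endpoint \<kappa>, endpoint \<kappa>'} \<in> L"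
proof -
  obtain d where d: "\<kappa>' = extend \<kappa> d" "\<kappa> \<in> fibre (vertex (endpoint \<kappa>))" "{endpoint \<kappa>, d} \<in> L"
    using assms unfolding steps_def by blast
  have dK: "{endpoint \<kappa>, d} \<in> K" using d(3) L_sub by blast
  have "extend \<kappa> ` {endpoint \<kappa>, d} \<in> universal_cover" by (rule universal_coverI[OF d(2) dK]) simp
  then show "{\<kappa>, \<kappa>'} \<in> universal_cover" using extend_self[OF d(2)] d(1) by simp
  show "{endpoint \<kappa>, endpoint \<kappa>'} \<in> L" using extend_fibre(2)[OF d(2) dK] d(1,3) by simp
qed

text \<open>
  Otherwise \<open>F\<close> together with its two-sided edges would be closed under steps in the preimage of \<open>L\<close>. But
  this set is finite, as 2-cells have finitely many faces, whereas infinitely many vertices can be reached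
  from each 2-cell.
\<close>

lemma free_face:
  assumes F: "finite F" "F \<noteq> {}" "F \<subseteq> {\<kappa>. endpoint \<kappa> \<in> V2}" "\<forall>\<kappa>\<in>F. {\<kappa>} \<in> universal_cover"
  shows "\<exists>e\<in>F. \<exists>a. a \<noteq> e \<and> {a, e} \<in> universal_cover \<and>
    (\<forall>\<sigma>\<in>universal_cover. \<sigma> \<inter> {\<kappa>. endpoint \<kappa> \<in> V2} \<subseteq> F \<longrightarrow> a \<in> \<sigma> \<longrightarrow> insert e \<sigma> \<in> universal_cover)"
proof (rule ccontr)
  assume no: "\<not> ?thesis"
  define N where "N = F \<union> {a. endpoint a \<in> E \<and> (\<exists>\<kappa>\<in>F. {\<kappa>, a} \<in> universal_cover)}"
  have "finite {a. {\<kappa>, a} \<in> universal_cover}" if "\<kappa> \<in> F" for \<kappa>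
  proof (rule U.star_finite_lift(1))
    show "{\<kappa>} \<in> universal_cover" using F(4) that by blast
    then have "{endpoint \<kappa>} \<in> K" using U.down[of "{\<kappa>}"] by simp
    then show "finite {\<sigma> \<in> K. insert (endpoint \<kappa>) \<sigma> \<in> K}" using F(3) that by (intro base.star_finite) auto
  qed
  then have "finite (\<Union>\<kappa>\<in>F. {a. {\<kappa>, a} \<in> universal_cover})" using F(1) by blast
  then have finN: "finite N"
    unfolding N_def using F(1) by (auto elim!: finite_subset[rotated])
  have closed: "\<kappa>' \<in> N" if k: "\<kappa> \<in> N" "(\<kappa>, \<kappa>') \<in> steps L" for \<kappa> \<kappa>'
  proof (rule ccontr)
    assume out: "\<kappa>' \<notin> N"
    have e: "{\<kappa>, \<kappa>'} \<in> universal_cover" "{endpoint \<kappa>, endpoint \<kappa>'} \<in> K" "endpoint \<kappa>' \<in> V2 \<union> E"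
      using steps_edge[OF k(2)] by (auto simp: full_subcomplex_def)
    have same: "\<kappa> = \<kappa>'" if "endpoint \<kappa> = endpoint \<kappa>'" by (rule inj_onD[OF U.inj[OF e(1)] that]) simp_all
    have ne: "endpoint \<kappa> \<noteq> endpoint \<kappa>'"
    proof
      assume "endpoint \<kappa> = endpoint \<kappa>'"
      then have "\<kappa> = \<kappa>'" by (rule same)
      then show False using k(1) out by simp
    qed
    show False
    proof (cases "\<kappa> \<in> F")
      case True
      then have "endpoint \<kappa>' \<notin> V2" using base.at_most_one[OF e(2), of "endpoint \<kappa>" "endpoint \<kappa>'"] F(3) ne by auto
      then have "endpoint \<kappa>' \<in> E" using e(3) by blast
      then show False using out True e(1) unfolding N_def by blast
    next
      case False
      then obtain \<kappa>0 where a: "endpoint \<kappa> \<in> E" and \<kappa>0: "\<kappa>0 \<in> F" "{\<kappa>0, \<kappa>} \<in> universal_cover" using k(1) unfolding N_def by blast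
      have "endpoint \<kappa>' \<notin> E" using edges_apart[OF a _ e(2)] ne by blast
      then have V': "endpoint \<kappa>' \<in> V2" using e(3) by blast
      have V0: "endpoint \<kappa>0 \<in> V2" using \<kappa>0(1) F(3) by blast
      have e0: "{\<kappa>, \<kappa>0} \<in> universal_cover" "{endpoint \<kappa>, endpoint \<kappa>0} \<in> K"
        using \<kappa>0(2) U.down[OF \<kappa>0(2)] by (simp_all add: insert_commute)
      have "\<kappa>' \<noteq> \<kappa>0" using out \<kappa>0(1) unfolding N_def by blast
      then have "endpoint \<kappa>' \<noteq> endpoint \<kappa>0" using U.edge_unique[OF e(1) e0(1)] by blast
      moreover have "endpoint \<kappa>' \<in> {e \<in> V2. {endpoint \<kappa>, e} \<in> K}" "endpoint \<kappa>0 \<in> {e \<in> V2. {endpoint \<kappa>, e} \<in> K}"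
        using V' V0 e(2) e0(2) by auto
      moreover obtain e1 e2 where "{e \<in> V2. {endpoint \<kappa>, e} \<in> K} = {e1, e2}" using two_cofaces[OF a] by blast
      ultimately have cof: "{e \<in> V2. {endpoint \<kappa>, e} \<in> K} = {endpoint \<kappa>', endpoint \<kappa>0}" by auto
      \<comment> \<open>Only one of the two 2-cells at the edge \<open>\<kappa>\<close> belongs to \<open>F\<close>, namely \<open>\<kappa>0\<close>, so the edge is free.\<close>
      have "insert \<kappa>0 \<sigma> \<in> universal_cover"
        if s: "\<sigma> \<in> universal_cover" "\<sigma> \<inter> {\<kappa>. endpoint \<kappa> \<in> V2} \<subseteq> F" "\<kappa> \<in> \<sigma>" for \<sigma>
      proof (cases "\<sigma> \<inter> {\<kappa>. endpoint \<kappa> \<in> V2} = {}")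
        case True
        then have "endpoint ` \<sigma> \<inter> V2 = {}" by blast
        then have ins: "insert (endpoint \<kappa>0) (endpoint ` \<sigma>) \<in> K"
          using s(3) by (intro flag_at_edge[OF a U.down[OF s(1)] _ _ V0 e0(2)]) auto
        have "{\<kappa>} \<in> universal_cover" using simplicialD(3)[OF universal_cover_simplicial s(1), of "{\<kappa>}"] s(3) by blast
        then obtain \<tau> where t: "\<tau> \<in> universal_cover" "\<kappa> \<in> \<tau>" "endpoint ` \<tau> = insert (endpoint \<kappa>0) (endpoint ` \<sigma>)"
          using U.lift_ex[OF _ ins, of \<kappa>] s(3) by blast
        let ?\<tau> = "{w \<in> \<tau>. endpoint w \<in> endpoint ` \<sigma>}"
        have "endpoint ` ?\<tau> = endpoint ` \<sigma>"
        proof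
          show "endpoint ` \<sigma> \<subseteq> endpoint ` ?\<tau>"
          proof
            fix v assume v: "v \<in> endpoint ` \<sigma>"
            then have "v \<in> endpoint ` \<tau>" unfolding t(3) by blast
            then obtain w where "w \<in> \<tau>" "v = endpoint w" by blast
            then show "v \<in> endpoint ` ?\<tau>" using v by blast
          qed
        qed blast
        moreover have k\<tau>: "\<kappa> \<in> ?\<tau>" using t(2) s(3) by blast
        moreover have "?\<tau> \<in> universal_cover" using k\<tau> by (intro simplicialD(3)[OF universal_cover_simplicial t(1)]) blast+
        ultimately have "?\<tau> = \<sigma>" using U.lift_unique[of ?\<tau> \<sigma> \<kappa>] s(1,3) by blast
        then have sub: "\<sigma> \<subseteq> \<tau>" by blast
        have "endpoint \<kappa>0 \<in> endpoint ` \<tau>" unfolding t(3) by blast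
        then obtain w where w: "w \<in> \<tau>" "endpoint w = endpoint \<kappa>0" by force
        have "{\<kappa>, w} \<in> universal_cover" using simplicialD(3)[OF universal_cover_simplicial t(1), of "{\<kappa>, w}"] t(2) w(1) by blast
        then have "w = \<kappa>0" using U.edge_unique[OF _ e0(1) w(2)] by blast
        then have "insert \<kappa>0 \<sigma> \<subseteq> \<tau>" using w(1) sub by blast
        then show ?thesis using simplicialD(3)[OF universal_cover_simplicial t(1), of "insert \<kappa>0 \<sigma>"] by blast
      next
        case False
        then obtain w where w: "w \<in> \<sigma>" "endpoint w \<in> V2" "w \<in> F" using s(2) by blast
        have kw: "{\<kappa>, w} \<in> universal_cover" using simplicialD(3)[OF universal_cover_simplicial s(1), of "{\<kappa>, w}"] s(3) w(1) by blast
        then have "{endpoint \<kappa>, endpoint w} \<in> K" using U.down[OF kw] by simp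
        then have "endpoint w \<in> {endpoint \<kappa>', endpoint \<kappa>0}" unfolding cof[symmetric] using w(2) by blast
        moreover have "endpoint w \<noteq> endpoint \<kappa>'" using U.edge_unique[OF kw e(1)] w(3) out unfolding N_def by blast
        ultimately have "w = \<kappa>0" using U.edge_unique[OF kw e0(1)] by blast
        then show ?thesis using s(1) w(1) by (simp add: insert_absorb)
      qed
      moreover have "\<kappa> \<noteq> \<kappa>0" using \<kappa>0(1) False by blast
      ultimately show False using no \<kappa>0(1) e0(1) by blast
    qed
  qed
  have stay: "\<kappa>' \<in> N" if "(\<kappa>, \<kappa>') \<in> (steps L)\<^sup>*" "\<kappa> \<in> N" for \<kappa> \<kappa>'
    using that by (induction rule: rtrancl_induct) (use closed in auto)
  obtain \<kappa> where k: "\<kappa> \<in> F" using F(2) by blast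
  then have kU: "{\<kappa>} \<in> universal_cover" "endpoint \<kappa> \<in> V2" using F(3,4) by auto
  have kf: "\<kappa> \<in> fibre (vertex (endpoint \<kappa>))" using universal_cover_star(1)[OF kU(1)] by simp
  have "{endpoint \<kappa>} \<in> K" using U.down[OF kU(1)] by simp
  then obtain x l c where l: "path_at l x x" "\<forall>t\<in>{0..1}. supp (l t) \<in> L" "\<forall>n>0. \<not> homotopic K (loop_power l n) (\<lambda>_. x)"
    "c \<in> supp x" "(endpoint \<kappa>, c) \<in> {(c, d). {c, d} \<in> L}\<^sup>*"
    using infinite_order[OF kU(2)] by blast
  obtain \<mu> where m: "\<mu> \<in> fibre (vertex c)" "(\<kappa>, \<mu>) \<in> (steps L)\<^sup>*" using reach_lift[OF l(5) kf] by blast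
  have "\<mu> \<in> N" using stay[OF m(2)] k by (simp add: N_def)
  then have "{\<kappa>'. (\<mu>, \<kappa>') \<in> (steps L)\<^sup>*} \<subseteq> N" using stay by blast
  then have "finite {\<kappa>'. (\<mu>, \<kappa>') \<in> (steps L)\<^sup>*}" using finN by (rule finite_subset)
  moreover have "infinite {\<kappa>'. (\<mu>, \<kappa>') \<in> (steps L)\<^sup>*}"
    by (rule infinite_reachable[OF L_sub L_simplicial l(1) _ _ l(4) m(1)]) (use l(2,3) in auto)
  ultimately show False by blast
qed

theorem null_sphere_based:
  assumes f: "tame K square f" "collapses_boundary f" "f (0, 0) b \<noteq> 0"
  shows "null_sphere (realization K) f"
proof (rule U.null_sphere_downstairs[OF f(1,2) base_vertex(2)])
  show "f (0, 0) (endpoint (path_class (\<lambda>_. vertex b))) \<noteq> 0" using f(3) base_vertex(3) by simp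
  interpret T: two_complex universal_cover "{\<kappa>. endpoint \<kappa> \<in> V2}"
    by (rule U.two_complex_lift) (rule base.two_complex_axioms)
  fix g assume g: "tame universal_cover square g" "collapses_boundary g"
  show "null_sphere (realization universal_cover) g"
    by (rule T.free_null_sphere[OF free_face g])
qed

end

section \<open>The fundamental group of a simplicial complex\<close>

abbreviation I01 :: "real topology" where
  "I01 \<equiv> top_of_set {0..1}"

lemma based_class_eq:
  "homotopic_with (\<lambda>h. \<forall>t\<in>B. h t = x) D Y f g \<Longrightarrow> based_class D B Y x f = based_class D B Y x g"
  unfolding based_class_def using homotopic_with_trans homotopic_with_symD by blast

lemma based_class_realization:
  fixes K :: "'v set set"
  assumes K: "simplicial K" and f: "f 0 = x" "f 1 = x"
  shows "based_class I01 {0, 1} (realization K) x f = {g. homotopic K f g}"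
proof (intro Set.set_eqI iffI)
  fix g assume "g \<in> based_class I01 {0, 1} (realization K) x f"
  then obtain k where k: "continuous_map (prod_topology I01 I01) (realization K) k"
    "\<forall>t. k (0, t) = f t" "\<forall>t. k (1, t) = g t" "\<forall>s\<in>{0..1}. \<forall>t\<in>{0, 1}. k (s, t) = x"
    by (auto simp: based_class_def homotopic_with_def)
  have "continuous_map (top_of_set ({0..1} \<times> {0..1})) (realization K) k" using k(1) by simp
  then have "tame K ({0..1} \<times> {0..1}) k"
    by (rule continuous_map_imp_tame[OF K compact_Times[OF compact_Icc compact_Icc]])
  then obtain J where J: "continuous_on ({0..1} \<times> {0..1}) k" "finite J" "J \<subseteq> K" "k ` ({0..1} \<times> {0..1}) \<subseteq> underlying_space J"
    by (auto simp: tame_def)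
  have "homotopic_paths (underlying_space J) f g"
    unfolding homotopic_paths
    by (rule exI[of _ k]) (use J k f in \<open>auto simp: pathstart_def pathfinish_def\<close>)
  then show "g \<in> {g. homotopic K f g}" using J by (auto simp: homotopic_def)
next
  fix g assume "g \<in> {g. homotopic K f g}"
  then obtain J where J: "finite J" "J \<subseteq> K" "homotopic_paths (underlying_space J) f g" by (auto simp: homotopic_def)
  have "continuous_map (top_of_set (underlying_space J)) (realization K) (\<lambda>y. y)"
    using J by (intro continuous_map_into_realization[where J = J]) auto
  then have "homotopic_with (\<lambda>h. \<forall>t\<in>{0, 1}. h t = x) I01 (realization K) ((\<lambda>y. y) \<circ> f) ((\<lambda>y. y) \<circ> g)"
    by (rule homotopic_with_compose_continuous_map_left[OF J(3)[unfolded homotopic_paths_def]])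
       (use f in \<open>auto simp: pathstart_def pathfinish_def\<close>)
  then show "g \<in> based_class I01 {0, 1} (realization K) x f" by (simp add: based_class_def o_def)
qed

lemma interval_cat_eq: "interval_cat f g = f +++ g"
  by (simp add: interval_cat_def joinpaths_def)

lemma loop_power_ends:
  assumes "pathstart l = x" "pathfinish l = x"
  shows "pathstart (loop_power l n) = x" "pathfinish (loop_power l n) = x"
  by (induction n) (use assms in \<open>simp_all add: pathstart_def pathfinish_def joinpaths_def\<close>)

lemma loop_power_homotopic_refl:
  assumes K: "simplicial K" and l: "homotopic K l l" "pathstart l = x" "pathfinish l = x"
  shows "homotopic K (loop_power l n) (loop_power l n)"
proof (induction n)
  case 0
  have "x \<in> underlying_space K" using tame_values[of K "{0..1}" l 0] l by (simp add: homotopic_refl_iff pathstart_def)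
  then show ?case using homotopic_const_refl[OF K] l(2) by simp
next
  case (Suc n)
  then show ?case using homotopic_join[OF Suc l(1)] loop_power_ends[OF l(2,3)] l(2) by simp
qed

lemma fundamental_group_pow:
  fixes K :: "'v set set"
  assumes K: "simplicial K" and l: "homotopic K l l" "pathstart l = x" "pathfinish l = x"
  shows "{g. homotopic K l g} [^]\<^bsub>fundamental_group (realization K) x\<^esub> (n::nat) = {g. homotopic K (loop_power l n) g}"
proof (induction n)
  case 0
  then show ?case
    using based_class_realization[OF K, of "\<lambda>_. x" x] l(2)
    by (simp add: nat_pow_def fundamental_group_def based_group_def)
next
  case (Suc n)
  let ?a = "{g. homotopic K (loop_power l n) g}" and ?b = "{g. homotopic K l g}"
  have lp: "homotopic K (loop_power l n) (loop_power l n)" by (rule loop_power_homotopic_refl[OF K l])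
  have e: "pathstart (loop_power l n) = x" "pathfinish (loop_power l n) = x" using loop_power_ends[OF l(2,3)] by auto
  have cat: "based_class I01 {0, 1} (realization K) x (interval_cat f g) = {h. homotopic K (loop_power l n +++ l) h}"
    if "f \<in> ?a" "g \<in> ?b" for f g
  proof -
    have fg: "homotopic K (loop_power l n) f" "homotopic K l g" using that by auto
    have h: "homotopic K (loop_power l n +++ l) (f +++ g)" using homotopic_join[OF fg] e l(2) by simp
    have "(f +++ g) 0 = x" "(f +++ g) 1 = x"
      using homotopic_ends[OF h] e l by (simp_all add: pathstart_def pathfinish_def joinpaths_def)
    then have "based_class I01 {0, 1} (realization K) x (interval_cat f g) = {h. homotopic K (f +++ g) h}"
      unfolding interval_cat_eq by (rule based_class_realization[OF K])
    also have "\<dots> = {h. homotopic K (loop_power l n +++ l) h}"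
      using h homotopic_trans homotopic_sym by blast
    finally show ?thesis .
  qed
  have "?b [^]\<^bsub>fundamental_group (realization K) x\<^esub> Suc n = ?a \<otimes>\<^bsub>fundamental_group (realization K) x\<^esub> ?b"
    using Suc by (simp add: nat_pow_def)
  also have "\<dots> = (\<Union>f\<in>?a. \<Union>g\<in>?b. based_class I01 {0, 1} (realization K) x (interval_cat f g))"
    by (simp add: fundamental_group_def based_group_def)
  also have "\<dots> = (\<Union>f\<in>?a. \<Union>g\<in>?b. {h. homotopic K (loop_power l n +++ l) h})"
    using cat by (intro SUP_cong refl) blast+
  also have "\<dots> = {h. homotopic K (loop_power l (Suc n)) h}"
    using lp l(1) by auto
  finally show ?case .
qed

lemma infinite_order_loop:
  fixes K :: "'v set set"
  assumes K: "simplicial K" and a: "a \<in> fundamental_group_induced (realization K) x id ` carrier (fundamental_group (subtopology (realization K) M) x)"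
    and inf: "has_infinite_order (fundamental_group (realization K) x) a"
  obtains l where "homotopic K l l" "pathstart l = x" "pathfinish l = x" "l ` {0..1} \<subseteq> M"
    "\<And>n. n > 0 \<Longrightarrow> \<not> homotopic K (loop_power l n) (\<lambda>_. x)"
proof -
  let ?R = "realization K"
  obtain l where l: "continuous_map I01 (subtopology ?R M) l" "\<forall>t\<in>{0, 1}. l t = x"
    "a = fundamental_group_induced ?R x id (based_class I01 {0, 1} (subtopology ?R M) x l)"
    using a by (auto simp: fundamental_group_def based_group_def based_maps_def)
  have cl: "continuous_map I01 ?R l" "l ` {0..1} \<subseteq> M" using l(1) by (auto simp: continuous_map_in_subtopology)
  have hl: "homotopic K l l" unfolding homotopic_refl_iff by (rule continuous_map_imp_tame[OF K compact_Icc cl(1)])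
  have ends: "l 0 = x" "l 1 = x" "pathstart l = x" "pathfinish l = x" using l(2) by (auto simp: pathstart_def pathfinish_def)
  have cls: "based_class I01 {0, 1} ?R x f = {g. homotopic K l g}"
    if "f \<in> based_class I01 {0, 1} (subtopology ?R M) x l" for f
  proof -
    have "homotopic_with (\<lambda>h. \<forall>t\<in>{0, 1}. h t = x) I01 (subtopology ?R M) l f" using that by (simp add: based_class_def)
    then have "homotopic_with (\<lambda>h. \<forall>t\<in>{0, 1}. h t = x) I01 ?R (id \<circ> l) (id \<circ> f)"
      by (rule homotopic_with_compose_continuous_map_left) (auto intro: continuous_map_from_subtopology)
    then have "based_class I01 {0, 1} ?R x l = based_class I01 {0, 1} ?R x f" by (intro based_class_eq) simp
    then show ?thesis using based_class_realization[OF K ends(1,2)] by simp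
  qed
  have "l \<in> based_class I01 {0, 1} (subtopology ?R M) x l" using l(1,2) by (simp add: based_class_def)
  then have a_eq: "a = {g. homotopic K l g}"
    unfolding l(3) fundamental_group_induced_def using cls by auto
  have "\<not> homotopic K (loop_power l n) (\<lambda>_. x)" if "n > 0" for n
  proof
    assume h: "homotopic K (loop_power l n) (\<lambda>_. x)"
    have "a [^]\<^bsub>fundamental_group ?R x\<^esub> n = {g. homotopic K (loop_power l n) g}"
      unfolding a_eq by (rule fundamental_group_pow[OF K hl ends(3,4)])
    also have "\<dots> = {g. homotopic K (\<lambda>_. x) g}" using h homotopic_trans homotopic_sym by blast
    also have "\<dots> = \<one>\<^bsub>fundamental_group ?R x\<^esub>"
      using based_class_realization[OF K, of "\<lambda>_. x" x] by (simp add: fundamental_group_def based_group_def)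
    finally show False using inf that unfolding has_infinite_order_def by blast
  qed
  then show ?thesis using that hl ends(3,4) cl(2) by blast
qed

text \<open>
  Being carried by vertices that can be reached from \<open>e\<close> is an open condition, and so is its negation.
\<close>

lemma component_reachable:
  fixes L :: "'v set set"
  assumes L: "simplicial L" "L \<subseteq> K"
    and M: "connectedin (subtopology (realization K) (underlying_space L)) M" "vertex e \<in> M" "x \<in> M" "c \<in> supp x"
  shows "(e, c) \<in> {(c, d). {c, d} \<in> L}\<^sup>*"
proof -
  let ?Y = "subtopology (realization K) (underlying_space L)"
  define S where "S = {c. (e, c) \<in> {(c, d). {c, d} \<in> L}\<^sup>*}"
  have ope: "openin ?Y {y \<in> topspace ?Y. \<exists>v\<in>T. y v \<noteq> 0}" for T
  proof -
    have "open {y :: 'v \<Rightarrow> real. y v \<noteq> 0}" for v by (intro open_Collect_neq continuous_intros) simp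
    then have "open (\<Union>v\<in>T. {y :: 'v \<Rightarrow> real. y v \<noteq> 0})" by blast
    then have "openin ?Y {y \<in> topspace ?Y. y \<in> (\<Union>v\<in>T. {y. y v \<noteq> 0})}"
      by (intro openin_continuous_map_preimage[OF continuous_map_from_subtopology[OF continuous_map_realization_euclidean]]) simp
    moreover have "{y \<in> topspace ?Y. y \<in> (\<Union>v\<in>T. {y. y v \<noteq> 0})} = {y \<in> topspace ?Y. \<exists>v\<in>T. y v \<noteq> 0}" by auto
    ultimately show ?thesis by simp
  qed
  let ?U = "{y \<in> topspace ?Y. \<exists>v\<in>S. y v \<noteq> 0}" and ?V = "{y \<in> topspace ?Y. \<exists>v\<in>- S. y v \<noteq> 0}"
  have MY: "M \<subseteq> topspace ?Y" using M(1) by (rule connectedin_subset_topspace)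
  have yL: "supp y \<in> L" if "y \<in> topspace ?Y" for y
    using that by (simp add: space_iff[OF L(1)])
  have same: "d \<in> S" if "supp y \<in> L" "c \<in> supp y" "d \<in> supp y" "c \<in> S" for y c d
  proof -
    have "{c, d} \<in> L" by (rule simplicialD(3)[OF L(1) that(1)]) (use that in auto)
    then show ?thesis using that(4) unfolding S_def by (auto intro: rtrancl_into_rtrancl)
  qed
  have disj: "?U \<inter> ?V \<inter> M = {}"
  proof (rule ccontr)
    assume "?U \<inter> ?V \<inter> M \<noteq> {}"
    then obtain y v w where "y \<in> topspace ?Y" "v \<in> S" "y v \<noteq> 0" "w \<notin> S" "y w \<noteq> 0" by blast
    then show False using same[OF yL, of y v w] by simp
  qed
  have cover: "M \<subseteq> ?U \<union> ?V"
  proof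
    fix y assume "y \<in> M"
    then have y: "y \<in> topspace ?Y" using MY by blast
    obtain v where "v \<in> supp y" using simplicialD(2)[OF L(1) yL[OF y]] by blast
    then show "y \<in> ?U \<union> ?V" using y by (cases "v \<in> S") auto
  qed
  have eU: "vertex e \<in> ?U \<inter> M"
    using M(2) MY by (auto simp: S_def vertex_def)
  have "?V \<inter> M = {}"
    using M(1) ope[of S] ope[of "- S"] cover disj eU unfolding connectedin by (metis (no_types, lifting) empty_iff)
  then have "x \<in> ?U" using cover M(3) by blast
  then obtain v where "v \<in> S" "v \<in> supp x" by auto
  moreover have "supp x \<in> L" using yL MY M(3) by blast
  ultimately have "c \<in> S" using same M(4) by blast
  then show ?thesis by (simp add: S_def)
qed

section \<open>Asphericity\<close>

context regular_CW_surface
begin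

lemma same_dim_eq:
  assumes "\<sigma> \<in> K'" "c \<in> \<sigma>" "d \<in> \<sigma>" "c \<in> cells n" "d \<in> cells n" shows "c = d"
  using K'_comparable[OF assms(1-3)] face_dim[OF assms(4,5)] face_dim[OF assms(5,4)] by blast

lemma two_complex_K': "two_complex K' (cells 2)"
proof
  show "simplicial K'" by (rule simplicial_K')
  show "e = e'" if "\<sigma> \<in> K'" "e \<in> \<sigma>" "e' \<in> \<sigma>" "e \<in> cells 2" "e' \<in> cells 2" for \<sigma> e e'
    using same_dim_eq that by blast
  show "card \<sigma> \<le> 2" if s: "\<sigma> \<in> K'" "\<sigma> \<inter> cells 2 = {}" for \<sigma>
  proof -
    have fin: "finite \<sigma>" using simplicialD(1)[OF simplicial_K' s(1)] .
    have one: "card (\<sigma> \<inter> cells n) \<le> 1" for n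
      unfolding One_nat_def using same_dim_eq[OF s(1)] fin by (subst card_le_Suc0_iff_eq) auto
    have "\<sigma> \<subseteq> (\<sigma> \<inter> cells 0) \<union> (\<sigma> \<inter> cells 1)"
    proof
      fix c assume c: "c \<in> \<sigma>"
      then obtain n where n: "c \<in> cells n" using K'_cell[OF s(1)] by blast
      then have "n \<noteq> 2" using s(2) c by blast
      then have "n = 0 \<or> n = 1" using cell_dim_le_2[OF n] by linarith
      then show "c \<in> (\<sigma> \<inter> cells 0) \<union> (\<sigma> \<inter> cells 1)" using c n by blast
    qed
    then have "card \<sigma> \<le> card ((\<sigma> \<inter> cells 0) \<union> (\<sigma> \<inter> cells 1))" using fin by (intro card_mono) auto
    also have "\<dots> \<le> card (\<sigma> \<inter> cells 0) + card (\<sigma> \<inter> cells 1)" by (rule card_Un_le)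
    also have "\<dots> \<le> 2" using one[of 0] one[of 1] by linarith
    finally show ?thesis .
  qed
  fix e assume e: "e \<in> cells 2"
  show "finite {\<sigma> \<in> K'. insert e \<sigma> \<in> K'}" by (rule disc_star(5)[OF e])
  show "\<exists>\<Psi> :: real \<times> real \<Rightarrow> 'a set \<Rightarrow> real. continuous_on (cball 0 1) \<Psi> \<and> inj_on \<Psi> (cball 0 1) \<and>
      \<Psi> ` cball 0 1 = underlying_space {\<sigma> \<in> K'. insert e \<sigma> \<in> K'} \<and> (\<forall>x\<in>cball 0 1. \<Psi> x e = 0 \<longleftrightarrow> norm x = 1)"
    using disc_star(1-4)[OF e] by (intro exI[of _ "star_disc_map e"]) blast
qed

definition two_sided_edges :: "'a set set" where
  "two_sided_edges = {a \<in> cells 1. card {f \<in> cells 2. face_of_cell X a f} = 2}"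

lemma coface_iff:
  assumes "a \<in> cells 1" "f \<in> cells 2" shows "{a, f} \<in> K' \<longleftrightarrow> face_of_cell X a f"
proof -
  have "\<not> f \<subseteq> X closure_of a"
  proof
    assume "f \<subseteq> X closure_of a"
    then have "f = a" using face_dim[OF assms(2,1)] by simp
    moreover obtain p where "p \<in> a" using cell_nonempty[OF assms(1)] by blast
    ultimately show False using cell_unique[OF assms, of p] by simp
  qed
  then show ?thesis
    using assms cell_in_closure[OF assms(1)] cell_in_closure[OF assms(2)]
    by (auto simp: K'_iff face_of_cell_def)
qed

lemma null_sphere_K':
  assumes loops: "\<And>M. M \<in> connected_components_of (subtopology (realization K') (underlying_space (two_sided_subcomplex X cells))) \<Longrightarrow>
      \<exists>x\<in>M. \<exists>a \<in> fundamental_group_induced (realization K') x id ` carrier (fundamental_group (subtopology (realization K') M) x).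
        has_infinite_order (fundamental_group (realization K') x) a"
    and f: "tame K' square f" "collapses_boundary f"
  shows "null_sphere (realization K') f"
proof -
  let ?L = "full_subcomplex K' (cells 2 \<union> two_sided_edges)"
  have L_eq: "two_sided_subcomplex X cells = ?L" by (simp add: two_sided_subcomplex_def two_sided_edges_def)
  have L_sub: "?L \<subseteq> K'" by (auto simp: full_subcomplex_def)
  have L: "simplicial ?L" by (rule simplicial_full_subcomplex[OF simplicial_K'])
  have "f (0, 0) \<in> underlying_space K'" by (rule tame_values[OF f(1)]) (simp add: square_def)
  then obtain b where b: "f (0, 0) b > 0" "b \<in> supp (f (0, 0))" and "supp (f (0, 0)) \<in> K'"
    using space_supp_nonempty[OF simplicial_K'] by (metis space_iff[OF simplicial_K'])
  then have bK: "{b} \<in> K'" using simplicialD(3)[OF simplicial_K', of "supp (f (0, 0))" "{b}"] by blast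
  have fb: "f (0, 0) b \<noteq> 0" using b(1) by simp
  interpret two_complex K' "cells 2" by (rule two_complex_K')
  interpret based_complex K' b using simplicial_K' bK by unfold_locales
  interpret two_sided_complex K' b "cells 2" two_sided_edges
  proof
    show "\<exists>e1 e2. e1 \<noteq> e2 \<and> {e \<in> cells 2. {a, e} \<in> K'} = {e1, e2}" if "a \<in> two_sided_edges" for a
    proof -
      have a: "a \<in> cells 1" "card {f \<in> cells 2. face_of_cell X a f} = 2" using that by (auto simp: two_sided_edges_def)
      have "{e \<in> cells 2. {a, e} \<in> K'} = {f \<in> cells 2. face_of_cell X a f}" using coface_iff[OF a(1)] by blast
      then show ?thesis using a(2) by (metis card_2_iff)
    qed
    show "insert e \<sigma> \<in> K'" if h: "a \<in> two_sided_edges" "\<sigma> \<in> K'" "a \<in> \<sigma>" "\<sigma> \<inter> cells 2 = {}" "e \<in> cells 2" "{a, e} \<in> K'" for a \<sigma> e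
    proof -
      have a: "a \<in> cells 1" using h(1) by (simp add: two_sided_edges_def)
      have ae: "a \<subseteq> X closure_of e" using coface_iff[OF a h(5)] h(6) by (simp add: face_of_cell_def)
      have "c \<subseteq> X closure_of e" if c: "c \<in> \<sigma>" for c
      proof -
        obtain k where k: "c \<in> cells k" using K'_cell[OF h(2) c] by blast
        have k2: "k \<noteq> 2" using k c h(4) by blast
        have "c \<subseteq> X closure_of a"
        proof (cases "c \<subseteq> X closure_of a")
          case False
          then have "a \<subseteq> X closure_of c" using K'_comparable[OF h(2) c h(3)] by blast
          then have "a = c" using face_dim[OF a k] cell_dim_le_2[OF k] k2 by linarith
          then show ?thesis using cell_in_closure[OF a] by simp
        qed
        then show ?thesis using closure_mono'[OF ae] by blast
      qed
      then have "\<sigma> \<in> cell_sd e" using h(2) by (simp add: cell_sd_def)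
      then have "insert e \<sigma> \<in> cell_sd e" by (rule cell_sd_insert[OF h(5)])
      then show ?thesis by (simp add: cell_sd_def)
    qed
    show "a = a'" if "a \<in> two_sided_edges" "a' \<in> two_sided_edges" "{a, a'} \<in> K'" for a a'
      using same_dim_eq[OF that(3), of a a' 1] that(1,2) by (simp add: two_sided_edges_def)
    fix e assume e: "e \<in> cells 2" "{e} \<in> K'"
    let ?Y = "subtopology (realization K') (underlying_space (two_sided_subcomplex X cells))"
    have "{e} \<in> ?L" using e by (simp add: full_subcomplex_def)
    then have "vertex e \<in> underlying_space ?L" using vertex_in_simplex[of "{e}" e] by (auto simp: underlying_space_def)
    then have ve: "vertex e \<in> topspace ?Y"
      using space_mono[OF L_sub] by (auto simp: topspace_realization L_eq)
    define M where "M = connected_component_of_set ?Y (vertex e)"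
    have "M \<in> connected_components_of ?Y" using ve by (simp add: connected_components_of_def M_def)
    then obtain x a where x: "x \<in> M"
      and a: "a \<in> fundamental_group_induced (realization K') x id ` carrier (fundamental_group (subtopology (realization K') M) x)"
        "has_infinite_order (fundamental_group (realization K') x) a"
      using loops by blast
    obtain l where l: "homotopic K' l l" "pathstart l = x" "pathfinish l = x" "l ` {0..1} \<subseteq> M"
      "\<And>n. n > 0 \<Longrightarrow> \<not> homotopic K' (loop_power l n) (\<lambda>_. x)"
      using infinite_order_loop[OF simplicial_K' a] by blast
    have conM: "connectedin (subtopology (realization K') (underlying_space ?L)) M"
      unfolding M_def L_eq[symmetric] by (rule connectedin_connected_component_of)
    have eM: "vertex e \<in> M" using ve by (simp add: M_def connected_component_of_refl)
    have M_supp: "supp y \<in> ?L" if "y \<in> M" for y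
    proof -
      have "y \<in> underlying_space ?L" using connectedin_subset_topspace[OF conM] that by auto
      then show ?thesis by (simp add: space_iff[OF L])
    qed
    obtain c where c: "c \<in> supp x" using simplicialD(2)[OF L M_supp[OF x]] by blast
    have "(e, c) \<in> {(c, d). {c, d} \<in> ?L}\<^sup>*" by (rule component_reachable[OF L L_sub conM eM x c])
    moreover have "path_at l x x" using l by (simp add: path_at_def)
    moreover have "\<forall>t\<in>{0..1}. supp (l t) \<in> ?L" using l(4) M_supp by blast
    ultimately show "\<exists>x l c. path_at l x x \<and> (\<forall>t\<in>{0..1}. supp (l t) \<in> ?L) \<and> (\<forall>n>0. \<not> homotopic K' (loop_power l n) (\<lambda>_. x)) \<and>
        c \<in> supp x \<and> (e, c) \<in> {(c, d). {c, d} \<in> ?L}\<^sup>*"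
      using l(5) c by blast
  qed
  show ?thesis by (rule null_sphere_based[OF f fb])
qed

text \<open>
  The sphere is moved to the subdivision, contracted there without a base point, and moved back; the
  free contraction is then replaced by a based one.
\<close>

lemma aspherical_if_null:
  assumes "\<And>f. tame K' square f \<Longrightarrow> collapses_boundary f \<Longrightarrow> null_sphere (realization K') f"
  shows "aspherical X"
  unfolding aspherical_def
proof
  fix x assume x: "x \<in> topspace X"
  let ?D = "top_of_set square"
  let ?cls = "based_class ?D square_boundary X x"
  have eq: "?cls f = ?cls (\<lambda>_. x)" if "f \<in> based_maps ?D square_boundary X x" for f
  proof -
    have f: "continuous_map ?D X f" "\<And>t. t \<in> square_boundary \<Longrightarrow> f t = x" using that by (auto simp: based_maps_def)
    have "continuous_map ?D (realization K') (to_sd \<circ> f)" by (rule continuous_map_compose[OF f(1) to_sd_continuous])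
    then have "tame K' square (to_sd \<circ> f)" by (rule continuous_map_imp_tame[OF simplicial_K' compact_square])
    moreover have "collapses_boundary (to_sd \<circ> f)" using f(2) by (auto simp: collapses_boundary_def)
    ultimately have "null_sphere (realization K') (to_sd \<circ> f)" by (rule assms)
    then have "null_sphere X (of_sd \<circ> (to_sd \<circ> f))" using of_sd_continuous by (rule null_sphere_push)
    moreover have "sphere_homotopic X f (of_sd \<circ> (to_sd \<circ> f))"
      unfolding sphere_homotopic_def
    proof (rule homotopic_with_equal)
      show "collapses_boundary f" "collapses_boundary (of_sd \<circ> (to_sd \<circ> f))" using f(2) by (auto simp: collapses_boundary_def)
      show "f t = (of_sd \<circ> (to_sd \<circ> f)) t" if "t \<in> topspace ?D" for t
        using of_sd_to_sd[of "f t"] continuous_map_image_subset_topspace[OF f(1)] that by auto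
    qed (rule f(1))
    ultimately have "null_sphere X f" by (rule null_sphere_step[rotated])
    then have "homotopic_with (\<lambda>h. \<forall>t\<in>square_boundary. h t = x) ?D X f (\<lambda>_. x)"
      using f(2) by (rule null_sphere_imp_based)
    then show ?thesis by (rule based_class_eq)
  qed
  have "(\<lambda>_. x) \<in> based_maps ?D square_boundary X x" using x by (simp add: based_maps_def)
  then have "?cls ` based_maps ?D square_boundary X x = {?cls (\<lambda>_. x)}" using eq by blast
  then show "carrier (second_homotopy_group X x) = {\<one>\<^bsub>second_homotopy_group X x\<^esub>}"
    by (simp add: second_homotopy_group_def based_group_def square_def square_boundary_def)
qed

end

theorem theorem3p1:
  fixes X :: "'a topology" and cells :: "nat \<Rightarrow> 'a set set"
  defines "K' \<equiv> realization (barycentric_subdivision X cells)"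
    and "L \<equiv> underlying_space (two_sided_subcomplex X cells)"
  assumes "regular_CW_complex X cells"
    and "two_dimensional cells"
    and "connected_space X"
    and "\<And>M. M \<in> connected_components_of (subtopology K' L) \<Longrightarrow>
           \<exists>x\<in>M. \<exists>a \<in> fundamental_group_induced K' x id ` carrier (fundamental_group (subtopology K' M) x).
             has_infinite_order (fundamental_group K' x) a"
  shows "aspherical X"
proof -
  have "regular_CW_surface X cells"
    using assms(3,4) by (intro regular_CW_surface.intro regular_CW_surface_axioms.intro) (auto simp: two_dimensional_def)
  then interpret regular_CW_surface X cells .
  show ?thesis
    by (rule aspherical_if_null, rule null_sphere_K') (use assms(6) in \<open>auto simp: K'_def L_def\<close>)
qed

end
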